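(* Let $n\ge 3$, let $z_1,\dots,z_{n-1}\in\mathbb{C}$ be distinct with $z_{n-2}=0$, $z_{n-1}=1$, let $z_n=\infty$, and let $X=\mathbb{C}\setminus\{z_1,\dots,z_{n-1}\}$. Let $c_1,\dots,c_{n-1}\in\mathbb{C}$ satisfy $\sum_{i=1}^{n-1}c_i=0$ and $\sum_{i=1}^{n-1}z_ic_i=1-\frac n2$, and suppose that the equation $$\frac{d^{2}u}{dz^{2}}+\frac{1}{2}\sum_{i=1}^{n-1}\left(\frac{1}{2(z-z_{i})^{2}}+\frac{c_{i}}{z-z_{i}}\right)u=0$$ has a real monodromy group. Let $\eta$ be a ratio of two linearly independent solutions whose branches are related by elements of $\mathrm{PSL}(2,\mathbb{R})$, and define $\varphi$ by $$e^{\varphi(z)}=\frac{|\eta'(z)|^{2}}{(\operatorname{Im}\eta(z))^{2}}.$$ Then the following hold. (i) The set $\eta^{-1}(\mathbb{R}\cup\{\infty\})\subset X$ is a disjoint union of finitely many (possibly zero) simple closed analytic curves in $X$. (ii) On the complement of these curves in $X$ the function $\varphi$ is well defined and satisfies the Liouville equation $\varphi_{z\bar z}=\frac12e^{\varphi}$. It has the asymptotic behavior $$\varphi(z)=\begin{cases}-2\log|z-z_{i}|-2\log|\log|z-z_{i}||+o(1), & z\to z_i,\ i\neq n,\\ -2\log|z|-2\log\log|z|+o(1), & z\to\infty.\end{cases}$$ (iii) Let $C$ be one of these curves, with Schwarz function $S$, and let $z_0\in C$. Then, as $z\to z_0$ along any direction not tangent to $C$, $$e^{\varphi(z)}=-\frac{4S'(z_{0})}{\left(\bar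 z-\bar z_{0}-S'(z_{0})(z-z_{0})\right)^{2}}\,\bigl(1+O(|z-z_{0}|)\bigr).$$
   Context: The ratio of two linearly independent solutions of the equation is a multi-valued locally univalent map from $X$ to $\mathbb{P}^1(\mathbb{C})$. Its branches are related by fractional linear transformations forming the (projectivized) monodromy group in $\mathrm{PSL}(2,\mathbb{C})$. The monodromy group is called *real* if it is conjugate in $\mathrm{PSL}(2,\mathbb{C})$ to a subgroup of $\mathrm{PSL}(2,\mathbb{R})$; then $\eta$ can be chosen so that its branches are related by elements of $\mathrm{PSL}(2,\mathbb{R})$. For a simple closed analytic curve $C\subset\mathbb{C}$, its Schwarz function $S$ is the holomorphic function in a neighbourhood of $C$ such that $C$ is given by the equation $\bar z=S(z)$. Locally, in terms of a branch of $\eta$ mapping an arc of $C$ into $\mathbb{R}$, $S=\bar\eta^{-1}\circ\eta$, where $\bar\eta^{-1}(z)=\overline{\eta^{-1}(\bar z)}$. *)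

theory Defs
  imports "HOL-Complex_Analysis.Complex_Analysis" "HOL-Library.Landau_Symbols"
begin

section \<open>The Riemann sphere and the groups PSL(2,C), PSL(2,R)\<close>

text \<open>Points of the complex projective line: \<^term>\<open>None\<close> is the point at infinity.\<close>
type_synonym riemann_sphere = "complex option"

text \<open>The point with homogeneous coordinates \<open>[a : b]\<close>, for \<open>(a, b) \<noteq> (0, 0)\<close>.\<close>
definition proj_ratio :: "complex \<Rightarrow> complex \<Rightarrow> riemann_sphere" where
  "proj_ratio a b = (if b = 0 then None else Some (a / b))"

definition real_line :: "riemann_sphere set" where
  "real_line = insert None (Some ` \<real>)"

fun moebius :: "complex \<Rightarrow> complex \<Rightarrow> complex \<Rightarrow> complex \<Rightarrow> riemann_sphere \<Rightarrow> riemann_sphere" where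
  "moebius a b c d None = proj_ratio a c"
| "moebius a b c d (Some w) = proj_ratio (a * w + b) (c * w + d)"

text \<open>The projective groups, realised as groups (under composition) of fractional linear
  transformations of the sphere.\<close>
definition PSL2C :: "(riemann_sphere \<Rightarrow> riemann_sphere) set" where
  "PSL2C = {moebius a b c d | a b c d. a * d - b * c = 1}"

definition PSL2R :: "(riemann_sphere \<Rightarrow> riemann_sphere) set" where
  "PSL2R = {moebius (of_real a) (of_real b) (of_real c) (of_real d) | a b c d :: real.
              a * d - b * c = 1}"

section \<open>Analytic continuation and multi-valued ratios\<close>

text \<open>\<open>F t\<close> represents a germ of an analytic function at \<open>\<gamma> t\<close>.\<close>
definition continuation_along :: "(real \<Rightarrow> complex) \<Rightarrow> (real \<Rightarrow> complex \<Rightarrow> complex) \<Rightarrow> bool" where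
  "continuation_along \<gamma> F \<longleftrightarrow>
     (\<forall>t\<in>{0..1}. F t analytic_on {\<gamma> t} \<and>
        (\<forall>\<^sub>F s in at t within {0..1}. \<forall>\<^sub>F x in nhds (\<gamma> s). F s x = F t x))"

text \<open>A multi-valued map from \<open>X\<close> to the sphere is given by the set of its branches at each point;
  a branch at \<open>w\<close> is a function of which only the germ at \<open>w\<close> matters. The following is the
  multi-valued map \<open>u1 / u2\<close> on \<open>X\<close>, where \<open>u1\<close>, \<open>u2\<close> are initial germs at \<open>p\<close> that are continued
  simultaneously along all paths in \<open>X\<close> starting at \<open>p\<close>.\<close>
type_synonym multivalued_map = "complex \<Rightarrow> (complex \<Rightarrow> riemann_sphere) set"

definition ratio_branches ::
  "complex set \<Rightarrow> complex \<Rightarrow> (complex \<Rightarrow> complex) \<Rightarrow> (complex \<Rightarrow> complex) \<Rightarrow> multivalued_map" where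
  "ratio_branches X p u1 u2 w =
     {f. \<exists>\<gamma> F1 F2. path \<gamma> \<and> path_image \<gamma> \<subseteq> X \<and> pathstart \<gamma> = p \<and> pathfinish \<gamma> = w \<and>
           continuation_along \<gamma> F1 \<and> continuation_along \<gamma> F2 \<and>
           (\<forall>\<^sub>F x in nhds p. F1 0 x = u1 x \<and> F2 0 x = u2 x) \<and>
           (\<forall>\<^sub>F x in nhds w. f x = proj_ratio (F1 1 x) (F2 1 x))}"

definition monodromy_group ::
  "complex set \<Rightarrow> complex \<Rightarrow> (complex \<Rightarrow> complex) \<Rightarrow> (complex \<Rightarrow> complex) \<Rightarrow>
     (riemann_sphere \<Rightarrow> riemann_sphere) set" where
  "monodromy_group X p u1 u2 =
     {m \<in> PSL2C. \<exists>f \<in> ratio_branches X p u1 u2 p.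
        \<forall>\<^sub>F x in nhds p. f x = m (proj_ratio (u1 x) (u2 x))}"

section \<open>The differential equation\<close>

definition punctured_plane :: "nat \<Rightarrow> (nat \<Rightarrow> complex) \<Rightarrow> complex set" where
  "punctured_plane n z = UNIV - z ` {1..n - 1}"

definition solution_near ::
  "nat \<Rightarrow> (nat \<Rightarrow> complex) \<Rightarrow> (nat \<Rightarrow> complex) \<Rightarrow> complex \<Rightarrow> (complex \<Rightarrow> complex) \<Rightarrow> bool" where
  "solution_near n z c p u \<longleftrightarrow>
     (\<exists>U. open U \<and> p \<in> U \<and> U \<subseteq> punctured_plane n z \<and> u holomorphic_on U \<and>
        (\<forall>w\<in>U. deriv (deriv u) w +
           1 / 2 * (\<Sum>i = 1..n - 1. 1 / (2 * (w - z i)\<^sup>2) + c i / (w - z i)) * u w = 0))"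

definition solution_basis ::
  "nat \<Rightarrow> (nat \<Rightarrow> complex) \<Rightarrow> (nat \<Rightarrow> complex) \<Rightarrow> complex \<Rightarrow>
     (complex \<Rightarrow> complex) \<Rightarrow> (complex \<Rightarrow> complex) \<Rightarrow> bool" where
  "solution_basis n z c p u1 u2 \<longleftrightarrow>
     solution_near n z c p u1 \<and> solution_near n z c p u2 \<and>
     (\<forall>a b. (\<forall>\<^sub>F x in nhds p. a * u1 x + b * u2 x = 0) \<longrightarrow> a = 0 \<and> b = 0)"

text \<open>The condition on the monodromy group does not depend on the choice of the base point and of
  the basis: another choice replaces the group by a conjugate.\<close>
definition real_monodromy :: "nat \<Rightarrow> (nat \<Rightarrow> complex) \<Rightarrow> (nat \<Rightarrow> complex) \<Rightarrow> bool" where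
  "real_monodromy n z c \<longleftrightarrow>
     (\<exists>p\<in>punctured_plane n z. \<exists>u1 u2. solution_basis n z c p u1 u2 \<and>
        (\<exists>g\<in>PSL2C. (\<lambda>m. g \<circ> m \<circ> inv g) ` monodromy_group (punctured_plane n z) p u1 u2 \<subseteq> PSL2R))"

definition ratio_of_solutions ::
  "nat \<Rightarrow> (nat \<Rightarrow> complex) \<Rightarrow> (nat \<Rightarrow> complex) \<Rightarrow> multivalued_map \<Rightarrow> bool" where
  "ratio_of_solutions n z c \<eta> \<longleftrightarrow>
     (\<exists>p\<in>punctured_plane n z. \<exists>u1 u2. solution_basis n z c p u1 u2 \<and>
        \<eta> = ratio_branches (punctured_plane n z) p u1 u2)"

definition branches_related_by ::
  "(riemann_sphere \<Rightarrow> riemann_sphere) set \<Rightarrow> multivalued_map \<Rightarrow> bool" where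
  "branches_related_by G \<eta> \<longleftrightarrow>
     (\<forall>w. \<forall>f\<in>\<eta> w. \<forall>g\<in>\<eta> w. \<exists>m\<in>G. \<forall>\<^sub>F x in nhds w. g x = m (f x))"

definition preimage_real_line :: "multivalued_map \<Rightarrow> complex set" where
  "preimage_real_line \<eta> = {w. \<exists>f\<in>\<eta> w. f w \<in> real_line}"

section \<open>The function phi\<close>

text \<open>\<open>r\<close> is the common value at \<open>w\<close> of the function \<open>\<phi>\<close> computed from any branch of \<open>\<eta>\<close>.
  Existence of such an \<open>r\<close> is the well-definedness of \<open>\<phi>\<close> at \<open>w\<close>.\<close>
definition phi_value :: "multivalued_map \<Rightarrow> complex \<Rightarrow> real \<Rightarrow> bool" where
  "phi_value \<eta> w r \<longleftrightarrow> \<eta> w \<noteq> {} \<and>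
     (\<forall>f\<in>\<eta> w. f w \<noteq> None \<and>
        exp r = (cmod (deriv (\<lambda>x. the (f x)) w))\<^sup>2 / (Im (the (f w)))\<^sup>2)"

definition phi :: "multivalued_map \<Rightarrow> complex \<Rightarrow> real" where
  "phi \<eta> w = (THE r. phi_value \<eta> w r)"

definition wirtinger :: "(complex \<Rightarrow> complex) \<Rightarrow> complex \<Rightarrow> complex" where
  "wirtinger f w =
     (frechet_derivative f (at w) 1 - \<i> * frechet_derivative f (at w) \<i>) / 2"

definition wirtinger_bar :: "(complex \<Rightarrow> complex) \<Rightarrow> complex \<Rightarrow> complex" where
  "wirtinger_bar f w =
     (frechet_derivative f (at w) 1 + \<i> * frechet_derivative f (at w) \<i>) / 2"

section \<open>Analytic curves\<close>

definition analytic_parametrization :: "(complex \<Rightarrow> complex) \<Rightarrow> complex set \<Rightarrow> bool" where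
  "analytic_parametrization g C \<longleftrightarrow>
     g analytic_on sphere 0 1 \<and> inj_on g (sphere 0 1) \<and>
     (\<forall>w\<in>sphere 0 1. deriv g w \<noteq> 0) \<and> g ` sphere 0 1 = C"

definition simple_closed_analytic_curve :: "complex set \<Rightarrow> bool" where
  "simple_closed_analytic_curve C \<longleftrightarrow> (\<exists>g. analytic_parametrization g C)"

text \<open>With \<open>w = exp (\<i> \<theta>)\<close>, the velocity of \<open>\<theta> \<mapsto> g (exp (\<i> \<theta>))\<close> is \<open>\<i> * w * deriv g w\<close>.\<close>
definition tangent_to :: "complex \<Rightarrow> complex set \<Rightarrow> complex \<Rightarrow> bool" where
  "tangent_to v C z0 \<longleftrightarrow>
     (\<exists>g w. analytic_parametrization g C \<and> w \<in> sphere 0 1 \<and> g w = z0 \<and>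
        (\<exists>r::real. v = r *\<^sub>R (\<i> * w * deriv g w)))"

definition schwarz_function :: "(complex \<Rightarrow> complex) \<Rightarrow> complex set \<Rightarrow> bool" where
  "schwarz_function S C \<longleftrightarrow>
     (\<exists>U. open U \<and> C \<subseteq> U \<and> S holomorphic_on U \<and> C = {x \<in> U. cnj x = S x})"

text \<open>The filter \<open>F\<close> expresses a variable tending to \<open>z0\<close> along the direction of the unit
  vector \<open>v\<close>, for instance on the ray \<open>z0 + t v\<close> with \<open>t\<close> decreasing to \<open>0\<close>.\<close>
definition approaches_along :: "complex filter \<Rightarrow> complex \<Rightarrow> complex \<Rightarrow> bool" where
  "approaches_along F z0 v \<longleftrightarrow>
     norm v = 1 \<and> filterlim (\<lambda>x. x) (at z0) F \<and> ((\<lambda>x. sgn (x - z0)) \<longlongrightarrow> v) F"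

end

theory Submission
  imports Defs
begin

text \<open>
  Continuing a pair of solutions keeps its Wronskian \<open>W\<close>, and two branches of the ratio that are related by a real
  unimodular substitution come from pairs \<open>(v1, v2)\<close> that are related by the same substitution up to sign. Hence
  \<open>J = Im (v1 cnj v2)\<close> is a single-valued real function on \<open>X\<close>; the real locus is \<open>J = 0\<close> and
  \<open>exp \<phi> = |W|^2 / J^2\<close>. The Liouville equation is a determinant identity for \<open>J\<close>, and the expansion at the
  curves is the first-order Taylor expansion of \<open>J\<close>.

  Near a puncture, in the coordinate \<open>s\<close> with \<open>z - z_i = exp s\<close> (or \<open>z = exp (- s)\<close> at infinity), there is a basis
  with ratio \<open>s + H (exp s)\<close>, \<open>H\<close> holomorphic. So \<open>J\<close> is a nonvanishing factor times a real quadratic polynomial in this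
  ratio, and invariance under \<open>s \<mapsto> s + 2 \<pi> \<i>\<close> forces it to be \<open>k Re (s + H) + D\<close> with \<open>|k| = |W|\<close>. In particular
  \<open>J\<close> has no zeros near the punctures, so the real locus is compact. It is locally conformally a real interval,
  oriented by the sign of \<open>J\<close>; arc length continued holomorphically gives canonical charts, their flow
  is periodic by compactness, and its orbits are the curves.
\<close>

section \<open>Power series solutions\<close>

text \<open>A branch of the ratio determines its pair of solutions only up to a scalar function.
  Fixing the Wronskian leaves a sign, which the Hermitian form does not see; from then on every
  local statement concerns two holomorphic functions with constant Wronskian. The ratio
  \<open>s + H (exp s)\<close> comes from the exponents. With u = exp (\<sigma> s / 2) v the
  equation becomes v'' = R (exp s) v, and R 0 = 0 because the leading coefficient of the potential
  is 1/4: at z_i it is 1/2 times 1/2, at infinity this is what the two conditions on the c_i say. So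
  1/2 is a double exponent: one solution is h (exp s), and reduction of order produces a second one
  that contains s itself. The relation k^2 = |W|^2 is the invariance of the discriminant of a
  Hermitian form; it gives k \<noteq> 0, hence the logarithm in the asymptotics, and leaves no
  unknown constant there. Unit speed and the side where J > 0 leave no freedom in a chart of the
  real locus, so the charts compose like a flow, and periodic orbits take the place of the
  classification of one-dimensional manifolds.\<close>

fun rec_seq :: "(nat \<Rightarrow> nat \<Rightarrow> complex) \<Rightarrow> nat \<Rightarrow> (nat \<Rightarrow> complex) \<Rightarrow> nat \<Rightarrow> complex" where
  "rec_seq c m i k = (if k < m then i k else (\<Sum>j<k. c k j * rec_seq c m i j))"

declare rec_seq.simps [simp del]

text \<open>The method of majorants: with ratio \<open>K * (1 + M)\<close> each of the
  \<open>k\<close> summands is at most \<open>C * L ^ k\<close>, and their number is paid for by the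
  factor \<open>k\<close> on the left.\<close>

lemma rec_seq_bound:
  fixes a :: "nat \<Rightarrow> complex"
  assumes rec: "\<And>k. k \<ge> m \<Longrightarrow> real k * norm (a k) \<le> (\<Sum>j<k. M * K ^ (k - j) * norm (a j))"
    and K: "K > 0" and M: "M \<ge> 0" and m: "m > 0"
  shows "\<exists>C\<ge>0. \<forall>k. norm (a k) \<le> C * (K * (1 + M)) ^ k"
proof -
  define L where "L = K * (1 + M)"
  have L: "L > 0" "L \<ge> K" "M * K \<le> L" using K M by (auto simp: L_def algebra_simps add_pos_nonneg)
  \<comment> \<open>Each of the first \<open>m\<close> values, rescaled, is a summand of
    \<open>C\<close>; this starts the induction.\<close>
  define C where "C = (\<Sum>j<m. norm (a j) / L ^ j)"
  have C0: "C \<ge> 0" unfolding C_def using L by (intro sum_nonneg) auto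
  have "norm (a k) \<le> C * L ^ k" for k
  proof (induction k rule: less_induct)
    case (less k)
    show ?case
    proof (cases "k < m")
      case True
      have "norm (a k) / L ^ k \<le> C"
        unfolding C_def using True L by (intro member_le_sum) auto
      then show ?thesis using L by (simp add: field_simps)
    next
      case False
      then have km: "k \<ge> m" and k: "k > 0" using m by auto
      have "real k * norm (a k) \<le> (\<Sum>j<k. M * K ^ (k - j) * norm (a j))" using rec km by blast
      also have "\<dots> \<le> (\<Sum>j<k. M * C * (K * L ^ (k - 1)))"
      proof (rule sum_mono)
        fix j assume j: "j \<in> {..<k}"
        have "K ^ (k - j) * L ^ j = K * (K ^ (k - 1 - j) * L ^ j)"
        proof -
          have "k - j = Suc (k - 1 - j)" using j by auto
          then show ?thesis by (metis power_Suc mult.assoc)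
        qed
        also have "\<dots> \<le> K * (L ^ (k - 1 - j) * L ^ j)"
          using K L by (intro mult_left_mono mult_right_mono power_mono) auto
        also have "\<dots> = K * L ^ (k - 1)" using j by (simp flip: power_add)
        finally have *: "K ^ (k - j) * L ^ j \<le> K * L ^ (k - 1)" .
        have "M * K ^ (k - j) * norm (a j) \<le> M * K ^ (k - j) * (C * L ^ j)"
          using less j K M by (intro mult_left_mono) auto
        also have "\<dots> = M * C * (K ^ (k - j) * L ^ j)" by simp
        also have "\<dots> \<le> M * C * (K * L ^ (k - 1))"
          using * M C0 by (intro mult_left_mono) auto
        finally show "M * K ^ (k - j) * norm (a j) \<le> M * C * (K * L ^ (k - 1))" .
      qed
      also have "\<dots> = real k * (C * ((M * K) * L ^ (k - 1)))" by simp
      also have "\<dots> \<le> real k * (C * (L * L ^ (k - 1)))"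
        using L C0 by (intro mult_left_mono mult_right_mono) auto
      also have "\<dots> = real k * (C * L ^ k)" using k by (simp flip: power_Suc)
      finally show ?thesis using k by simp
    qed
  qed
  then show ?thesis using C0 unfolding L_def by blast
qed

lemma fps_conv_radius_ge_of_bound:
  fixes a :: "nat \<Rightarrow> complex"
  assumes "\<And>k. norm (a k) \<le> C * L ^ k" "L > 0"
  shows "fps_conv_radius (Abs_fps a) \<ge> ereal (1 / L)"
  unfolding fps_conv_radius_def
proof (rule conv_radius_geI_ex')
  fix r :: real assume r: "0 < r" "ereal r < ereal (1 / L)"
  then have rL: "L * r < 1" using assms(2) by (simp add: field_simps)
  show "summable (\<lambda>n. fps_nth (Abs_fps a) n * of_real r ^ n)"
  proof (rule summable_comparison_test')
    show "summable (\<lambda>n. C * (L * r) ^ n)"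
      using rL r assms(2) by (intro summable_mult summable_geometric) auto
    fix n :: nat assume "n \<ge> 0"
    have "norm (a n * of_real r ^ n) = norm (a n) * r ^ n"
      using r by (simp add: norm_mult norm_power)
    also have "\<dots> \<le> (C * L ^ n) * r ^ n" using assms r by (intro mult_right_mono) auto
    finally show "norm (fps_nth (Abs_fps a) n * of_real r ^ n) \<le> C * (L * r) ^ n"
      by (simp add: power_mult_distrib mult_ac)
  qed
qed

lemma fps_expansion_coeff_bound:
  assumes hol: "q holomorphic_on ball 0 R" and R: "R > 0"
    and B: "\<And>x. x \<in> ball 0 R \<Longrightarrow> norm (q x) \<le> B"
  shows "norm (fps_nth (fps_expansion q 0) k) \<le> B * (2 / R) ^ k"
proof -
  \<comment> \<open>Cauchy's inequality on the circle of radius \<open>R / 2\<close>, which lies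
    inside the open ball where \<open>q\<close> is bounded; hence the 2.\<close>
  have "norm ((deriv ^^ k) q 0) \<le> fact k * B / (R / 2) ^ k"
    using R by (intro Cauchy_inequality holomorphic_on_imp_continuous_on holomorphic_on_subset[OF hol] B)
      auto
  then show ?thesis
    by (simp add: fps_expansion_def norm_divide power_divide field_simps)
qed

lemma eval_fps_on_ball:
  assumes "fps_conv_radius F \<ge> ereal r"
  shows "eval_fps F holomorphic_on ball 0 r"
    and "\<And>x. x \<in> ball 0 r \<Longrightarrow> deriv (eval_fps F) x = eval_fps (fps_deriv F) x"
    and "\<And>x. x \<in> ball 0 r \<Longrightarrow> deriv (deriv (eval_fps F)) x = eval_fps (fps_deriv (fps_deriv F)) x"
proof -
  have *: "ereal (norm x) < fps_conv_radius F" if "x \<in> ball 0 r" for x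
    using that assms by (meson less_ereal.simps(1) mem_ball_0 order_less_le_trans)
  show "eval_fps F holomorphic_on ball 0 r"
    using * by (intro holomorphic_on_eval_fps) (auto simp: dist_norm)
  show 1: "deriv (eval_fps F) x = eval_fps (fps_deriv F) x" if "x \<in> ball 0 r" for x
    using *[OF that] by (simp add: eval_fps_deriv)
  show "deriv (deriv (eval_fps F)) x = eval_fps (fps_deriv (fps_deriv F)) x" if x: "x \<in> ball 0 r" for x
  proof -
    have "deriv (deriv (eval_fps F)) x = deriv (eval_fps (fps_deriv F)) x"
    proof (rule deriv_cong_ev)
      have "\<forall>\<^sub>F y in nhds x. y \<in> ball 0 r" using x by (intro eventually_nhds_in_open) auto
      then show "\<forall>\<^sub>F y in nhds x. deriv (eval_fps F) y = eval_fps (fps_deriv F) y"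
        by eventually_elim (rule 1)
    qed simp
    also have "\<dots> = eval_fps (fps_deriv (fps_deriv F)) x"
      using *[OF x] fps_conv_radius_deriv[of F] by (subst eval_fps_deriv) auto
    finally show ?thesis .
  qed
qed

text \<open>Comparison of coefficients, with convergence by the majorant bound. The radius
  \<open>r\<close> depends only on \<open>R\<close> and \<open>B\<close> and is fixed before the
  initial values, so that two solutions forming a basis live on the same ball.\<close>

lemma linear_ode_at_0:
  assumes hol: "q holomorphic_on ball 0 R" and R: "R > 0" and B0: "B \<ge> 0"
    and B: "\<And>x. x \<in> ball 0 R \<Longrightarrow> norm (q x) \<le> B"
    and r_def: "r = 1 / (2 / R * (1 + B / (2 / R)\<^sup>2))"
  shows "\<exists>u. u holomorphic_on ball 0 r \<and> u 0 = \<alpha> \<and> deriv u 0 = \<beta> \<and>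
             (\<forall>x\<in>ball 0 r. deriv (deriv u) x + q x * u x = 0)"
proof -
  define K where "K = 2 / R"
  \<comment> \<open>The convolution with \<open>q\<close> is shifted by two places, and
    \<open>B * K ^ (k - 2 - j) = M * K ^ (k - j)\<close>.\<close>
  define M where "M = B / K\<^sup>2"
  have K: "K > 0" and M: "M \<ge> 0" using R B0 by (auto simp: K_def M_def)
  define L where "L = K * (1 + M)"
  have L: "L > 0" using K M by (simp add: L_def add_pos_nonneg)
  have r: "r = 1 / L" by (simp add: r_def L_def M_def K_def)
  have rR: "r \<le> R"
  proof -
    have "1 / L \<le> 1 / K" using K M by (intro divide_left_mono) (auto simp: L_def algebra_simps add_pos_nonneg)
    also have "\<dots> \<le> R" using R by (simp add: K_def)
    finally show ?thesis by (simp add: r)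
  qed
  have r0: "r > 0" using L by (simp add: r)
  define Q where "Q = fps_expansion q 0"
  \<comment> \<open>Coefficient k - 2 of u'' + q u = 0, solved for \<open>a k\<close>. The guard
    discards j = k - 1, where truncated subtraction would produce the constant coefficient of
    \<open>q\<close>.\<close>
  define c where "c = (\<lambda>k j. - (if j + 2 \<le> k then fps_nth Q (k - 2 - j) else 0) / (of_nat (k * (k - 1))))"
  define a where "a = rec_seq c 2 (\<lambda>k. if k = 0 then \<alpha> else \<beta>)"
  have a01: "a 0 = \<alpha>" "a 1 = \<beta>" by (simp_all add: a_def rec_seq.simps)
  have arec: "of_nat (k * (k - 1)) * a k = - (\<Sum>j<k. (if j + 2 \<le> k then fps_nth Q (k - 2 - j) else 0) * a j)"
    if "k \<ge> 2" for k
  proof -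
    have "k * (k - 1) \<noteq> 0" using that by auto
    then have nz: "(of_nat (k * (k - 1)) :: complex) \<noteq> 0" by (metis of_nat_eq_0_iff)
    have "a k = (\<Sum>j<k. c k j * a j)" using that by (simp add: a_def rec_seq.simps[of _ _ _ k])
    also have "of_nat (k * (k - 1)) * \<dots> =
       (\<Sum>j<k. - (if j + 2 \<le> k then fps_nth Q (k - 2 - j) else 0) * a j)"
      unfolding sum_distrib_left c_def using nz by (intro sum.cong) auto
    finally show ?thesis by (simp add: sum_negf)
  qed
  have Qb: "norm (fps_nth Q k) \<le> B * K ^ k" for k
    unfolding Q_def K_def by (rule fps_expansion_coeff_bound[OF hol R B])
  have "\<exists>C\<ge>0. \<forall>k. norm (a k) \<le> C * (K * (1 + M)) ^ k"
  proof (rule rec_seq_bound[where m = 2, OF _ K M])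
    fix k :: nat assume k: "k \<ge> 2"
    have "real k * norm (a k) \<le> real (k * (k - 1)) * norm (a k)"
    proof (rule mult_right_mono)
      have "k * 1 \<le> k * (k - 1)" using k by (intro mult_left_mono) auto
      then show "real k \<le> real (k * (k - 1))" by linarith
    qed simp
    also have "\<dots> = norm (of_nat (k * (k - 1)) * a k)" by (simp add: norm_mult del: of_nat_mult)
    also have "\<dots> = norm (\<Sum>j<k. (if j + 2 \<le> k then fps_nth Q (k - 2 - j) else 0) * a j)"
      using arec[OF k] by simp
    also have "\<dots> \<le> (\<Sum>j<k. norm ((if j + 2 \<le> k then fps_nth Q (k - 2 - j) else 0) * a j))"
      by (rule norm_sum)
    also have "\<dots> \<le> (\<Sum>j<k. M * K ^ (k - j) * norm (a j))"
    proof (rule sum_mono)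
      fix j assume "j \<in> {..<k}"
      show "norm ((if j + 2 \<le> k then fps_nth Q (k - 2 - j) else 0) * a j) \<le> M * K ^ (k - j) * norm (a j)"
      proof (cases "j + 2 \<le> k")
        case True
        then have "k - j = 2 + (k - 2 - j)" by simp
          then have "K ^ (k - j) = K\<^sup>2 * K ^ (k - 2 - j)" by (metis power_add)
        then have "M * K ^ (k - j) = B * K ^ (k - 2 - j)" using K by (simp add: M_def)
        then show ?thesis using True Qb[of "k - 2 - j"] by (auto simp: norm_mult intro!: mult_right_mono)
      qed (use K M in auto)
    qed
    finally show "real k * norm (a k) \<le> (\<Sum>j<k. M * K ^ (k - j) * norm (a j))" .
  qed simp
  then obtain C where C: "\<And>k. norm (a k) \<le> C * L ^ k" unfolding L_def by blast
  define F where "F = Abs_fps a"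
  have rad: "fps_conv_radius F \<ge> ereal r"
    unfolding F_def r by (rule fps_conv_radius_ge_of_bound[OF C L])
  have Qrad: "fps_conv_radius Q \<ge> ereal R"
    unfolding Q_def by (rule conv_radius_fps_expansion) (use hol in \<open>auto simp: eball_def ball_def\<close>)
  have formal: "fps_deriv (fps_deriv F) + Q * F = 0"
  proof (rule fps_ext)
    fix k
    have "(\<Sum>j<k + 2. (if j + 2 \<le> k + 2 then fps_nth Q (k + 2 - 2 - j) else 0) * a j)
        = (\<Sum>j\<le>k. fps_nth Q (k - j) * a j)"
      by (rule sum.mono_neutral_cong_right) auto
    also have "\<dots> = fps_nth (F * Q) k"
      unfolding fps_mult_nth F_def atMost_atLeast0 by (intro sum.cong) auto
    finally have "of_nat ((k + 2) * (k + 1)) * a (k + 2) = - fps_nth (F * Q) k"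
      using arec[of "k + 2"] by simp
    moreover have "fps_nth (fps_deriv (fps_deriv F)) k = of_nat ((k + 2) * (k + 1)) * a (k + 2)"
      by (simp add: F_def algebra_simps)
    ultimately show "fps_nth (fps_deriv (fps_deriv F) + Q * F) k = fps_nth 0 k"
      by (simp add: mult.commute)
  qed
  note ev = eval_fps_on_ball[OF rad]
  have ode: "deriv (deriv (eval_fps F)) x + q x * eval_fps F x = 0" if x: "x \<in> ball 0 r" for x
  proof -
    have n1: "ereal (norm x) < fps_conv_radius F"
      using x rad by (meson less_ereal.simps(1) mem_ball_0 order_less_le_trans)
    have n2: "ereal (norm x) < fps_conv_radius Q"
      using x rR Qrad by (meson less_ereal.simps(1) mem_ball_0 order_less_le_trans)
    have n3: "ereal (norm x) < fps_conv_radius (fps_deriv (fps_deriv F))"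
      using n1 fps_conv_radius_deriv[of F] fps_conv_radius_deriv[of "fps_deriv F"] by order
    have n4: "ereal (norm x) < fps_conv_radius (Q * F)"
      using n1 n2 fps_conv_radius_mult[of Q F] by (meson min_less_iff_conj order_less_le_trans)
    have "q x = eval_fps Q x"
      unfolding Q_def using x rR hol by (subst eval_fps_expansion'[where r = R]) auto
    then have "deriv (deriv (eval_fps F)) x + q x * eval_fps F x
        = eval_fps (fps_deriv (fps_deriv F) + Q * F) x"
      using x n1 n2 n3 n4 by (simp add: ev(3) eval_fps_add eval_fps_mult)
    then show ?thesis by (simp add: formal)
  qed
  have "eval_fps F 0 = \<alpha>" by (simp add: eval_fps_at_0 F_def a01)
  moreover have "deriv (eval_fps F) 0 = \<beta>" using ev(2)[of 0] r0 a01 by (simp add: eval_fps_at_0 F_def)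
  ultimately show ?thesis using ev(1) ode by blast
qed

text \<open>The left-hand side of the equation is (y d/dy)^2 applied to \<open>h\<close>. As
  \<open>R 0 = 0\<close>, the indicial polynomial is k^2, so the recursion k^2 a_k = sum of R_(k -
  j) a_j over j < k can be solved for every k > 0, and the value at 0 is free.\<close>

lemma frobenius_double_exponent:
  assumes hol: "R holomorphic_on ball 0 \<rho>" and \<rho>: "\<rho> > 0" and R0: "R 0 = 0"
  shows "\<exists>r h. 0 < r \<and> r \<le> \<rho> \<and> h holomorphic_on ball 0 r \<and> h 0 = 1 \<and> (\<forall>y\<in>ball 0 r. h y \<noteq> 0) \<and>
             (\<forall>y\<in>ball 0 r. y * deriv h y + y\<^sup>2 * deriv (deriv h) y = R y * h y)"
proof -
  \<comment> \<open>Half the radius gives a compact ball, on which \<open>R\<close> is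
    bounded.\<close>
  define \<rho>' where "\<rho>' = \<rho> / 2"
  have \<rho>': "\<rho>' > 0" "\<rho>' < \<rho>" using \<rho> by (auto simp: \<rho>'_def)
  have "compact (R ` cball 0 \<rho>')"
    using \<rho>' by (intro compact_continuous_image holomorphic_on_imp_continuous_on holomorphic_on_subset[OF hol]) auto
  then obtain B where B: "B > 0" "\<And>x. x \<in> cball 0 \<rho>' \<Longrightarrow> norm (R x) \<le> B"
    by (metis compact_imp_bounded bounded_pos imageI)
  have hol': "R holomorphic_on ball 0 \<rho>'" using hol \<rho>' by (rule_tac holomorphic_on_subset) auto
  define K where "K = 2 / \<rho>'"
  have K: "K > 0" using \<rho>' by (auto simp: K_def)
  define L where "L = K * (1 + B)"
  have L: "L > 0" using K B by (simp add: L_def)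
  define r where "r = 1 / L"
  have r\<rho>: "r \<le> \<rho>'"
  proof -
    have "1 / L \<le> 1 / K" using K B by (intro divide_left_mono) (auto simp: L_def algebra_simps add_pos_nonneg)
    also have "\<dots> \<le> \<rho>'" using \<rho>' by (simp add: K_def)
    finally show ?thesis by (simp add: r_def)
  qed
  have r0: "r > 0" using L by (simp add: r_def)
  define Q where "Q = fps_expansion R 0"
  have Q0: "fps_nth Q 0 = 0" by (simp add: Q_def fps_expansion_def R0)
  define c where "c = (\<lambda>k j. fps_nth Q (k - j) / (of_nat k)\<^sup>2)"
  define a where "a = rec_seq c 1 (\<lambda>k. 1)"
  have a0: "a 0 = 1" by (simp add: a_def rec_seq.simps)
  have arec: "(of_nat k)\<^sup>2 * a k = (\<Sum>j<k. fps_nth Q (k - j) * a j)"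
    if "k \<ge> 1" for k
  proof -
    have "a k = (\<Sum>j<k. c k j * a j)" using that by (simp add: a_def rec_seq.simps[of _ _ _ k])
    also have "(of_nat k)\<^sup>2 * \<dots> = (\<Sum>j<k. fps_nth Q (k - j) * a j)"
      unfolding sum_distrib_left c_def using that by (intro sum.cong) auto
    finally show ?thesis .
  qed
  have Qb: "norm (fps_nth Q k) \<le> B * K ^ k" for k
    unfolding Q_def K_def using B by (intro fps_expansion_coeff_bound[OF hol' \<rho>'(1)]) auto
  have "\<exists>C\<ge>0. \<forall>k. norm (a k) \<le> C * (K * (1 + B)) ^ k"
  proof (rule rec_seq_bound[where m = 1, OF _ K])
    fix k :: nat assume k: "k \<ge> 1"
    have "real k * norm (a k) \<le> (real k)\<^sup>2 * norm (a k)"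
      using k by (intro mult_right_mono) (auto simp: power2_eq_square)
    also have "\<dots> = norm ((of_nat k)\<^sup>2 * a k)" by (simp add: norm_mult norm_power)
    also have "\<dots> = norm (\<Sum>j<k. fps_nth Q (k - j) * a j)" using arec[OF k] by simp
    also have "\<dots> \<le> (\<Sum>j<k. norm (fps_nth Q (k - j) * a j))" by (rule norm_sum)
    also have "\<dots> \<le> (\<Sum>j<k. B * K ^ (k - j) * norm (a j))"
      by (intro sum_mono) (auto simp: norm_mult intro!: mult_right_mono Qb)
    finally show "real k * norm (a k) \<le> (\<Sum>j<k. B * K ^ (k - j) * norm (a j))" .
  qed (use B in auto)
  then obtain C where C: "\<And>k. norm (a k) \<le> C * L ^ k" unfolding L_def by blast
  define F where "F = Abs_fps a"
  have rad: "fps_conv_radius F \<ge> ereal r"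
    unfolding F_def r_def by (rule fps_conv_radius_ge_of_bound[OF C L])
  have Qrad: "fps_conv_radius Q \<ge> ereal \<rho>'"
    unfolding Q_def by (rule conv_radius_fps_expansion) (use hol' in \<open>auto simp: eball_def ball_def\<close>)
  have formal: "fps_X * fps_deriv F + fps_X * (fps_X * fps_deriv (fps_deriv F)) = Q * F"
  proof (rule fps_ext)
    fix k
    have "fps_nth (Q * F) k = fps_nth (F * Q) k" by (simp add: mult.commute)
    also have "\<dots> = (\<Sum>j\<le>k. fps_nth Q (k - j) * a j)"
      unfolding fps_mult_nth F_def atMost_atLeast0 by (intro sum.cong) auto
    also have "\<dots> = (\<Sum>j<k. fps_nth Q (k - j) * a j)"
      by (rule sum.mono_neutral_right) (auto simp: Q0 not_less)
    also have "\<dots> = (of_nat k)\<^sup>2 * a k" using arec[of k] by (cases "k = 0") auto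
    also have "\<dots> = fps_nth (fps_X * fps_deriv F + fps_X * (fps_X * fps_deriv (fps_deriv F))) k"
      by (cases k rule: nat.exhaust; cases "k - 1") (auto simp: F_def algebra_simps power2_eq_square)
    finally show "fps_nth (fps_X * fps_deriv F + fps_X * (fps_X * fps_deriv (fps_deriv F))) k = fps_nth (Q * F) k"
      by simp
  qed
  note ev = eval_fps_on_ball[OF rad]
  have ode: "y * deriv (eval_fps F) y + y\<^sup>2 * deriv (deriv (eval_fps F)) y = R y * eval_fps F y"
    if y: "y \<in> ball 0 r" for y
  proof -
    have n1: "ereal (norm y) < fps_conv_radius F"
      using y rad by (meson less_ereal.simps(1) mem_ball_0 order_less_le_trans)
    have n2: "ereal (norm y) < fps_conv_radius Q"
      using y r\<rho> Qrad by (meson less_ereal.simps(1) mem_ball_0 order_less_le_trans)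
    have n3: "ereal (norm y) < fps_conv_radius (fps_deriv F)"
      using n1 fps_conv_radius_deriv[of F] by order
    have n4: "ereal (norm y) < fps_conv_radius (fps_deriv (fps_deriv F))"
      using n3 fps_conv_radius_deriv[of "fps_deriv F"] by order
    have n5: "ereal (norm y) < fps_conv_radius (fps_X * G)"
      if "ereal (norm y) < fps_conv_radius G" for G
      using that fps_conv_radius_mult[of fps_X G] by (simp add: order_less_le_trans)
    have e1: "eval_fps (fps_X * G) y = y * eval_fps G y"
      if "ereal (norm y) < fps_conv_radius G" for G
      using that by (subst eval_fps_mult) auto
    have "R y = eval_fps Q y"
      unfolding Q_def using y r\<rho> hol' by (subst eval_fps_expansion'[where r = \<rho>']) auto
    then have "R y * eval_fps F y = eval_fps (Q * F) y"
      using n1 n2 by (simp add: eval_fps_mult)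
    also have "\<dots> = y * deriv (eval_fps F) y + y * (y * deriv (deriv (eval_fps F)) y)"
      unfolding formal[symmetric] using y
      by (subst eval_fps_add) (auto simp: e1 ev n3 n4 n5)
    finally show ?thesis by (simp add: power2_eq_square mult.assoc)
  qed
  have h0: "eval_fps F 0 = 1" by (simp add: eval_fps_at_0 F_def a0)
  have "isCont (eval_fps F) 0"
    using holomorphic_on_imp_continuous_on[OF ev(1)] r0 by (simp add: continuous_on_eq_continuous_at)
  then have "\<exists>e>0. \<forall>y. dist 0 y < e \<longrightarrow> eval_fps F y \<noteq> 0"
    using h0 by (intro continuous_at_avoid) auto
  then obtain e where e: "e > 0" "\<And>y. dist 0 y < e \<Longrightarrow> eval_fps F y \<noteq> 0" by blast
  show ?thesis
  proof (intro exI conjI ballI)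
    show "eval_fps F holomorphic_on ball 0 (min r e)" using ev(1) by (rule holomorphic_on_subset) auto
  qed (use h0 e r0 ode r\<rho> \<rho>' in auto)
qed

section \<open>Linear equations of second order\<close>

definition solves_on :: "(complex \<Rightarrow> complex) \<Rightarrow> complex set \<Rightarrow> (complex \<Rightarrow> complex) \<Rightarrow> bool" where
  "solves_on q U v \<longleftrightarrow> v holomorphic_on U \<and> (\<forall>x\<in>U. deriv (deriv v) x + q x * v x = 0)"

text \<open>With this sign the derivative of f / g is minus the Wronskian divided by g^2.\<close>

definition wronskian :: "(complex \<Rightarrow> complex) \<Rightarrow> (complex \<Rightarrow> complex) \<Rightarrow> complex \<Rightarrow> complex" where
  "wronskian f g x = f x * deriv g x - deriv f x * g x"

lemma solves_on_subset: "solves_on q U v \<Longrightarrow> V \<subseteq> U \<Longrightarrow> solves_on q V v"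
  by (auto simp: solves_on_def intro: holomorphic_on_subset)

lemma eventually_eq_deriv:
  assumes "\<forall>\<^sub>F x in nhds a. f x = g x"
  shows "\<forall>\<^sub>F x in nhds a. deriv f x = deriv g x"
proof -
  have "\<forall>\<^sub>F y in nhds a. \<forall>\<^sub>F x in nhds y. f x = g x" using assms by (simp add: eventually_eventually)
  then show ?thesis by eventually_elim (rule deriv_cong_ev, auto)
qed

lemma solves_on_cong:
  assumes "open U" "solves_on q U v" "\<And>x. x \<in> U \<Longrightarrow> v x = v' x"
  shows "solves_on q U v'"
  unfolding solves_on_def
proof (intro conjI ballI)
  show "v' holomorphic_on U" using assms by (metis holomorphic_transform solves_on_def)
  fix x assume x: "x \<in> U"
  have "\<forall>\<^sub>F y in nhds x. y \<in> U" using assms(1) x by (rule eventually_nhds_in_open)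
  then have "\<forall>\<^sub>F y in nhds x. v y = v' y" by eventually_elim (rule assms(3))
  then have "deriv (deriv v) x = deriv (deriv v') x"
    using eventually_eq_deriv by (blast intro: deriv_cong_ev)
  then show "deriv (deriv v') x + q x * v' x = 0" using assms x by (auto simp: solves_on_def)
qed

lemma wronskian_cong:
  assumes "\<forall>\<^sub>F x in nhds a. f x = f' x" "\<forall>\<^sub>F x in nhds a. g x = g' x"
  shows "wronskian f g a = wronskian f' g' a"
  using assms[THEN eventually_nhds_x_imp_x] deriv_cong_ev[OF assms(1) refl] deriv_cong_ev[OF assms(2) refl]
  by (simp add: wronskian_def)

lemma holomorphic_on_has_deriv:
  assumes "f holomorphic_on U" "open U" "x \<in> U"
  shows "(f has_field_derivative deriv f x) (at x)" "(deriv f has_field_derivative deriv (deriv f) x) (at x)"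
  using assms holomorphic_derivI holomorphic_deriv by blast+

text \<open>Abel's identity for an equation without first-order term: in the derivative f g'' - f''
  g both second derivatives are - q times the function.\<close>

lemma wronskian_const:
  assumes "open U" "connected U" "solves_on q U f" "solves_on q U g" "x \<in> U" "y \<in> U"
  shows "wronskian f g x = wronskian f g y"
proof -
  have D: "(wronskian f g has_field_derivative 0) (at x)" if x: "x \<in> U" for x
  proof -
    have h: "f holomorphic_on U" "g holomorphic_on U" using assms by (auto simp: solves_on_def)
    note d = holomorphic_on_has_deriv[OF h(1) assms(1) x] holomorphic_on_has_deriv[OF h(2) assms(1) x]
    have e: "deriv (deriv f) x = - (q x * f x)" "deriv (deriv g) x = - (q x * g x)"
      using assms x by (auto simp: solves_on_def eq_neg_iff_add_eq_0)
    have "((\<lambda>x. f x * deriv g x - deriv f x * g x) has_field_derivative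
        (deriv f x * deriv g x + deriv (deriv g) x * f x) - (deriv (deriv f) x * g x + deriv g x * deriv f x)) (at x)"
      by (intro derivative_intros d)
    then show ?thesis unfolding wronskian_def[abs_def] by (simp add: e algebra_simps)
  qed
  have "continuous_on U (wronskian f g)"
    using D by (meson DERIV_isCont continuous_at_imp_continuous_on)
  then obtain c where "\<And>x. x \<in> U \<Longrightarrow> wronskian f g x = c"
    using DERIV_zero_connected_constant[of U "{}" "wronskian f g"] assms D by auto
  then show ?thesis using assms by simp
qed

lemma solves_on_lincomb:
  assumes "open U" "solves_on q U f" "solves_on q U g"
  shows "solves_on q U (\<lambda>x. \<alpha> * f x + \<beta> * g x)"
    and "x \<in> U \<Longrightarrow> wronskian (\<lambda>x. \<alpha> * f x + \<beta> * g x) (\<lambda>x. \<gamma> * f x + \<delta> * g x) x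
            = (\<alpha> * \<delta> - \<beta> * \<gamma>) * wronskian f g x"
proof -
  have h: "f holomorphic_on U" "g holomorphic_on U" using assms by (auto simp: solves_on_def)
  have d1: "deriv (\<lambda>x. \<alpha> * f x + \<beta> * g x) x = \<alpha> * deriv f x + \<beta> * deriv g x" if x: "x \<in> U" for x \<alpha> \<beta>
    using holomorphic_on_has_deriv[OF h(1) assms(1) x] holomorphic_on_has_deriv[OF h(2) assms(1) x]
    by (auto intro!: DERIV_imp_deriv derivative_eq_intros)
  have d2: "deriv (deriv (\<lambda>x. \<alpha> * f x + \<beta> * g x)) x = \<alpha> * deriv (deriv f) x + \<beta> * deriv (deriv g) x"
    if x: "x \<in> U" for x
  proof -
    have "\<forall>\<^sub>F y in nhds x. y \<in> U" using assms(1) x by (rule eventually_nhds_in_open)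
    then have "\<forall>\<^sub>F y in nhds x. deriv (\<lambda>x. \<alpha> * f x + \<beta> * g x) y = \<alpha> * deriv f y + \<beta> * deriv g y"
      by eventually_elim (rule d1)
    then have "deriv (deriv (\<lambda>x. \<alpha> * f x + \<beta> * g x)) x = deriv (\<lambda>y. \<alpha> * deriv f y + \<beta> * deriv g y) x"
      by (rule deriv_cong_ev) simp
    also have "\<dots> = \<alpha> * deriv (deriv f) x + \<beta> * deriv (deriv g) x"
      using holomorphic_on_has_deriv[OF h(1) assms(1) x] holomorphic_on_has_deriv[OF h(2) assms(1) x]
      by (auto intro!: DERIV_imp_deriv derivative_eq_intros)
    finally show ?thesis .
  qed
  show "solves_on q U (\<lambda>x. \<alpha> * f x + \<beta> * g x)"
    unfolding solves_on_def
  proof (intro conjI ballI)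
    fix x assume x: "x \<in> U"
    have "\<alpha> * (deriv (deriv f) x + q x * f x) + \<beta> * (deriv (deriv g) x + q x * g x) = 0"
      using assms x by (simp add: solves_on_def)
    then show "deriv (deriv (\<lambda>x. \<alpha> * f x + \<beta> * g x)) x + q x * (\<alpha> * f x + \<beta> * g x) = 0"
      by (simp add: d2[OF x] algebra_simps)
  qed (intro holomorphic_intros h)
  show "wronskian (\<lambda>x. \<alpha> * f x + \<beta> * g x) (\<lambda>x. \<gamma> * f x + \<delta> * g x) x
            = (\<alpha> * \<delta> - \<beta> * \<gamma>) * wronskian f g x" if "x \<in> U"
    unfolding wronskian_def d1[OF that] by (simp add: algebra_simps)
qed

text \<open>Cramer's rule: v W(e1, e2) = W(v, e2) e1 + W(e1, v) e2 holds identically, and all three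
  Wronskians are constant. No uniqueness theorem for initial values enters.\<close>

lemma solves_on_combination:
  assumes U: "open U" "connected U" and s: "solves_on q U v" "solves_on q U e1" "solves_on q U e2"
    and a: "a \<in> U" "wronskian e1 e2 a \<noteq> 0"
  obtains \<alpha> \<beta> where "\<And>x. x \<in> U \<Longrightarrow> v x = \<alpha> * e1 x + \<beta> * e2 x"
proof
  fix x assume x: "x \<in> U"
  let ?W = "wronskian e1 e2 a"
  have "wronskian v e2 x = wronskian v e2 a" "wronskian e1 v x = wronskian e1 v a" "wronskian e1 e2 x = ?W"
    using U s a x by (blast intro: wronskian_const)+
  moreover have "v x * wronskian e1 e2 x = wronskian v e2 x * e1 x + wronskian e1 v x * e2 x"
    by (simp add: wronskian_def algebra_simps)
  ultimately have "v x * ?W = wronskian v e2 a * e1 x + wronskian e1 v a * e2 x" by simp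
  then show "v x = wronskian v e2 a / ?W * e1 x + wronskian e1 v a / ?W * e2 x"
    using a by (simp add: field_simps)
qed

text \<open>The solutions with initial data (1, 0) and (0, 1) at \<open>w\<close> share a ball
  because the radius in \<open>linear_ode_at_0\<close> is uniform in the data; their Wronskian is 1
  at \<open>w\<close> and constant.\<close>

lemma solves_on_local_basis:
  assumes "open X" "q holomorphic_on X" "w \<in> X"
  obtains \<rho> e1 e2 where "\<rho> > 0" "ball w \<rho> \<subseteq> X" "solves_on q (ball w \<rho>) e1" "solves_on q (ball w \<rho>) e2"
    "\<And>x. x \<in> ball w \<rho> \<Longrightarrow> wronskian e1 e2 x = 1"
proof -
  obtain R where R: "R > 0" "cball w R \<subseteq> X" using assms by (meson open_contains_cball)
  have "compact (q ` cball w R)"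
    using R assms by (intro compact_continuous_image holomorphic_on_imp_continuous_on)
      (auto intro: holomorphic_on_subset)
  then obtain B where B: "B > 0" "\<And>x. x \<in> cball w R \<Longrightarrow> norm (q x) \<le> B"
    by (metis compact_imp_bounded bounded_pos imageI)
  define q0 where "q0 = (\<lambda>x. q (w + x))"
  have hol: "q0 holomorphic_on ball 0 R"
  proof -
    have "(q \<circ> (\<lambda>x. w + x)) holomorphic_on ball 0 R"
      by (intro holomorphic_on_compose_gen[OF _ assms(2)] holomorphic_intros)
         (use R in \<open>auto simp: subset_iff dist_norm\<close>)
    then show ?thesis by (simp add: o_def q0_def)
  qed
  have q0B: "norm (q0 x) \<le> B" if "x \<in> ball 0 R" for x
    using that B by (auto simp: q0_def dist_norm)
  define r where "r = 1 / (2 / R * (1 + B / (2 / R)\<^sup>2))"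
  have r0: "r > 0" using R B by (simp add: r_def add_pos_pos)
  have "\<exists>u. u holomorphic_on ball 0 r \<and> u 0 = \<alpha> \<and> deriv u 0 = \<beta> \<and>
             (\<forall>x\<in>ball 0 r. deriv (deriv u) x + q0 x * u x = 0)" for \<alpha> \<beta>
    using B by (intro linear_ode_at_0[OF hol R(1) _ q0B r_def]) auto
  then have ex: "\<exists>u. u holomorphic_on ball 0 r \<and> u 0 = \<alpha> \<and> deriv u 0 = \<beta> \<and>
             (\<forall>x\<in>ball 0 r. deriv (deriv u) x + q0 x * u x = 0)" for \<alpha> \<beta> by blast
  define \<rho> where "\<rho> = min r R"
  have \<rho>: "\<rho> > 0" "\<rho> \<le> r" "\<rho> \<le> R" using r0 R by (auto simp: \<rho>_def)
  have ball: "ball w \<rho> \<subseteq> X" using R \<rho> by (auto simp: subset_iff)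
  have shift: "deriv (\<lambda>x. u (x - w)) = (\<lambda>x. deriv u (x - w))" for u :: "complex \<Rightarrow> complex"
  proof
    fix x
    have "deriv (\<lambda>x. u (x + - w)) x = deriv u (x + - w)" unfolding deriv_def by (simp only: DERIV_shift)
    then show "deriv (\<lambda>x. u (x - w)) x = deriv u (x - w)" by simp
  qed
  have sol: "\<exists>e. solves_on q (ball w \<rho>) e \<and> e w = \<alpha> \<and> deriv e w = \<beta>" for \<alpha> \<beta>
  proof -
    obtain u where u: "u holomorphic_on ball 0 r" "u 0 = \<alpha>" "deriv u 0 = \<beta>"
             "\<And>x. x\<in>ball 0 r \<Longrightarrow> deriv (deriv u) x + q0 x * u x = 0"
      using ex by blast
    have "(u \<circ> (\<lambda>x. x - w)) holomorphic_on ball w \<rho>"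
      by (intro holomorphic_on_compose_gen[OF _ u(1)] holomorphic_intros)
         (use \<rho> in \<open>auto simp: subset_iff dist_norm norm_minus_commute\<close>)
    then have "(\<lambda>x. u (x - w)) holomorphic_on ball w \<rho>" by (simp add: o_def)
    moreover have "deriv (deriv u) (x - w) + q x * u (x - w) = 0" if "x \<in> ball w \<rho>" for x
      using u(4)[of "x - w"] that \<rho> by (auto simp: q0_def dist_norm norm_minus_commute)
    ultimately show ?thesis using u by (intro exI[of _ "\<lambda>x. u (x - w)"]) (simp add: solves_on_def shift)
  qed
  obtain e1 where e1: "solves_on q (ball w \<rho>) e1" "e1 w = 1" "deriv e1 w = 0" using sol by blast
  obtain e2 where e2: "solves_on q (ball w \<rho>) e2" "e2 w = 0" "deriv e2 w = 1" using sol by blast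
  have "wronskian e1 e2 x = 1" if "x \<in> ball w \<rho>" for x
  proof -
    have "wronskian e1 e2 x = wronskian e1 e2 w"
      using e1 e2 that \<rho> by (intro wronskian_const[of "ball w \<rho>"]) auto
    then show ?thesis using e1 e2 by (simp add: wronskian_def)
  qed
  with that[of \<rho> e1 e2] \<rho> ball e1 e2 show ?thesis by blast
qed

section \<open>Prolonging continuations; pairs with the same ratio\<close>

text \<open>Along the added path one function \<open>v\<close> stays analytic, so \<open>v\<close>
  itself serves as the germ at each of its points.\<close>

lemma continuation_along_join:
  assumes F: "continuation_along \<gamma> F" and \<gamma>: "path \<gamma>" "pathfinish \<gamma> = w"
    and \<delta>: "path \<delta>" "pathstart \<delta> = w" and v: "\<And>t. t \<in> {0..1} \<Longrightarrow> v analytic_on {\<delta> t}"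
    and eq: "\<forall>\<^sub>F x in nhds w. v x = F 1 x"
  shows "continuation_along (\<gamma> +++ \<delta>) (\<lambda>t. if t \<le> 1/2 then F (2 * t) else v)"
  unfolding continuation_along_def
proof (intro ballI conjI)
  fix t :: real assume t: "t \<in> {0..1}"
  let ?G = "\<lambda>t. if t \<le> 1/2 then F (2 * t) else v"
  have "F (2 * t) analytic_on {\<gamma> (2 * t)}" if "t \<le> 1/2"
    using t F that unfolding continuation_along_def by simp
  then show "?G t analytic_on {(\<gamma> +++ \<delta>) t}"
    using t v[of "2 * t - 1"] by (simp add: joinpaths_def)
  consider "t < 1/2" | "t = 1/2" | "t > 1/2" by linarith
  then show "\<forall>\<^sub>F s in at t within {0..1}. \<forall>\<^sub>F x in nhds ((\<gamma> +++ \<delta>) s). ?G s x = ?G t x"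
  proof cases
    case 3
    then show ?thesis unfolding eventually_at by (intro exI[of _ "t - 1/2"]) (auto simp: dist_real_def)
  next
    case le: 1
    have "2 * t \<in> {0..1}" using t le by auto
    then have "\<forall>\<^sub>F s in at (2 * t) within {0..1}. \<forall>\<^sub>F x in nhds (\<gamma> s). F s x = F (2 * t) x"
      using F by (auto simp: continuation_along_def)
    then obtain d where d: "d > 0" "\<And>s. s \<in> {0..1} \<Longrightarrow> s \<noteq> 2 * t \<Longrightarrow> dist s (2 * t) < d \<Longrightarrow>
        \<forall>\<^sub>F x in nhds (\<gamma> s). F s x = F (2 * t) x"
      unfolding eventually_at by blast
    show ?thesis unfolding eventually_at
    proof (intro exI[of _ "min (d / 2) (1/2 - t)"] conjI ballI impI)
      show "min (d / 2) (1/2 - t) > 0" using d le by auto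
      fix s assume s: "s \<in> {0..1}" "s \<noteq> t \<and> dist s t < min (d / 2) (1/2 - t)"
      have s2: "s \<le> 1/2" using s by (auto simp: dist_real_def)
      have "dist (2 * s) (2 * t) = 2 * dist s t" by (simp add: dist_real_def abs_if)
      then have "dist (2 * s) (2 * t) < d" using s by simp
      then have "\<forall>\<^sub>F x in nhds (\<gamma> (2 * s)). F (2 * s) x = F (2 * t) x"
        using s s2 by (intro d) auto
      then show "\<forall>\<^sub>F x in nhds ((\<gamma> +++ \<delta>) s). ?G s x = ?G t x"
        using s2 le by (simp add: joinpaths_def)
    qed
  next
    \<comment> \<open>At the joint the germ in force is \<open>F 1\<close>. To the right of it
      \<open>v\<close> has the same germ because, for small times, \<open>\<delta>\<close> stays in
      the open set where \<open>v\<close> and \<open>F 1\<close> agree.\<close>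
    case le: 2
    have "\<forall>\<^sub>F s in at 1 within {0..1}. \<forall>\<^sub>F x in nhds (\<gamma> s). F s x = F 1 x"
      using F by (auto simp: continuation_along_def)
    then obtain d where d: "d > 0" "\<And>s. s \<in> {0..1} \<Longrightarrow> s \<noteq> 1 \<Longrightarrow> dist s 1 < d \<Longrightarrow>
        \<forall>\<^sub>F x in nhds (\<gamma> s). F s x = F 1 x"
      unfolding eventually_at by blast
    obtain U where U: "open U" "w \<in> U" "\<And>x. x \<in> U \<Longrightarrow> v x = F 1 x"
      using eq unfolding eventually_nhds by blast
    obtain e where e: "e > 0" "ball w e \<subseteq> U" using U open_contains_ball by blast
    have "continuous_on {0..1} \<delta>" using \<delta> by (simp add: path_def)
    then obtain d' where d': "d' > 0" "\<And>s. s \<in> {0..1} \<Longrightarrow> dist s 0 < d' \<Longrightarrow> dist (\<delta> s) (\<delta> 0) < e"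
      using e unfolding continuous_on_iff by (metis atLeastAtMost_iff order_refl zero_le_one)
    show ?thesis unfolding eventually_at
    proof (intro exI[of _ "min (d / 2) (d' / 2)"] conjI ballI impI)
      show "min (d / 2) (d' / 2) > 0" using d d' by auto
      fix s assume s: "s \<in> {0..1}" "s \<noteq> t \<and> dist s t < min (d / 2) (d' / 2)"
      show "\<forall>\<^sub>F x in nhds ((\<gamma> +++ \<delta>) s). ?G s x = ?G t x"
      proof (cases "s \<le> 1/2")
        case True
        then have "\<forall>\<^sub>F x in nhds (\<gamma> (2 * s)). F (2 * s) x = F 1 x"
          using s le by (intro d) (auto simp: dist_real_def)
        then show ?thesis unfolding le using True by (simp add: joinpaths_def)
      next
        case False
        then have "dist (\<delta> (2 * s - 1)) (\<delta> 0) < e"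
          using s le by (intro d') (auto simp: dist_real_def)
        then have "\<delta> (2 * s - 1) \<in> U" using e \<delta> by (auto simp: pathstart_def dist_commute)
        then have "\<forall>\<^sub>F x in nhds (\<delta> (2 * s - 1)). x \<in> U" using U eventually_nhds_in_open by blast
        then have "\<forall>\<^sub>F x in nhds (\<delta> (2 * s - 1)). v x = F 1 x" by eventually_elim (rule U(3))
        then show ?thesis unfolding le using False by (simp add: joinpaths_def)
      qed
    qed
  qed
qed

lemma proj_ratio_eqD:
  assumes "proj_ratio a b = proj_ratio c d" "(a, b) \<noteq> (0, 0)" "(c, d) \<noteq> (0, 0)"
  shows "a * d = b * c"
  using assms by (auto simp: proj_ratio_def field_simps split: if_splits)

lemma moebius_proj_ratio:
  assumes "(v1, v2) \<noteq> (0, 0)" "a * d - b * c \<noteq> 0"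
  shows "moebius a b c d (proj_ratio v1 v2) = proj_ratio (a * v1 + b * v2) (c * v1 + d * v2)"
proof (cases "v2 = 0")
  case True
  then show ?thesis using assms by (auto simp: proj_ratio_def)
next
  case False
  then have "a * (v1 / v2) + b = (a * v1 + b * v2) / v2" "c * (v1 / v2) + d = (c * v1 + d * v2) / v2"
    by (auto simp: field_simps)
  then show ?thesis using False by (simp add: proj_ratio_def[of v1]) (simp add: proj_ratio_def)
qed

text \<open>Multiplying a pair by a function l multiplies its Wronskian by l^2. To avoid
  differentiating l, only its value at \<open>w\<close> is used, together with the derivative of the
  cross-multiplied relation.\<close>

lemma proportional_pairs_same_wronskian:
  assumes cross: "\<forall>\<^sub>F x in nhds w. t1 x * Q x = t2 x * P x"
    and "t1 field_differentiable at w" "t2 field_differentiable at w"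
    and "P field_differentiable at w" "Q field_differentiable at w"
    and W: "wronskian P Q w = W" "wronskian t1 t2 w = W" "W \<noteq> 0"
  shows "\<exists>\<epsilon>. \<epsilon>\<^sup>2 = 1 \<and> t1 w = \<epsilon> * P w \<and> t2 w = \<epsilon> * Q w"
proof -
  have "deriv (\<lambda>x. t1 x * Q x) w = deriv (\<lambda>x. t2 x * P x) w"
    using cross by (rule deriv_cong_ev) simp
  then have d: "t1 w * deriv Q w + deriv t1 w * Q w = t2 w * deriv P w + deriv t2 w * P w"
    using assms by simp
  have c: "t1 w * Q w = t2 w * P w" using cross by (rule eventually_nhds_x_imp_x)
  obtain l where l: "t1 w = l * P w" "t2 w = l * Q w"
  proof (cases "Q w = 0")
    case True
    then have "P w \<noteq> 0" using W by (auto simp: wronskian_def)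
    then show ?thesis using that[of "t1 w / P w"] True c by auto
  next
    case False
    then show ?thesis using that[of "t2 w / Q w"] c by (auto simp: field_simps)
  qed
  have "W = l * (P w * deriv t2 w - deriv t1 w * Q w)" using W l by (simp add: wronskian_def algebra_simps)
  also have "P w * deriv t2 w - deriv t1 w * Q w = l * W"
    using d l W by (simp add: wronskian_def algebra_simps)
  finally have "l\<^sup>2 = 1" using W by (simp add: power2_eq_square)
  then show ?thesis using l by blast
qed

lemma Im_hermitian_real_unimodular:
  fixes a b c d :: real
  assumes "a * d - b * c = 1"
  shows "Im ((of_real a * x + of_real b * y) * cnj (of_real c * x + of_real d * y)) = Im (x * cnj y)"
proof -
  have "Im ((of_real a * x + of_real b * y) * cnj (of_real c * x + of_real d * y))
      = (a * d - b * c) * Im (x * cnj y)"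
    by (simp add: algebra_simps)
  then show ?thesis using assms by simp
qed

section \<open>Branches of the ratio and the invariant Hermitian form\<close>

locale solution_pair =
  fixes X :: "complex set" and q :: "complex \<Rightarrow> complex" and p :: complex
    and u1 u2 :: "complex \<Rightarrow> complex" and W :: complex
  assumes open_X: "open X" and connected_X: "connected X" and q_holo: "q holomorphic_on X"
    and initial: "\<exists>\<rho>>0. ball p \<rho> \<subseteq> X \<and> solves_on q (ball p \<rho>) u1 \<and> solves_on q (ball p \<rho>) u2 \<and>
                    (\<forall>x\<in>ball p \<rho>. wronskian u1 u2 x = W)"
    and W_nonzero: "W \<noteq> 0"
begin

definition solution_germ :: "complex \<Rightarrow> (complex \<Rightarrow> complex) \<Rightarrow> (complex \<Rightarrow> complex) \<Rightarrow> bool" where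
  "solution_germ w v1 v2 \<longleftrightarrow> (\<exists>\<rho>>0. ball w \<rho> \<subseteq> X \<and> solves_on q (ball w \<rho>) v1 \<and> solves_on q (ball w \<rho>) v2 \<and>
                    (\<forall>x\<in>ball w \<rho>. wronskian v1 v2 x = W))"

lemma solution_germ_cong:
  assumes "solution_germ w v1 v2" "\<forall>\<^sub>F x in nhds w. v1 x = v1' x" "\<forall>\<^sub>F x in nhds w. v2 x = v2' x"
  shows "solution_germ w v1' v2'"
proof -
  obtain \<rho> where \<rho>: "\<rho> > 0" "ball w \<rho> \<subseteq> X" "solves_on q (ball w \<rho>) v1" "solves_on q (ball w \<rho>) v2"
    "\<And>x. x \<in> ball w \<rho> \<Longrightarrow> wronskian v1 v2 x = W"
    using assms(1) unfolding solution_germ_def by blast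
  have "\<forall>\<^sub>F x in nhds w. v1 x = v1' x \<and> v2 x = v2' x" using assms(2,3) by eventually_elim auto
  then obtain e where e: "e > 0" "\<And>x. x \<in> ball w e \<Longrightarrow> v1 x = v1' x \<and> v2 x = v2' x"
    unfolding eventually_nhds_metric by (auto simp: dist_commute)
  define r where "r = min \<rho> e"
  have r: "r > 0" "ball w r \<subseteq> ball w \<rho>" "ball w r \<subseteq> ball w e" using \<rho> e by (auto simp: r_def)
  show ?thesis unfolding solution_germ_def
  proof (intro exI[of _ r] conjI ballI)
    show "solves_on q (ball w r) v1'"
      by (rule solves_on_cong[of _ _ v1]) (use \<rho> e r in \<open>auto intro: solves_on_subset\<close>)
    show "solves_on q (ball w r) v2'"
      by (rule solves_on_cong[of _ _ v2]) (use \<rho> e r in \<open>auto intro: solves_on_subset\<close>)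
    fix x assume x: "x \<in> ball w r"
    have "\<forall>\<^sub>F y in nhds x. y \<in> ball w e" using x r by (intro eventually_nhds_in_open) auto
    then have "\<forall>\<^sub>F y in nhds x. v1 y = v1' y" "\<forall>\<^sub>F y in nhds x. v2 y = v2' y"
      by (eventually_elim; use e in blast)+
    then have "wronskian v1 v2 x = wronskian v1' v2' x" by (rule wronskian_cong)
    then show "wronskian v1' v2' x = W" using \<rho>(5)[of x] x r by auto
  qed (use \<rho> r in auto)
qed

text \<open>The identity theorem, applied to the left-hand side of the equation and to the Wronskian
  minus \<open>W\<close>.\<close>

lemma solution_germ_move:
  assumes "v1 holomorphic_on U" "v2 holomorphic_on U" "open U" "connected U" "U \<subseteq> X"
    and g: "a \<in> U" "solution_germ a v1 v2"
  shows "solves_on q U v1" "solves_on q U v2" "\<And>x. x \<in> U \<Longrightarrow> wronskian v1 v2 x = W"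
    and "b \<in> U \<Longrightarrow> solution_germ b v1 v2"
proof -
  obtain \<rho> where \<rho>: "\<rho> > 0" "ball a \<rho> \<subseteq> X" "solves_on q (ball a \<rho>) v1" "solves_on q (ball a \<rho>) v2"
    "\<And>x. x \<in> ball a \<rho> \<Longrightarrow> wronskian v1 v2 x = W"
    using g(2) unfolding solution_germ_def by blast
  have qU: "q holomorphic_on U" using q_holo assms holomorphic_on_subset by blast
  have limpt: "a islimpt ball a \<rho> \<inter> U"
    using \<rho> g assms(3) by (intro open_imp_islimpt) auto
  have ext: "f x = 0" if "f holomorphic_on U" "\<And>y. y \<in> ball a \<rho> \<Longrightarrow> f y = 0" "x \<in> U" for f x
    by (rule analytic_continuation[OF that(1) assms(3,4) _ g(1) limpt]) (use that in auto)
  have sol: "solves_on q U v" if v: "v holomorphic_on U" "solves_on q (ball a \<rho>) v" for v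
    unfolding solves_on_def
  proof (intro conjI v ballI)
    fix x assume "x \<in> U"
    show "deriv (deriv v) x + q x * v x = 0"
      by (rule ext[OF _ _ \<open>x \<in> U\<close>])
         (use v qU assms in \<open>auto intro!: holomorphic_intros holomorphic_deriv simp: solves_on_def\<close>)
  qed
  show 1: "solves_on q U v1" "solves_on q U v2" using sol assms \<rho> by auto
  show 2: "wronskian v1 v2 x = W" if x: "x \<in> U" for x
  proof -
    have "wronskian v1 v2 x - W = 0"
      by (rule ext[OF _ _ x])
         (use assms \<rho>(5) in \<open>auto intro!: holomorphic_intros holomorphic_deriv simp: wronskian_def[abs_def]\<close>)
    then show ?thesis by simp
  qed
  assume b: "b \<in> U"
  obtain e where "e > 0" "ball b e \<subseteq> U" using b assms(3) open_contains_ball by blast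
  then show "solution_germ b v1 v2" unfolding solution_germ_def
    using 1 2 assms(5) by (intro exI[of _ e]) (auto intro: solves_on_subset)
qed

section \<open>Continued pairs of solutions\<close>

text \<open>The pair behind a branch: \<open>ratio_branches\<close> keeps only the quotient, whereas
  the Hermitian form needs numerator and denominator.\<close>

definition branch_pair :: "complex \<Rightarrow> (complex \<Rightarrow> complex) \<Rightarrow> (complex \<Rightarrow> complex) \<Rightarrow> bool" where
  "branch_pair w v1 v2 \<longleftrightarrow> (\<exists>\<gamma> F1 F2. path \<gamma> \<and> path_image \<gamma> \<subseteq> X \<and> pathstart \<gamma> = p \<and> pathfinish \<gamma> = w \<and>
           continuation_along \<gamma> F1 \<and> continuation_along \<gamma> F2 \<and>
           (\<forall>\<^sub>F x in nhds p. F1 0 x = u1 x \<and> F2 0 x = u2 x) \<and>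
           (\<forall>\<^sub>F x in nhds w. v1 x = F1 1 x \<and> v2 x = F2 1 x))"

lemma ratio_branches_iff:
  "f \<in> ratio_branches X p u1 u2 w \<longleftrightarrow>
     (\<exists>v1 v2. branch_pair w v1 v2 \<and> (\<forall>\<^sub>F x in nhds w. f x = proj_ratio (v1 x) (v2 x)))"
proof
  assume "f \<in> ratio_branches X p u1 u2 w"
  then obtain \<gamma> F1 F2 where "path \<gamma> \<and> path_image \<gamma> \<subseteq> X \<and> pathstart \<gamma> = p \<and> pathfinish \<gamma> = w \<and>
           continuation_along \<gamma> F1 \<and> continuation_along \<gamma> F2 \<and>
           (\<forall>\<^sub>F x in nhds p. F1 0 x = u1 x \<and> F2 0 x = u2 x)"
      and *: "\<forall>\<^sub>F x in nhds w. f x = proj_ratio (F1 1 x) (F2 1 x)"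
    unfolding ratio_branches_def by blast
  then have "branch_pair w (F1 1) (F2 1)"
    unfolding branch_pair_def by (intro exI[of _ \<gamma>] exI[of _ F1] exI[of _ F2]) auto
  with * show "\<exists>v1 v2. branch_pair w v1 v2 \<and> (\<forall>\<^sub>F x in nhds w. f x = proj_ratio (v1 x) (v2 x))" by blast
next
  assume "\<exists>v1 v2. branch_pair w v1 v2 \<and> (\<forall>\<^sub>F x in nhds w. f x = proj_ratio (v1 x) (v2 x))"
  then obtain v1 v2 \<gamma> F1 F2 where 1: "path \<gamma>" "path_image \<gamma> \<subseteq> X" "pathstart \<gamma> = p" "pathfinish \<gamma> = w"
      "continuation_along \<gamma> F1" "continuation_along \<gamma> F2" "\<forall>\<^sub>F x in nhds p. F1 0 x = u1 x \<and> F2 0 x = u2 x"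
      and 2: "\<forall>\<^sub>F x in nhds w. v1 x = F1 1 x \<and> v2 x = F2 1 x"
      and 3: "\<forall>\<^sub>F x in nhds w. f x = proj_ratio (v1 x) (v2 x)"
    unfolding branch_pair_def by blast
  from 2 3 have "\<forall>\<^sub>F x in nhds w. f x = proj_ratio (F1 1 x) (F2 1 x)" by eventually_elim auto
  with 1 show "f \<in> ratio_branches X p u1 u2 w" unfolding ratio_branches_def by blast
qed

lemma branch_pair_ratio:
  "branch_pair w v1 v2 \<Longrightarrow> (\<lambda>x. proj_ratio (v1 x) (v2 x)) \<in> ratio_branches X p u1 u2 w"
  unfolding ratio_branches_iff by (rule exI[of _ v1], rule exI[of _ v2]) simp

lemma branch_pair_cong:
  assumes "branch_pair w v1 v2" "\<forall>\<^sub>F x in nhds w. v1 x = v1' x" "\<forall>\<^sub>F x in nhds w. v2 x = v2' x"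
  shows "branch_pair w v1' v2'"
proof -
  obtain \<gamma> F1 F2 where 1: "path \<gamma>" "path_image \<gamma> \<subseteq> X" "pathstart \<gamma> = p" "pathfinish \<gamma> = w"
      "continuation_along \<gamma> F1" "continuation_along \<gamma> F2" "\<forall>\<^sub>F x in nhds p. F1 0 x = u1 x \<and> F2 0 x = u2 x"
      and 2: "\<forall>\<^sub>F x in nhds w. v1 x = F1 1 x \<and> v2 x = F2 1 x"
    using assms(1) unfolding branch_pair_def by blast
  from 2 assms(2,3) have "\<forall>\<^sub>F x in nhds w. v1' x = F1 1 x \<and> v2' x = F2 1 x" by eventually_elim auto
  with 1 show ?thesis unfolding branch_pair_def by blast
qed

text \<open>Along a continuation the property passes between neighbouring parameters, since nearby
  germs are germs of one function on a ball, where \<open>solution_germ_move\<close> applies.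
  Connectedness of the parameter interval carries it from 0 to 1.\<close>

lemma branch_pair_solution_germ:
  assumes "branch_pair w v1 v2"
  shows "solution_germ w v1 v2" "w \<in> X"
proof -
  obtain \<gamma> F1 F2 where \<gamma>: "path \<gamma>" "path_image \<gamma> \<subseteq> X" "pathstart \<gamma> = p" "pathfinish \<gamma> = w"
      and F: "continuation_along \<gamma> F1" "continuation_along \<gamma> F2"
      and 1: "\<forall>\<^sub>F x in nhds p. F1 0 x = u1 x \<and> F2 0 x = u2 x"
      and 2: "\<forall>\<^sub>F x in nhds w. v1 x = F1 1 x \<and> v2 x = F2 1 x"
    using assms(1) unfolding branch_pair_def by blast
  show "w \<in> X" using \<gamma> by (metis pathfinish_in_path_image subsetD)
  have start: "solution_germ (\<gamma> 0) (F1 0) (F2 0)"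
  proof (rule solution_germ_cong)
    show "solution_germ (\<gamma> 0) u1 u2" using initial \<gamma> by (simp add: solution_germ_def pathstart_def)
  qed (use 1 \<gamma> in \<open>auto simp: pathstart_def elim: eventually_mono\<close>)
  have "solution_germ (\<gamma> 1) (F1 1) (F2 1)"
  proof (rule connected_induction_simple[of "{0..1::real}" 0 1 "\<lambda>t. solution_germ (\<gamma> t) (F1 t) (F2 t)"])
    fix a :: real assume a: "a \<in> {0..1}"
    obtain e1 where e1: "e1 > 0" "F1 a holomorphic_on ball (\<gamma> a) e1"
      using F a unfolding continuation_along_def analytic_on_def by blast
    obtain e2 where e2: "e2 > 0" "F2 a holomorphic_on ball (\<gamma> a) e2"
      using F a unfolding continuation_along_def analytic_on_def by blast
    have "\<gamma> a \<in> X" using a \<gamma> by (auto simp: path_image_def)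
    then obtain e3 where e3: "e3 > 0" "ball (\<gamma> a) e3 \<subseteq> X" using open_X open_contains_ball by blast
    define e where "e = min e1 (min e2 e3)"
    define B where "B = ball (\<gamma> a) e"
    have B: "open B" "connected B" "B \<subseteq> X" "F1 a holomorphic_on B" "F2 a holomorphic_on B"
      using e3 e1 e2 by (auto simp: B_def e_def intro: holomorphic_on_subset)
    have "\<forall>\<^sub>F s in at a within {0..1}. (\<forall>\<^sub>F x in nhds (\<gamma> s). F1 s x = F1 a x)"
      "\<forall>\<^sub>F s in at a within {0..1}. (\<forall>\<^sub>F x in nhds (\<gamma> s). F2 s x = F2 a x)"
      using F a by (auto simp: continuation_along_def)
    then have "\<forall>\<^sub>F s in at a within {0..1}. (\<forall>\<^sub>F x in nhds (\<gamma> s). F1 s x = F1 a x) \<and> (\<forall>\<^sub>F x in nhds (\<gamma> s). F2 s x = F2 a x)"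
      by eventually_elim auto
    then obtain d where d: "d > 0" "\<And>s. s \<in> {0..1} \<Longrightarrow> s \<noteq> a \<Longrightarrow> dist s a < d \<Longrightarrow>
        (\<forall>\<^sub>F x in nhds (\<gamma> s). F1 s x = F1 a x) \<and> (\<forall>\<^sub>F x in nhds (\<gamma> s). F2 s x = F2 a x)"
      unfolding eventually_at by blast
    have "continuous_on {0..1} \<gamma>" using \<gamma> by (simp add: path_def)
    moreover have "e > 0" using e1 e2 e3 by (simp add: e_def)
    ultimately obtain d' where d': "d' > 0" "\<And>s. s \<in> {0..1} \<Longrightarrow> dist s a < d' \<Longrightarrow> dist (\<gamma> s) (\<gamma> a) < e"
      unfolding continuous_on_iff using a by blast
    define T where "T = {0..1} \<inter> ball a (min d d')"
    have T: "\<gamma> s \<in> B \<and> (\<forall>\<^sub>F x in nhds (\<gamma> s). F1 s x = F1 a x) \<and> (\<forall>\<^sub>F x in nhds (\<gamma> s). F2 s x = F2 a x)"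
      if "s \<in> T" for s
      using that d'(2)[of s] d(2)[of s] by (cases "s = a") (auto simp: T_def B_def dist_commute)
    show "\<exists>T. openin (top_of_set {0..1}) T \<and> a \<in> T \<and>
        (\<forall>x\<in>T. \<forall>y\<in>T. solution_germ (\<gamma> x) (F1 x) (F2 x) \<longrightarrow> solution_germ (\<gamma> y) (F1 y) (F2 y))"
    proof (intro exI[of _ T] conjI ballI impI)
      show "openin (top_of_set {0..1}) T" unfolding T_def by (intro openin_open_Int) auto
      show "a \<in> T" using a d d' by (simp add: T_def)
      fix x y assume xy: "x \<in> T" "y \<in> T" "solution_germ (\<gamma> x) (F1 x) (F2 x)"
      have "solution_germ (\<gamma> x) (F1 a) (F2 a)" using solution_germ_cong xy T by blast
      then have "solution_germ (\<gamma> y) (F1 a) (F2 a)"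
        using solution_germ_move(4)[OF B(4,5,1,2,3)] T xy by blast
      then show "solution_germ (\<gamma> y) (F1 y) (F2 y)"
        by (rule solution_germ_cong) (use T[OF xy(2)] in \<open>auto elim: eventually_mono\<close>)
    qed
  qed (use start in auto)
  then have "solution_germ w (F1 1) (F2 1)" using \<gamma> by (simp add: pathfinish_def)
  then show "solution_germ w v1 v2"
    by (rule solution_germ_cong) (use 2 in \<open>auto elim: eventually_mono\<close>)
qed

text \<open>The path to \<open>w\<close> is prolonged by a segment inside the ball, along which the
  pair continues itself.\<close>

lemma branch_pair_move_ball:
  assumes b: "branch_pair w v1 v2" and v: "v1 holomorphic_on ball c r" "v2 holomorphic_on ball c r"
    and c: "ball c r \<subseteq> X" "w \<in> ball c r" "x \<in> ball c r"
  shows "branch_pair x v1 v2"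
proof -
  obtain \<gamma> F1 F2 where \<gamma>: "path \<gamma>" "path_image \<gamma> \<subseteq> X" "pathstart \<gamma> = p" "pathfinish \<gamma> = w"
      and F: "continuation_along \<gamma> F1" "continuation_along \<gamma> F2"
      and 1: "\<forall>\<^sub>F x in nhds p. F1 0 x = u1 x \<and> F2 0 x = u2 x"
      and 2: "\<forall>\<^sub>F x in nhds w. v1 x = F1 1 x \<and> v2 x = F2 1 x"
    using b unfolding branch_pair_def by blast
  have img: "path_image (linepath w x) \<subseteq> ball c r"
    using c by (simp add: closed_segment_subset)
  have in_ball: "linepath w x t \<in> ball c r" if "t \<in> {0..1}" for t
    using that img by (metis image_eqI path_image_def subsetD)
  have an: "v1 analytic_on {linepath w x t}" "v2 analytic_on {linepath w x t}" if "t \<in> {0..1}" for t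
    using in_ball[OF that] v by (meson analytic_at open_ball)+
  have j: "continuation_along (\<gamma> +++ linepath w x) (\<lambda>t. if t \<le> 1/2 then F1 (2 * t) else v1)"
       "continuation_along (\<gamma> +++ linepath w x) (\<lambda>t. if t \<le> 1/2 then F2 (2 * t) else v2)"
    by (rule continuation_along_join[OF _ \<gamma>(1,4)]; use F an 2 in \<open>auto elim: eventually_mono\<close>)+
  show ?thesis unfolding branch_pair_def
    by (rule exI[of _ "\<gamma> +++ linepath w x"], rule exI[of _ "\<lambda>t. if t \<le> 1/2 then F1 (2 * t) else v1"],
        rule exI[of _ "\<lambda>t. if t \<le> 1/2 then F2 (2 * t) else v2"])
       (use \<gamma> j 1 img c in \<open>auto simp: path_image_join\<close>)
qed

text \<open>Connectedness of \<open>X\<close> reduces this to a ball that carries a basis of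
  solutions: a pair given near one point of the ball is a combination of the basis, and the
  combination makes sense on the whole ball.\<close>

lemma branch_pair_exists:
  assumes "w \<in> X"
  shows "\<exists>v1 v2. branch_pair w v1 v2"
proof (rule connected_induction_simple[OF connected_X _ assms])
  show pX: "p \<in> X" using initial by (metis centre_in_ball subsetD)
  have "branch_pair p u1 u2"
  proof -
    obtain \<rho> where \<rho>: "\<rho> > 0" "u1 holomorphic_on ball p \<rho>" "u2 holomorphic_on ball p \<rho>"
      using initial by (auto simp: solves_on_def)
    then have "u1 analytic_on {p}" "u2 analytic_on {p}" unfolding analytic_on_def by auto
    moreover have "linepath p p t = p" for t by (simp add: linepath_refl)
    ultimately show ?thesis unfolding branch_pair_def continuation_along_def
      by (intro exI[of _ "linepath p p"] exI[of _ "\<lambda>_. u1"] exI[of _ "\<lambda>_. u2"])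
         (use pX in auto)
  qed
  then show "\<exists>v1 v2. branch_pair p v1 v2" by blast
next
  fix a assume a: "a \<in> X"
  obtain \<rho> e1 e2 where \<rho>: "\<rho> > 0" "ball a \<rho> \<subseteq> X"
    and e: "solves_on q (ball a \<rho>) e1" "solves_on q (ball a \<rho>) e2"
    "\<And>x. x \<in> ball a \<rho> \<Longrightarrow> wronskian e1 e2 x = 1"
    using solves_on_local_basis[OF open_X q_holo a] by metis
  show "\<exists>T. openin (top_of_set X) T \<and> a \<in> T \<and>
         (\<forall>x\<in>T. \<forall>y\<in>T. (\<exists>v1 v2. branch_pair x v1 v2) \<longrightarrow> (\<exists>v1 v2. branch_pair y v1 v2))"
  proof (intro exI[of _ "ball a \<rho>"] conjI ballI impI)
    show "openin (top_of_set X) (ball a \<rho>)" using \<rho> open_X by (simp add: open_subset)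
    fix x y assume x: "x \<in> ball a \<rho>" and y: "y \<in> ball a \<rho>" and "\<exists>v1 v2. branch_pair x v1 v2"
    then obtain v1 v2 where b: "branch_pair x v1 v2" by blast
    obtain r where r: "r > 0" "solves_on q (ball x r) v1" "solves_on q (ball x r) v2"
      using branch_pair_solution_germ[OF b] by (auto simp: solution_germ_def)
    \<comment> \<open>The pair lives on the first ball and the basis on the second; their
      intersection is convex, so coefficients can be compared there.\<close>
    define N where "N = ball x r \<inter> ball a \<rho>"
    have N: "open N" "connected N" "x \<in> N" "N \<subseteq> ball x r" "N \<subseteq> ball a \<rho>" using r x
      by (auto simp: N_def convex_Int intro: convex_connected)
    have ev: "\<forall>\<^sub>F z in nhds x. z \<in> N" using N eventually_nhds_in_open by blast
    note sN = solves_on_subset[OF _ N(4)] solves_on_subset[OF _ N(5)]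
    have We: "wronskian e1 e2 x \<noteq> 0" using e x by simp
    obtain \<alpha> \<beta> where 1: "\<And>z. z \<in> N \<Longrightarrow> v1 z = \<alpha> * e1 z + \<beta> * e2 z"
      by (rule solves_on_combination[OF N(1,2) sN(1)[OF r(2)] sN(2)[OF e(1)] sN(2)[OF e(2)] N(3) We]) blast
    obtain \<gamma> \<delta> where 2: "\<And>z. z \<in> N \<Longrightarrow> v2 z = \<gamma> * e1 z + \<delta> * e2 z"
      by (rule solves_on_combination[OF N(1,2) sN(1)[OF r(3)] sN(2)[OF e(1)] sN(2)[OF e(2)] N(3) We]) blast
    have "branch_pair x (\<lambda>z. \<alpha> * e1 z + \<beta> * e2 z) (\<lambda>z. \<gamma> * e1 z + \<delta> * e2 z)"
      by (rule branch_pair_cong[OF b]) (use ev 1 2 in \<open>auto elim: eventually_mono\<close>)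
    then have "branch_pair y (\<lambda>z. \<alpha> * e1 z + \<beta> * e2 z) (\<lambda>z. \<gamma> * e1 z + \<delta> * e2 z)"
      using e \<rho> x y by (elim branch_pair_move_ball[where c = a and r = \<rho>])
         (auto simp: solves_on_def intro!: holomorphic_intros)
    then show "\<exists>v1 v2. branch_pair y v1 v2" by blast
  qed (use \<rho> in auto)
qed

end

section \<open>The invariant Hermitian form and its relation to phi\<close>

locale real_solution_pair = solution_pair +
  assumes real_branches: "branches_related_by PSL2R (ratio_branches X p u1 u2)"
begin

lemma hermitian_unique:
  assumes v: "branch_pair w v1 v2" and t: "branch_pair w t1 t2"
  shows "Im (v1 w * cnj (v2 w)) = Im (t1 w * cnj (t2 w))"
proof -
  obtain r where r: "r > 0" "solves_on q (ball w r) v1" "solves_on q (ball w r) v2"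
    "\<And>x. x \<in> ball w r \<Longrightarrow> wronskian v1 v2 x = W"
    using branch_pair_solution_germ[OF v] by (auto simp: solution_germ_def)
  obtain s where s: "s > 0" "solves_on q (ball w s) t1" "solves_on q (ball w s) t2"
    "\<And>x. x \<in> ball w s \<Longrightarrow> wronskian t1 t2 x = W"
    using branch_pair_solution_germ[OF t] by (auto simp: solution_germ_def)
  have "(\<lambda>x. proj_ratio (v1 x) (v2 x)) \<in> ratio_branches X p u1 u2 w"
       "(\<lambda>x. proj_ratio (t1 x) (t2 x)) \<in> ratio_branches X p u1 u2 w"
    using v t by (simp_all add: branch_pair_ratio)
  then obtain m where m: "m \<in> PSL2R"
      "\<forall>\<^sub>F x in nhds w. proj_ratio (t1 x) (t2 x) = m (proj_ratio (v1 x) (v2 x))"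
    using real_branches unfolding branches_related_by_def by meson
  from m(1) obtain a b c d :: real where abcd: "a * d - b * c = 1"
    and m_eq: "m = moebius (of_real a) (of_real b) (of_real c) (of_real d)"
    unfolding PSL2R_def by blast
  have det: "of_real a * of_real d - of_real b * of_real c = (1 :: complex)"
    using abcd by (metis of_real_1 of_real_diff of_real_mult)
  define P where "P = (\<lambda>x. of_real a * v1 x + of_real b * v2 x)"
  define Q where "Q = (\<lambda>x. of_real c * v1 x + of_real d * v2 x)"
  have WPQ: "wronskian P Q x = W" if "x \<in> ball w r" for x
    unfolding P_def Q_def using solves_on_lincomb(2)[OF _ r(2,3)] that r det by simp
  have "\<forall>\<^sub>F x in nhds w. x \<in> ball w (min r s)" using r s by (intro eventually_nhds_in_open) auto
  \<comment> \<open>In cross-multiplied form the relation needs no case distinction at infinity; the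
    nonzero Wronskians exclude a common zero of numerator and denominator.\<close>
  with m(2) have cross: "\<forall>\<^sub>F x in nhds w. t1 x * Q x = t2 x * P x"
  proof eventually_elim
    case (elim x)
    have x: "x \<in> ball w r" "x \<in> ball w s" using elim by auto
    have nz: "(v1 x, v2 x) \<noteq> (0, 0)" "(t1 x, t2 x) \<noteq> (0, 0)" "(P x, Q x) \<noteq> (0, 0)"
      using r(4)[OF x(1)] s(4)[OF x(2)] WPQ[OF x(1)] W_nonzero by (auto simp: wronskian_def)
    have "proj_ratio (t1 x) (t2 x) = proj_ratio (P x) (Q x)"
      using elim(1) moebius_proj_ratio[OF nz(1)] det unfolding m_eq P_def Q_def by simp
    then show ?case using proj_ratio_eqD nz by blast
  qed
  have diff: "f field_differentiable at w" if "solves_on q (ball w e) f" "e > 0" for f e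
    using that by (auto simp: solves_on_def intro: holomorphic_on_imp_differentiable_at)
  have vd: "v1 field_differentiable at w" "v2 field_differentiable at w" using diff r by blast+
  have "P field_differentiable at w" "Q field_differentiable at w"
    unfolding P_def Q_def using vd by (auto intro!: derivative_intros)
  then obtain \<epsilon> where \<epsilon>: "\<epsilon>\<^sup>2 = 1" "t1 w = \<epsilon> * P w" "t2 w = \<epsilon> * Q w"
    using proportional_pairs_same_wronskian[OF cross diff[OF s(2,1)] diff[OF s(3,1)]] WPQ s W_nonzero r by auto
  have "\<epsilon> = 1 \<or> \<epsilon> = -1" using \<epsilon>(1) by (simp add: power2_eq_1_iff)
  then have "t1 w * cnj (t2 w) = P w * cnj (Q w)" using \<epsilon>(2,3) by auto
  then show ?thesis unfolding P_def Q_def using Im_hermitian_real_unimodular[OF abcd] by simp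
qed

text \<open>The choice is harmless by \<open>hermitian_unique\<close>. Off \<open>X\<close> there
  are no branches and the value is arbitrary, so statements about this function carry
  \<open>w \<in> X\<close>.\<close>

definition hermitian_form :: "complex \<Rightarrow> real" where
  "hermitian_form w = (SOME r. \<exists>v1 v2. branch_pair w v1 v2 \<and> r = Im (v1 w * cnj (v2 w)))"

lemma hermitian_form_eq:
  assumes "branch_pair w v1 v2"
  shows "hermitian_form w = Im (v1 w * cnj (v2 w))"
proof -
  have "\<exists>r v1 v2. branch_pair w v1 v2 \<and> r = Im (v1 w * cnj (v2 w))"
    by (rule exI, rule exI[of _ v1], rule exI[of _ v2]) (simp add: assms)
  then have "\<exists>v1 v2. branch_pair w v1 v2 \<and> hermitian_form w = Im (v1 w * cnj (v2 w))"
    unfolding hermitian_form_def by (rule someI_ex)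
  then obtain t1 t2 where "branch_pair w t1 t2" "hermitian_form w = Im (t1 w * cnj (t2 w))" by blast
  then show ?thesis using hermitian_unique[OF assms] by simp
qed

lemma hermitian_form_local:
  assumes "w \<in> X"
  obtains \<rho> v1 v2 where "\<rho> > 0" "ball w \<rho> \<subseteq> X" "v1 holomorphic_on ball w \<rho>" "v2 holomorphic_on ball w \<rho>"
    "\<And>x. x \<in> ball w \<rho> \<Longrightarrow> wronskian v1 v2 x = W"
    "\<And>x. x \<in> ball w \<rho> \<Longrightarrow> hermitian_form x = Im (v1 x * cnj (v2 x))"
proof -
  obtain v1 v2 where b: "branch_pair w v1 v2" using branch_pair_exists assms by blast
  obtain r where r: "r > 0" "ball w r \<subseteq> X" "v1 holomorphic_on ball w r" "v2 holomorphic_on ball w r"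
    "\<And>x. x \<in> ball w r \<Longrightarrow> wronskian v1 v2 x = W"
    using branch_pair_solution_germ[OF b] by (auto simp: solution_germ_def solves_on_def)
  moreover have "hermitian_form x = Im (v1 x * cnj (v2 x))" if "x \<in> ball w r" for x
    using branch_pair_move_ball[OF b r(3,4,2) _ that] r(1) hermitian_form_eq by simp
  ultimately show ?thesis using that by blast
qed

text \<open>Im (v1 / v2) = J / |v2|^2, and where the ratio is infinite \<open>v2\<close> vanishes
  and J with it.\<close>

lemma preimage_real_line_iff:
  "w \<in> preimage_real_line (ratio_branches X p u1 u2) \<longleftrightarrow> w \<in> X \<and> hermitian_form w = 0"
proof -
  have *: "proj_ratio (v1 w) (v2 w) \<in> real_line \<longleftrightarrow> hermitian_form w = 0"
    if b: "branch_pair w v1 v2" for v1 v2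
  proof (cases "v2 w = 0")
    case False
    have "v1 w / v2 w = v1 w * cnj (v2 w) / of_real ((cmod (v2 w))\<^sup>2)"
      unfolding complex_norm_square using False by simp
    then have "Im (v1 w / v2 w) = Im (v1 w * cnj (v2 w)) / (cmod (v2 w))\<^sup>2"
      by (metis Im_divide_of_real)
    then show ?thesis using False hermitian_form_eq[OF b]
      by (auto simp: proj_ratio_def real_line_def complex_is_Real_iff image_iff)
  qed (use hermitian_form_eq[OF b] in \<open>auto simp: proj_ratio_def real_line_def\<close>)
  show ?thesis
  proof
    assume "w \<in> preimage_real_line (ratio_branches X p u1 u2)"
    then obtain f where f: "f \<in> ratio_branches X p u1 u2 w" "f w \<in> real_line"
      unfolding preimage_real_line_def by blast
    then obtain v1 v2 where b: "branch_pair w v1 v2" and ev: "\<forall>\<^sub>F x in nhds w. f x = proj_ratio (v1 x) (v2 x)"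
      unfolding ratio_branches_iff by blast
    have "f w = proj_ratio (v1 w) (v2 w)" using ev by (rule eventually_nhds_x_imp_x)
    then show "w \<in> X \<and> hermitian_form w = 0"
      using *[OF b] f(2) branch_pair_solution_germ(2)[OF b] by simp
  next
    assume w: "w \<in> X \<and> hermitian_form w = 0"
    then obtain v1 v2 where "branch_pair w v1 v2" using branch_pair_exists by blast
    then have "(\<lambda>x. proj_ratio (v1 x) (v2 x)) \<in> ratio_branches X p u1 u2 w" "proj_ratio (v1 w) (v2 w) \<in> real_line"
      using * w branch_pair_ratio by simp_all
    then show "w \<in> preimage_real_line (ratio_branches X p u1 u2)"
      unfolding preimage_real_line_def by (intro CollectI bexI[of _ "\<lambda>x. proj_ratio (v1 x) (v2 x)"])
  qed
qed

text \<open>The ratio has derivative - W / v2^2 and imaginary part J / |v2|^2; the powers of |v2|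
  cancel in the quotient.\<close>

lemma phi_value_iff:
  assumes "w \<in> X" "hermitian_form w \<noteq> 0"
  shows "phi_value (ratio_branches X p u1 u2) w r \<longleftrightarrow> exp r = (cmod W)\<^sup>2 / (hermitian_form w)\<^sup>2"
proof -
  have *: "f w \<noteq> None \<and> (cmod (deriv (\<lambda>x. the (f x)) w))\<^sup>2 / (Im (the (f w)))\<^sup>2 = (cmod W)\<^sup>2 / (hermitian_form w)\<^sup>2"
    if f: "f \<in> ratio_branches X p u1 u2 w" for f
  proof -
    obtain v1 v2 where b: "branch_pair w v1 v2" and ev: "\<forall>\<^sub>F x in nhds w. f x = proj_ratio (v1 x) (v2 x)"
      using f unfolding ratio_branches_iff by blast
    obtain r where r: "r > 0" "ball w r \<subseteq> X" "v1 holomorphic_on ball w r" "v2 holomorphic_on ball w r"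
      "\<And>x. x \<in> ball w r \<Longrightarrow> wronskian v1 v2 x = W"
      using branch_pair_solution_germ[OF b] by (auto simp: solution_germ_def solves_on_def)
    have J: "hermitian_form w = Im (v1 w * cnj (v2 w))" by (rule hermitian_form_eq[OF b])
    have nz: "v2 w \<noteq> 0" using assms J by auto
    have d: "(v1 has_field_derivative deriv v1 w) (at w)" "(v2 has_field_derivative deriv v2 w) (at w)"
      using holomorphic_derivI[OF r(3) open_ball] holomorphic_derivI[OF r(4) open_ball] r(1) by simp_all
    have "\<forall>\<^sub>F x in nhds w. v2 x \<noteq> 0"
    proof (rule tendsto_imp_eventually_ne[OF _ nz])
      show "(v2 \<longlongrightarrow> v2 w) (nhds w)"
        using DERIV_isCont[OF d(2)] by (simp add: isCont_def tendsto_at_iff_tendsto_nhds)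
    qed
    with ev have "\<forall>\<^sub>F x in nhds w. the (f x) = v1 x / v2 x"
      by eventually_elim (simp add: proj_ratio_def)
    then have "deriv (\<lambda>x. the (f x)) w = deriv (\<lambda>x. v1 x / v2 x) w" by (rule deriv_cong_ev) simp
    also have "\<dots> = - W / (v2 w)\<^sup>2"
    proof -
      have "- wronskian v1 v2 w / (v2 w)\<^sup>2 = (deriv v1 w * v2 w - v1 w * deriv v2 w) / (v2 w * v2 w)"
        by (simp add: wronskian_def power2_eq_square)
      moreover have "deriv (\<lambda>x. v1 x / v2 x) w = (deriv v1 w * v2 w - v1 w * deriv v2 w) / (v2 w * v2 w)"
        by (rule DERIV_imp_deriv[OF DERIV_divide[OF d nz]])
      ultimately show ?thesis using r(5)[of w] r(1) by simp
    qed
    finally have 1: "cmod (deriv (\<lambda>x. the (f x)) w) = cmod W / (cmod (v2 w))\<^sup>2"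
      by (simp add: norm_divide norm_power)
    have fw: "f w = proj_ratio (v1 w) (v2 w)" using ev by (rule eventually_nhds_x_imp_x)
    have "v1 w / v2 w = v1 w * cnj (v2 w) / of_real ((cmod (v2 w))\<^sup>2)"
      unfolding complex_norm_square using nz by simp
    then have "Im (v1 w / v2 w) = hermitian_form w / (cmod (v2 w))\<^sup>2"
      unfolding J by (metis Im_divide_of_real)
    then show ?thesis using fw nz 1 by (simp add: proj_ratio_def power_divide)
  qed
  obtain v1 v2 where "branch_pair w v1 v2" using branch_pair_exists assms by blast
  then obtain f0 where f0: "f0 \<in> ratio_branches X p u1 u2 w"
    using branch_pair_ratio by blast
  show ?thesis unfolding phi_value_def
  proof (intro iffI conjI ballI)
    assume "ratio_branches X p u1 u2 w \<noteq> {} \<and> (\<forall>f\<in>ratio_branches X p u1 u2 w. f w \<noteq> None \<and>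
        exp r = (cmod (deriv (\<lambda>x. the (f x)) w))\<^sup>2 / (Im (the (f w)))\<^sup>2)"
    then have "exp r = (cmod (deriv (\<lambda>x. the (f0 x)) w))\<^sup>2 / (Im (the (f0 w)))\<^sup>2" using f0 by blast
    then show "exp r = (cmod W)\<^sup>2 / (hermitian_form w)\<^sup>2" using *[OF f0] by simp
  next
    assume e: "exp r = (cmod W)\<^sup>2 / (hermitian_form w)\<^sup>2"
    show "ratio_branches X p u1 u2 w \<noteq> {}" using f0 by blast
    fix f assume f: "f \<in> ratio_branches X p u1 u2 w"
    show "f w \<noteq> None" using *[OF f] by blast
    show "exp r = (cmod (deriv (\<lambda>x. the (f x)) w))\<^sup>2 / (Im (the (f w)))\<^sup>2" using *[OF f] e by simp
  qed
qed

lemma phi_eq: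
  assumes "w \<in> X" "hermitian_form w \<noteq> 0"
  shows "\<exists>!r. phi_value (ratio_branches X p u1 u2) w r"
    and "phi (ratio_branches X p u1 u2) w = ln ((cmod W)\<^sup>2 / (hermitian_form w)\<^sup>2)"
    and "exp (phi (ratio_branches X p u1 u2) w) = (cmod W)\<^sup>2 / (hermitian_form w)\<^sup>2"
proof -
  have pos: "(cmod W)\<^sup>2 / (hermitian_form w)\<^sup>2 > 0" using assms W_nonzero by simp
  then have iff: "phi_value (ratio_branches X p u1 u2) w r \<longleftrightarrow> r = ln ((cmod W)\<^sup>2 / (hermitian_form w)\<^sup>2)" for r
    unfolding phi_value_iff[OF assms] using exp_ln[OF pos] by (metis ln_exp)
  show "\<exists>!r. phi_value (ratio_branches X p u1 u2) w r" unfolding iff by simp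
  show 1: "phi (ratio_branches X p u1 u2) w = ln ((cmod W)\<^sup>2 / (hermitian_form w)\<^sup>2)"
    unfolding phi_def iff by simp
  show "exp (phi (ratio_branches X p u1 u2) w) = (cmod W)\<^sup>2 / (hermitian_form w)\<^sup>2"
    unfolding 1 using pos by simp
qed

end

section \<open>The equation near a puncture\<close>

text \<open>The Liouville transformation for x = z0 + exp (\<sigma> s): the factor exp (\<sigma> s /
  2), a square root of x - z0, removes the first-order term, and its own second derivative
  contributes the 1/4. The sign is 1 at a finite puncture and -1 at infinity; \<open>l\<close> is a
  local inverse of the substitution.\<close>

lemma exponential_substitution:
  assumes \<sigma>: "\<sigma> = 1 \<or> \<sigma> = (-1 :: complex)" and B: "open B"
    and v: "\<And>s. s \<in> S \<Longrightarrow> (v has_field_derivative dv s) (at s)"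
    and dv: "\<And>s. s \<in> S \<Longrightarrow> (dv has_field_derivative R (exp s) * v s) (at s)"
    and l: "\<And>x. x \<in> B \<Longrightarrow> l x \<in> S" "\<And>x. x \<in> B \<Longrightarrow> z0 + exp (\<sigma> * l x) = x"
      "\<And>x. x \<in> B \<Longrightarrow> (l has_field_derivative \<sigma> * exp (- (\<sigma> * l x))) (at x)"
    and q: "\<And>s. s \<in> S \<Longrightarrow> q (z0 + exp (\<sigma> * s)) * exp (2 * \<sigma> * s) = 1 / 4 - R (exp s)"
  defines "u \<equiv> (\<lambda>x. exp (\<sigma> * l x / 2) * v (l x))"
  shows "\<And>x. x \<in> B \<Longrightarrow> deriv u x = exp (- (\<sigma> * l x) / 2) * (v (l x) / 2 + \<sigma> * dv (l x))"
    and "solves_on q B u"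
proof -
  have \<sigma>2: "\<sigma> * \<sigma> = 1" using \<sigma> by auto
  have \<sigma>2': "\<sigma> * (\<sigma> * a) = a" for a by (simp add: mult.assoc[symmetric] \<sigma>2)
  let ?du = "\<lambda>x. exp (- (\<sigma> * l x) / 2) * (v (l x) / 2 + \<sigma> * dv (l x))"
  have vl: "((\<lambda>x. v (l x)) has_field_derivative dv (l x) * (\<sigma> * exp (- (\<sigma> * l x)))) (at x)" if "x \<in> B" for x
    by (rule DERIV_chain2[OF v[OF l(1)[OF that]] l(3)[OF that]])
  have dvl: "((\<lambda>x. dv (l x)) has_field_derivative R (exp (l x)) * v (l x) * (\<sigma> * exp (- (\<sigma> * l x)))) (at x)" if "x \<in> B" for x
    by (rule DERIV_chain2[OF dv[OF l(1)[OF that]] l(3)[OF that]])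
  have el: "((\<lambda>x. exp (a * (\<sigma> * l x))) has_field_derivative exp (a * (\<sigma> * l x)) * a * exp (- (\<sigma> * l x))) (at x)"
    if "x \<in> B" for x a
    using l(3)[OF that] by (auto intro!: derivative_eq_intros simp: \<sigma>2' mult_ac)
  have half: "exp (1 / 2 * t) * exp (- t) = exp (- t / 2)" for t :: complex
    by (simp flip: exp_add)
  have du: "(u has_field_derivative ?du x) (at x)" if x: "x \<in> B" for x
  proof -
    have "((\<lambda>x. exp (1/2 * (\<sigma> * l x)) * v (l x)) has_field_derivative
        exp (1/2 * (\<sigma> * l x)) * (1/2) * exp (- (\<sigma> * l x)) * v (l x) + dv (l x) * (\<sigma> * exp (- (\<sigma> * l x))) * exp (1/2 * (\<sigma> * l x))) (at x)"
      by (rule DERIV_mult[OF el[OF x] vl[OF x]])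
    also have "exp (1/2 * (\<sigma> * l x)) * (1/2) * exp (- (\<sigma> * l x)) * v (l x) + dv (l x) * (\<sigma> * exp (- (\<sigma> * l x))) * exp (1/2 * (\<sigma> * l x))
       = (exp (1/2 * (\<sigma> * l x)) * exp (- (\<sigma> * l x))) * (v (l x) / 2 + \<sigma> * dv (l x))" by (simp add: algebra_simps)
    finally show ?thesis unfolding half u_def by simp
  qed
  then show deriv_u: "deriv u x = ?du x" if "x \<in> B" for x using that by (simp add: DERIV_imp_deriv)
  have ddu: "(?du has_field_derivative - (q x * u x)) (at x)" if x: "x \<in> B" for x
  proof -
    let ?e = "exp (- (1/2) * (\<sigma> * l x)) * exp (- (\<sigma> * l x))"
    have "((\<lambda>x. exp (- (1/2) * (\<sigma> * l x)) * (v (l x) / 2 + \<sigma> * dv (l x))) has_field_derivative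
        exp (- (1/2) * (\<sigma> * l x)) * (- (1/2)) * exp (- (\<sigma> * l x)) * (v (l x) / 2 + \<sigma> * dv (l x))
        + (dv (l x) * (\<sigma> * exp (- (\<sigma> * l x))) / 2 + \<sigma> * (R (exp (l x)) * v (l x) * (\<sigma> * exp (- (\<sigma> * l x))))) * exp (- (1/2) * (\<sigma> * l x))) (at x)"
      by (rule DERIV_mult[OF el[OF x] DERIV_add[OF DERIV_cdivide[OF vl[OF x]] DERIV_cmult[OF dvl[OF x]]]])
    also have "exp (- (1/2) * (\<sigma> * l x)) * (- (1/2)) * exp (- (\<sigma> * l x)) * (v (l x) / 2 + \<sigma> * dv (l x))
        + (dv (l x) * (\<sigma> * exp (- (\<sigma> * l x))) / 2 + \<sigma> * (R (exp (l x)) * v (l x) * (\<sigma> * exp (- (\<sigma> * l x))))) * exp (- (1/2) * (\<sigma> * l x))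
        = ?e * (R (exp (l x)) * (\<sigma> * \<sigma>) - 1 / 4) * v (l x)" by (simp add: algebra_simps)
    also have "R (exp (l x)) * (\<sigma> * \<sigma>) - 1 / 4 = - (q x * exp (2 * \<sigma> * l x))"
      using q[OF l(1)[OF x]] unfolding l(2)[OF x] \<sigma>2 by simp
    also have "?e * (- (q x * exp (2 * \<sigma> * l x))) * v (l x) = - (?e * (q x * exp (2 * \<sigma> * l x)) * v (l x))" by simp
    also have "?e * (q x * exp (2 * \<sigma> * l x)) * v (l x) = q x * (?e * exp (2 * \<sigma> * l x)) * v (l x)" by (simp only: mult_ac)
    also have "?e * exp (2 * \<sigma> * l x) = exp (\<sigma> * l x / 2)" by (simp flip: exp_add)
    finally show ?thesis by (simp add: u_def mult.assoc)
  qed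
  show "solves_on q B u" unfolding solves_on_def
  proof (intro conjI ballI)
    show "u holomorphic_on B" using du B holomorphic_on_open by blast
    fix x assume x: "x \<in> B"
    have "\<forall>\<^sub>F y in nhds x. y \<in> B" using B x by (rule eventually_nhds_in_open)
    then have "\<forall>\<^sub>F y in nhds x. deriv u y = ?du y" by eventually_elim (rule deriv_u)
    then have "deriv (deriv u) x = deriv ?du x" by (rule deriv_cong_ev) simp
    also have "\<dots> = - (q x * u x)" by (rule DERIV_imp_deriv[OF ddu[OF x]])
    finally show "deriv (deriv u) x + q x * u x = 0" by simp
  qed
qed

text \<open>The branch of the inverse of \<open>s \<mapsto> z0 + exp (\<sigma> s)\<close>, where \<open>\<sigma> = \<plusminus>1\<close>, that sends the image of \<open>s\<close> to \<open>s\<close>.\<close>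
definition exp_inverse :: "complex \<Rightarrow> complex \<Rightarrow> complex \<Rightarrow> complex \<Rightarrow> complex" where
  "exp_inverse \<sigma> z0 s x = s + \<sigma> * Ln ((x - z0) / exp (\<sigma> * s))"

lemma exp_inverse:
  assumes \<sigma>: "\<sigma> = 1 \<or> \<sigma> = (-1 :: complex)"
  shows "exp_inverse \<sigma> z0 s (z0 + exp (\<sigma> * s)) = s"
    and "x \<noteq> z0 \<Longrightarrow> z0 + exp (\<sigma> * exp_inverse \<sigma> z0 s x) = x"
    and "x \<in> ball (z0 + exp (\<sigma> * s)) (norm (exp (\<sigma> * s))) \<Longrightarrow>
      (exp_inverse \<sigma> z0 s has_field_derivative \<sigma> * exp (- (\<sigma> * exp_inverse \<sigma> z0 s x))) (at x)"
proof -
  have \<sigma>2: "\<sigma> * \<sigma> = 1" using \<sigma> by auto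
  have \<sigma>2': "\<sigma> * (\<sigma> * a) = a" for a by (simp add: mult.assoc[symmetric] \<sigma>2)
  show "exp_inverse \<sigma> z0 s (z0 + exp (\<sigma> * s)) = s" by (simp add: exp_inverse_def)
  show 1: "z0 + exp (\<sigma> * exp_inverse \<sigma> z0 s x) = x" if "x \<noteq> z0" for x
    using that by (simp add: exp_inverse_def distrib_left \<sigma>2' exp_add)
  assume x: "x \<in> ball (z0 + exp (\<sigma> * s)) (norm (exp (\<sigma> * s)))"
  \<comment> \<open>The quotient stays in the unit disc about 1, hence in the right half-plane, away
    from the branch cut of Ln.\<close>
  have "norm ((x - z0) / exp (\<sigma> * s) - 1) < 1"
  proof -
    have "(x - z0) / exp (\<sigma> * s) - 1 = (x - z0 - exp (\<sigma> * s)) / exp (\<sigma> * s)"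
      by (simp add: diff_divide_distrib)
    then have "norm ((x - z0) / exp (\<sigma> * s) - 1) = norm (x - z0 - exp (\<sigma> * s)) / norm (exp (\<sigma> * s))"
      by (simp only: norm_divide)
    also have "\<dots> < 1" using x by (simp add: divide_less_eq dist_norm norm_minus_commute algebra_simps)
    finally show ?thesis .
  qed
  then have "Re ((x - z0) / exp (\<sigma> * s)) > 0"
    using abs_Re_le_cmod[of "(x - z0) / exp (\<sigma> * s) - 1"] by simp
  then have nr: "(x - z0) / exp (\<sigma> * s) \<notin> \<real>\<^sub>\<le>\<^sub>0" by (auto simp: complex_nonpos_Reals_iff)
  then have xz: "x \<noteq> z0" by auto
  have d: "(exp_inverse \<sigma> z0 s has_field_derivative \<sigma> * (1 / exp (\<sigma> * s) * inverse ((x - z0) / exp (\<sigma> * s)))) (at x)"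
    unfolding exp_inverse_def[abs_def] using nr
    by (auto intro!: derivative_eq_intros simp: field_simps)
  have "exp (\<sigma> * exp_inverse \<sigma> z0 s x) = x - z0" using 1[OF xz] by (simp add: algebra_simps)
  then have "exp (- (\<sigma> * exp_inverse \<sigma> z0 s x)) = 1 / exp (\<sigma> * s) * inverse ((x - z0) / exp (\<sigma> * s))"
    using xz by (simp add: exp_minus field_simps)
  then show "(exp_inverse \<sigma> z0 s has_field_derivative \<sigma> * exp (- (\<sigma> * exp_inverse \<sigma> z0 s x))) (at x)"
    using d by simp
qed

text \<open>Seen from base \<open>a\<close>, the candidate logarithm is
  \<open>b + \<sigma> * (s - a)\<close>, of norm below 1 + 1 < pi. In this range Ln inverts exp, so
  both bases select the same branch.\<close>

lemma exp_inverse_change_base: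
  assumes \<sigma>: "\<sigma> = 1 \<or> \<sigma> = (-1 :: complex)" and close: "norm (s - a) < 1"
  shows "\<forall>\<^sub>F x in nhds (z0 + exp (\<sigma> * s)). exp_inverse \<sigma> z0 s x = exp_inverse \<sigma> z0 a x"
proof -
  have \<sigma>2: "\<sigma> * \<sigma> = 1" using \<sigma> by auto
  have \<sigma>2': "\<sigma> * (\<sigma> * b) = b" for b by (simp add: mult.assoc[symmetric] \<sigma>2)
  let ?x = "z0 + exp (\<sigma> * s)"
  have "isCont (\<lambda>x. Ln ((x - z0) / exp (\<sigma> * s))) ?x" by (intro continuous_intros) auto
  then have "((\<lambda>x. Ln ((x - z0) / exp (\<sigma> * s))) \<longlongrightarrow> Ln ((?x - z0) / exp (\<sigma> * s))) (nhds ?x)"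
    unfolding isCont_def tendsto_at_iff_tendsto_nhds[of "\<lambda>x. Ln ((x - z0) / exp (\<sigma> * s))" ?x] .
  then have "\<forall>\<^sub>F x in nhds ?x. dist (Ln ((x - z0) / exp (\<sigma> * s))) (Ln ((?x - z0) / exp (\<sigma> * s))) < 1"
    by (rule tendstoD) simp
  moreover have "\<forall>\<^sub>F x in nhds ?x. x \<noteq> z0" by (rule t1_space_nhds) simp
  ultimately show ?thesis
  proof eventually_elim
    case (elim x)
    define b where "b = Ln ((x - z0) / exp (\<sigma> * s))"
    have nb: "norm b < 1" using elim(1) by (simp add: b_def)
    have n\<sigma>: "norm (\<sigma> * (s - a)) < 1" using close \<sigma> by (auto simp: norm_minus_commute)
    have "norm (b + \<sigma> * (s - a)) < 2" using norm_triangle_ineq[of b "\<sigma> * (s - a)"] nb n\<sigma> by linarith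
    then have "\<bar>Im (b + \<sigma> * (s - a))\<bar> < pi" using abs_Im_le_cmod[of "b + \<sigma> * (s - a)"] pi_gt3 by linarith
    then have "Ln (exp (b + \<sigma> * (s - a))) = b + \<sigma> * (s - a)" by (intro Ln_exp) auto
    moreover have "exp (b + \<sigma> * (s - a)) = (x - z0) / exp (\<sigma> * a)"
      using elim(2) by (simp add: b_def exp_add exp_diff right_diff_distrib)
    ultimately have "Ln ((x - z0) / exp (\<sigma> * a)) = b + \<sigma> * (s - a)" by simp
    then show ?case by (simp add: exp_inverse_def b_def[symmetric] distrib_left \<sigma>2')
  qed
qed

text \<open>In the coordinate s, functions holomorphic on all of \<open>S\<close> describe a
  continuation. Two parameters over the same point of \<open>X\<close>, such as s and s + 2 pi i,
  then yield two branches there, which is how the local monodromy becomes visible.\<close>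

lemma (in solution_pair) branch_pair_along_exp:
  assumes \<sigma>: "\<sigma> = 1 \<or> \<sigma> = (-1 :: complex)" and S: "open S" "connected S"
    and X: "\<And>s. s \<in> S \<Longrightarrow> z0 + exp (\<sigma> * s) \<in> X" and V: "V1 holomorphic_on S" "V2 holomorphic_on S"
    and s: "s0 \<in> S" "s1 \<in> S"
    and b: "branch_pair (z0 + exp (\<sigma> * s0)) (\<lambda>x. V1 (exp_inverse \<sigma> z0 s0 x)) (\<lambda>x. V2 (exp_inverse \<sigma> z0 s0 x))"
  shows "branch_pair (z0 + exp (\<sigma> * s1)) (\<lambda>x. V1 (exp_inverse \<sigma> z0 s1 x)) (\<lambda>x. V2 (exp_inverse \<sigma> z0 s1 x))"
proof (rule connected_induction_simple[where P = "\<lambda>s. branch_pair (z0 + exp (\<sigma> * s))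
      (\<lambda>x. V1 (exp_inverse \<sigma> z0 s x)) (\<lambda>x. V2 (exp_inverse \<sigma> z0 s x))", OF S(2) s b])
  fix a assume a: "a \<in> S"
  let ?E = "\<lambda>s. z0 + exp (\<sigma> * s)"
  let ?l = "exp_inverse \<sigma> z0 a"
  have dl: "(?l has_field_derivative \<sigma> * exp (- (\<sigma> * ?l x))) (at x)" if "x \<in> ball (?E a) (norm (exp (\<sigma> * a)))" for x
    using exp_inverse(3)[OF \<sigma> that] .
  have hol: "?l holomorphic_on ball (?E a) (norm (exp (\<sigma> * a)))"
    using dl holomorphic_on_open by blast
  have "open (ball (?E a) (norm (exp (\<sigma> * a))) \<inter> ?l -` S)"
    using hol S(1) by (intro continuous_open_preimage holomorphic_on_imp_continuous_on) auto
  then have "open (ball (?E a) (norm (exp (\<sigma> * a))) \<inter> ?l -` S \<inter> X)" using open_X by (rule open_Int)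
  moreover have "?E a \<in> ball (?E a) (norm (exp (\<sigma> * a))) \<inter> ?l -` S \<inter> X"
    using a X exp_inverse(1)[OF \<sigma>] by simp
  ultimately obtain e where e: "e > 0" "ball (?E a) e \<subseteq> ball (?E a) (norm (exp (\<sigma> * a))) \<inter> ?l -` S \<inter> X"
    by (meson open_contains_ball)
  have hl: "?l holomorphic_on ball (?E a) e" using hol e(2) holomorphic_on_subset by blast
  have hV: "(\<lambda>x. V1 (?l x)) holomorphic_on ball (?E a) e" "(\<lambda>x. V2 (?l x)) holomorphic_on ball (?E a) e"
    using holomorphic_on_compose_gen[OF hl V(1)] holomorphic_on_compose_gen[OF hl V(2)] e(2) by (auto simp: o_def)
  have "isCont ?E a" by (intro continuous_intros)
  then obtain d where d: "d > 0" "\<And>s. dist s a < d \<Longrightarrow> dist (?E s) (?E a) < e"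
    using e(1) unfolding continuous_at_eps_delta by blast
  \<comment> \<open>The radius \<open>d\<close> keeps the image in the ball around the base point;
    the radius 1 is the hypothesis of \<open>exp_inverse_change_base\<close>.\<close>
  define T where "T = S \<inter> ball a (min d 1)"
  have TE: "?E s \<in> ball (?E a) e" if "s \<in> T" for s
    using that d(2)[of s] by (simp add: T_def dist_commute)
  have Tl: "\<forall>\<^sub>F x in nhds (?E s). V (exp_inverse \<sigma> z0 s x) = V (?l x)" if "s \<in> T" for s and V :: "complex \<Rightarrow> complex"
  proof -
    have "norm (s - a) < 1" using that by (simp add: T_def dist_norm norm_minus_commute)
    from exp_inverse_change_base[OF \<sigma> this] show ?thesis by eventually_elim simp
  qed
  show "\<exists>T. openin (top_of_set S) T \<and> a \<in> T \<and> (\<forall>x\<in>T. \<forall>y\<in>T.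
      branch_pair (?E x) (\<lambda>z. V1 (exp_inverse \<sigma> z0 x z)) (\<lambda>z. V2 (exp_inverse \<sigma> z0 x z)) \<longrightarrow>
      branch_pair (?E y) (\<lambda>z. V1 (exp_inverse \<sigma> z0 y z)) (\<lambda>z. V2 (exp_inverse \<sigma> z0 y z)))"
  proof (rule exI[of _ T], intro conjI ballI impI)
    show "openin (top_of_set S) T" unfolding T_def by (intro openin_open_Int) auto
    show "a \<in> T" using a d by (simp add: T_def)
    fix x y assume x: "x \<in> T" and y: "y \<in> T"
      and bx: "branch_pair (?E x) (\<lambda>z. V1 (exp_inverse \<sigma> z0 x z)) (\<lambda>z. V2 (exp_inverse \<sigma> z0 x z))"
    have "branch_pair (?E x) (\<lambda>z. V1 (?l z)) (\<lambda>z. V2 (?l z))"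
      by (rule branch_pair_cong[OF bx Tl[OF x] Tl[OF x]])
    then have "branch_pair (?E y) (\<lambda>z. V1 (?l z)) (\<lambda>z. V2 (?l z))"
      by (rule branch_pair_move_ball[OF _ hV _ TE[OF x] TE[OF y]]) (use e(2) in blast)
    then show "branch_pair (?E y) (\<lambda>z. V1 (exp_inverse \<sigma> z0 y z)) (\<lambda>z. V2 (exp_inverse \<sigma> z0 y z))"
      by (rule branch_pair_cong) (use Tl[OF y] in \<open>simp_all add: eq_commute\<close>)
  qed
qed

text \<open>\<open>G\<close> is A |L|^2 plus a real-linear term Im (\<kappa> L) plus
  \<open>D\<close>. The values at L, L + 2 pi i and L + 4 pi i have second difference 8 pi^2 A, so A
  = 0; the first difference then kills the coefficient of Im L. The discriminant |\<kappa>|^2 - 4 A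
  D equals |\<alpha> \<delta> - \<beta> \<gamma>|^2, which determines the remaining coefficient up
  to sign.\<close>

lemma quadratic_form_periodic:
  fixes \<alpha> \<beta> \<gamma> \<delta> L :: complex
  defines "G \<equiv> (\<lambda>L. Im ((\<alpha> + \<beta> * L) * cnj (\<gamma> + \<delta> * L)))"
  assumes 1: "G (L + 2 * of_real pi * \<i>) = G L" and 2: "G (L + 4 * of_real pi * \<i>) = G L"
  shows "\<exists>k D. k\<^sup>2 = (cmod (\<alpha> * \<delta> - \<beta> * \<gamma>))\<^sup>2 \<and> (\<forall>L. G L = k * Re L + D)"
proof -
  define A where "A = Im (\<beta> * cnj \<delta>)"
  define \<kappa> where "\<kappa> = \<beta> * cnj \<gamma> - cnj \<alpha> * \<delta>"
  define D where "D = Im (\<alpha> * cnj \<gamma>)"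
  have G: "G L = A * ((Re L)\<^sup>2 + (Im L)\<^sup>2) + (Re \<kappa> * Im L + Im \<kappa> * Re L) + D" for L
    by (simp add: G_def A_def \<kappa>_def D_def power2_eq_square algebra_simps)
  have e1: "A * (4 * pi * Im L + 4 * pi\<^sup>2) + 2 * pi * Re \<kappa> = 0"
    using 1 unfolding G by (simp add: power2_eq_square algebra_simps)
  have e2: "A * (8 * pi * Im L + 16 * pi\<^sup>2) + 4 * pi * Re \<kappa> = 0"
    using 2 unfolding G by (simp add: power2_eq_square algebra_simps)
  have "A * (8 * pi\<^sup>2) = (A * (8 * pi * Im L + 16 * pi\<^sup>2) + 4 * pi * Re \<kappa>)
      - 2 * (A * (4 * pi * Im L + 4 * pi\<^sup>2) + 2 * pi * Re \<kappa>)" by (simp add: algebra_simps)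
  also have "\<dots> = 0" unfolding e1 e2 by simp
  finally have "A * (8 * pi\<^sup>2) = 0" .
  then have A: "A = 0" by simp
  then have \<kappa>: "Re \<kappa> = 0" using e1 by simp
  have "(cmod (\<alpha> * \<delta> - \<beta> * \<gamma>))\<^sup>2 = (cmod \<kappa>)\<^sup>2 - 4 * A * D"
    unfolding cmod_power2 A_def \<kappa>_def D_def by (simp add: power2_eq_square algebra_simps)
  then have "(Im \<kappa>)\<^sup>2 = (cmod (\<alpha> * \<delta> - \<beta> * \<gamma>))\<^sup>2" using A \<kappa> by (simp add: cmod_power2)
  then show ?thesis using G A \<kappa> by (intro exI[of _ "Im \<kappa>"] exI[of _ D]) simp
qed

context real_solution_pair
begin

text \<open>A pair at one point of the half-plane is expressed in the explicit basis, and
  \<open>branch_pair_along_exp\<close> spreads this expression over the half-plane. There the form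
  is a positive factor times \<open>G (L s)\<close>, to which \<open>quadratic_form_periodic\<close>
  applies.\<close>

lemma hermitian_form_at_puncture:
  assumes \<sigma>: "\<sigma> = 1 \<or> \<sigma> = (-1 :: complex)" and R: "R holomorphic_on ball 0 \<rho>" "\<rho> > 0" "R 0 = 0"
    and X: "\<And>s. Re s < ln \<rho> \<Longrightarrow> z0 + exp (\<sigma> * s) \<in> X"
    and q: "\<And>s. Re s < ln \<rho> \<Longrightarrow> q (z0 + exp (\<sigma> * s)) * exp (2 * \<sigma> * s) = 1 / 4 - R (exp s)"
  shows "\<exists>r h H k D. 0 < r \<and> r \<le> \<rho> \<and> h holomorphic_on ball 0 r \<and> H holomorphic_on ball 0 r \<and> h 0 = 1 \<and>
     k\<^sup>2 = (cmod W)\<^sup>2 \<and>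
     (\<forall>s. Re s < ln r \<longrightarrow> hermitian_form (z0 + exp (\<sigma> * s))
        = exp (Re (\<sigma> * s)) * (cmod (h (exp s)))\<^sup>2 * (k * Re (s + H (exp s)) + D))"
proof -
  have \<sigma>2: "\<sigma> * \<sigma> = 1" using \<sigma> by auto
  obtain r h where r: "0 < r" "r \<le> \<rho>" and h: "h holomorphic_on ball 0 r" "h 0 = 1" "\<And>y. y \<in> ball 0 r \<Longrightarrow> h y \<noteq> 0"
    and ode: "\<And>y. y \<in> ball 0 r \<Longrightarrow> y * deriv h y + y\<^sup>2 * deriv (deriv h) y = R y * h y"
    using frobenius_double_exponent[OF R] by blast
  define S where "S = {s. Re s < ln r}"
  have S: "open S" "connected S"
    unfolding S_def by (auto intro!: convex_connected simp: open_halfspace_Re_lt convex_halfspace_Re_lt)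
  have S\<rho>: "Re s < ln \<rho>" if "s \<in> S" for s
  proof -
    have "ln r \<le> ln \<rho>" using r by simp
    then show ?thesis using that by (simp add: S_def)
  qed
  have expS: "exp s \<in> ball 0 r" if "s \<in> S" for s
    using that r exp_less_mono[of "Re s" "ln r"] by (simp add: S_def)
  \<comment> \<open>Reduction of order: the second solution is \<open>v * L\<close> with L' = 1 /
    v^2. The value 1 of 1 / h^2 at 0 integrates to the summand s; the rest vanishes at 0, and
    divided by y it has a holomorphic primitive \<open>H\<close>.\<close>
  define g where "g = (\<lambda>y. 1 / (h y)\<^sup>2 - 1)"
  have g: "g holomorphic_on ball 0 r" unfolding g_def using h by (intro holomorphic_intros) auto
  have g0: "g 0 = 0" by (simp add: g_def h)
  define g1 where "g1 = (\<lambda>y. if y = 0 then deriv g 0 else (g y - g 0) / (y - 0))"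
  have "g1 holomorphic_on ball 0 r" unfolding g1_def by (rule pole_lemma_open[OF g]) simp
  then obtain H where H: "\<And>y. y \<in> ball 0 r \<Longrightarrow> (H has_field_derivative g1 y) (at y within ball 0 r)"
    using holomorphic_convex_primitive'[OF convex_ball open_ball] by blast
  have dH: "(H has_field_derivative g1 y) (at y)" if "y \<in> ball 0 r" for y
    using H[OF that] at_within_open[OF that open_ball] by simp
  have Hh: "H holomorphic_on ball 0 r" using dH holomorphic_on_open by blast
  have yg1: "y * g1 y = 1 / (h y)\<^sup>2 - 1" for y by (auto simp: g1_def g0 g_def h)
  define v where "v = (\<lambda>s. h (exp s))"
  define dv where "dv = (\<lambda>s. exp s * deriv h (exp s))"
  define L where "L = (\<lambda>s. s + H (exp s))"
  define v2 where "v2 = (\<lambda>s. v s * L s)"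
  define dv2 where "dv2 = (\<lambda>s. dv s * L s + 1 / v s)"
  have vnz: "v s \<noteq> 0" if "s \<in> S" for s using h(3) expS[OF that] by (simp add: v_def)
  have d_v: "(v has_field_derivative dv s) (at s)" if s: "s \<in> S" for s
    unfolding v_def dv_def using DERIV_chain2[OF holomorphic_derivI[OF h(1) open_ball expS[OF s]] DERIV_exp]
    by (simp add: mult.commute)
  have d_dv: "(dv has_field_derivative R (exp s) * v s) (at s)" if s: "s \<in> S" for s
  proof -
    have hd: "deriv h holomorphic_on ball 0 r" using h(1) by (simp add: holomorphic_deriv)
    have "((\<lambda>s. exp s * deriv h (exp s)) has_field_derivative
        exp s * deriv h (exp s) + deriv (deriv h) (exp s) * exp s * exp s) (at s)"
      by (rule DERIV_mult[OF DERIV_exp DERIV_chain2[OF holomorphic_derivI[OF hd open_ball expS[OF s]] DERIV_exp]])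
    then show ?thesis unfolding dv_def v_def using ode[OF expS[OF s]] by (simp add: power2_eq_square mult_ac)
  qed
  have d_L: "(L has_field_derivative 1 / (v s)\<^sup>2) (at s)" if s: "s \<in> S" for s
  proof -
    have "(L has_field_derivative 1 + g1 (exp s) * exp s) (at s)"
      unfolding L_def by (rule DERIV_add[OF DERIV_ident DERIV_chain2[OF dH[OF expS[OF s]] DERIV_exp]])
    then show ?thesis using yg1[of "exp s"] by (simp add: v_def mult.commute)
  qed
  have d_v2: "(v2 has_field_derivative dv2 s) (at s)" if s: "s \<in> S" for s
    unfolding v2_def dv2_def using DERIV_mult[OF d_v[OF s] d_L[OF s]] vnz[OF s]
    by (simp add: power2_eq_square field_simps)
  have d_dv2: "(dv2 has_field_derivative R (exp s) * v2 s) (at s)" if s: "s \<in> S" for s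
  proof -
    have "(dv2 has_field_derivative (R (exp s) * v s * L s + 1 / (v s)\<^sup>2 * dv s) + (0 * v s - 1 * dv s) / (v s * v s)) (at s)"
      unfolding dv2_def
      by (rule DERIV_add[OF DERIV_mult[OF d_dv[OF s] d_L[OF s]] DERIV_divide[OF DERIV_const d_v[OF s] vnz[OF s]]])
    then show ?thesis by (simp add: v2_def power2_eq_square mult_ac)
  qed
  define s0 :: complex where "s0 = of_real (ln r - 1)"
  have s0: "s0 \<in> S" by (simp add: S_def s0_def)
  let ?E = "\<lambda>s. z0 + exp (\<sigma> * s)"
  have EX: "?E s \<in> X" if "s \<in> S" for s using X S\<rho> that by blast
  let ?l = "exp_inverse \<sigma> z0 s0"
  obtain f1 f2 where b: "branch_pair (?E s0) f1 f2" using branch_pair_exists[OF EX[OF s0]] by blast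
  obtain e0 where e0: "e0 > 0" "solves_on q (ball (?E s0) e0) f1" "solves_on q (ball (?E s0) e0) f2"
    "\<And>x. x \<in> ball (?E s0) e0 \<Longrightarrow> wronskian f1 f2 x = W"
    using branch_pair_solution_germ(1)[OF b] unfolding solution_germ_def by blast
  have hol: "?l holomorphic_on ball (?E s0) (norm (exp (\<sigma> * s0)))"
    using exp_inverse(3)[OF \<sigma>] holomorphic_on_open by blast
  have "open (ball (?E s0) (norm (exp (\<sigma> * s0))) \<inter> ?l -` S)"
    using hol S(1) by (intro continuous_open_preimage holomorphic_on_imp_continuous_on) auto
  moreover have "?E s0 \<in> ball (?E s0) (norm (exp (\<sigma> * s0))) \<inter> ?l -` S"
    using s0 exp_inverse(1)[OF \<sigma>] by simp
  ultimately obtain e1 where e1: "e1 > 0" "ball (?E s0) e1 \<subseteq> ball (?E s0) (norm (exp (\<sigma> * s0))) \<inter> ?l -` S"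
    by (meson open_contains_ball)
  define B where "B = ball (?E s0) (min e0 e1)"
  have B: "open B" "connected B" "?E s0 \<in> B" "B \<subseteq> ball (?E s0) e0" "B \<subseteq> ball (?E s0) e1"
    using e0 e1 by (auto simp: B_def)
  have Bl: "?l x \<in> S" "x \<in> ball (?E s0) (norm (exp (\<sigma> * s0)))" if "x \<in> B" for x
    using that B(5) e1(2) by blast+
  have Bz: "x \<noteq> z0" if "x \<in> B" for x using Bl(2)[OF that] by (auto simp: dist_norm)
  note sub = exponential_substitution[OF \<sigma> B(1) _ _ Bl(1) exp_inverse(2)[OF \<sigma> Bz] exp_inverse(3)[OF \<sigma> Bl(2)] q[OF S\<rho>]]
  define c1 where "c1 = (\<lambda>x. exp (\<sigma> * ?l x / 2) * v (?l x))"
  define c2 where "c2 = (\<lambda>x. exp (\<sigma> * ?l x / 2) * v2 (?l x))"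
  have c1: "solves_on q B c1" "\<And>x. x \<in> B \<Longrightarrow> deriv c1 x = exp (- (\<sigma> * ?l x) / 2) * (v (?l x) / 2 + \<sigma> * dv (?l x))"
    unfolding c1_def by (rule sub; (rule d_v d_dv | assumption); assumption)+
  have c2: "solves_on q B c2" "\<And>x. x \<in> B \<Longrightarrow> deriv c2 x = exp (- (\<sigma> * ?l x) / 2) * (v2 (?l x) / 2 + \<sigma> * dv2 (?l x))"
    unfolding c2_def by (rule sub; (rule d_v2 d_dv2 | assumption); assumption)+
  have lE: "?l (?E s0) = s0" by (rule exp_inverse(1)[OF \<sigma>])
  have wr: "wronskian c1 c2 (?E s0) = \<sigma>"
  proof -
    have "exp (\<sigma> * s0 / 2) * exp (- (\<sigma> * s0) / 2) = 1" by (simp flip: exp_add)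
    moreover have "wronskian c1 c2 (?E s0)
        = (exp (\<sigma> * s0 / 2) * exp (- (\<sigma> * s0) / 2)) * (\<sigma> * (v s0 * dv2 s0 - dv s0 * v2 s0))"
      unfolding wronskian_def c1(2)[OF B(3)] c2(2)[OF B(3)] by (simp add: c1_def c2_def lE algebra_simps)
    ultimately have "wronskian c1 c2 (?E s0) = \<sigma> * (v s0 * dv2 s0 - dv s0 * v2 s0)" by (simp only: mult_1_left)
    also have "\<dots> = \<sigma>" using vnz[OF s0] by (simp add: dv2_def v2_def algebra_simps)
    finally show ?thesis .
  qed
  have wr0: "wronskian c1 c2 (?E s0) \<noteq> 0" unfolding wr using \<sigma> by auto
  note f = solves_on_subset[OF e0(2) B(4)] solves_on_subset[OF e0(3) B(4)]
  obtain \<alpha> \<beta> where 1: "\<And>x. x \<in> B \<Longrightarrow> f1 x = \<alpha> * c1 x + \<beta> * c2 x"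
    by (rule solves_on_combination[OF B(1,2) f(1) c1(1) c2(1) B(3) wr0]) blast
  obtain \<gamma> \<delta> where 2: "\<And>x. x \<in> B \<Longrightarrow> f2 x = \<gamma> * c1 x + \<delta> * c2 x"
    by (rule solves_on_combination[OF B(1,2) f(2) c1(1) c2(1) B(3) wr0]) blast
  have evB: "\<forall>\<^sub>F x in nhds (?E s0). x \<in> B" using B(1,3) by (rule eventually_nhds_in_open)
  have det: "(cmod W)\<^sup>2 = (cmod (\<alpha> * \<delta> - \<beta> * \<gamma>))\<^sup>2"
  proof -
    have "W = wronskian f1 f2 (?E s0)" using e0(1,4) by simp
    also have "\<dots> = wronskian (\<lambda>x. \<alpha> * c1 x + \<beta> * c2 x) (\<lambda>x. \<gamma> * c1 x + \<delta> * c2 x) (?E s0)"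
      by (rule wronskian_cong; rule eventually_mono[OF evB]) (use 1 2 in auto)
    also have "\<dots> = (\<alpha> * \<delta> - \<beta> * \<gamma>) * \<sigma>" unfolding solves_on_lincomb(2)[OF B(1) c1(1) c2(1) B(3)] wr ..
    finally show ?thesis using \<sigma> by (auto simp: norm_mult)
  qed
  \<comment> \<open>The combination with coefficients \<open>\<alpha>\<close>,
    \<open>\<beta>\<close> of the two basis solutions, as a function of s on the whole
    half-plane.\<close>
  define V where "V = (\<lambda>\<alpha> \<beta> s. exp (\<sigma> * s / 2) * v s * (\<alpha> + \<beta> * L s))"
  have hV: "V a b holomorphic_on S" for a b
  proof -
    have "v holomorphic_on S" "L holomorphic_on S" using d_v d_L S(1) holomorphic_on_open by blast+
    then show ?thesis unfolding V_def by (intro holomorphic_intros) auto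
  qed
  have Vc: "a * c1 x + b * c2 x = V a b (?l x)" for a b x
    by (simp add: V_def c1_def c2_def v2_def algebra_simps)
  have bV: "branch_pair (?E s0) (\<lambda>x. V \<alpha> \<beta> (?l x)) (\<lambda>x. V \<gamma> \<delta> (?l x))"
  proof (rule branch_pair_cong[OF b])
    show "\<forall>\<^sub>F x in nhds (?E s0). f1 x = V \<alpha> \<beta> (?l x)" using evB by eventually_elim (simp add: 1 Vc)
    show "\<forall>\<^sub>F x in nhds (?E s0). f2 x = V \<gamma> \<delta> (?l x)" using evB by eventually_elim (simp add: 2 Vc)
  qed
  define G where "G = (\<lambda>L. Im ((\<alpha> + \<beta> * L) * cnj (\<gamma> + \<delta> * L)))"
  have form: "hermitian_form (?E s) = exp (Re (\<sigma> * s)) * (cmod (v s))\<^sup>2 * G (L s)" if s: "s \<in> S" for s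
  proof -
    have "branch_pair (?E s) (\<lambda>x. V \<alpha> \<beta> (exp_inverse \<sigma> z0 s x)) (\<lambda>x. V \<gamma> \<delta> (exp_inverse \<sigma> z0 s x))"
      by (rule branch_pair_along_exp[OF \<sigma> S EX hV hV s0 s bV])
    then have "hermitian_form (?E s) = Im (V \<alpha> \<beta> s * cnj (V \<gamma> \<delta> s))"
      using exp_inverse(1)[OF \<sigma>] by (simp add: hermitian_form_eq)
    also have "V \<alpha> \<beta> s * cnj (V \<gamma> \<delta> s) = (exp (\<sigma> * s / 2) * cnj (exp (\<sigma> * s / 2))) * (v s * cnj (v s))
         * ((\<alpha> + \<beta> * L s) * cnj (\<gamma> + \<delta> * L s))" by (simp add: V_def mult_ac)
    also have "\<dots> = of_real ((cmod (exp (\<sigma> * s / 2)))\<^sup>2 * (cmod (v s))\<^sup>2) * ((\<alpha> + \<beta> * L s) * cnj (\<gamma> + \<delta> * L s))"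
      by (simp only: complex_norm_square of_real_mult)
    also have "Im \<dots> = (cmod (exp (\<sigma> * s / 2)))\<^sup>2 * (cmod (v s))\<^sup>2 * G (L s)"
      unfolding G_def by (simp only: Im_complex_of_real Re_complex_of_real times_complex.sel mult_zero_left add_0_right)
    also have "(cmod (exp (\<sigma> * s / 2)))\<^sup>2 = exp (Re (\<sigma> * s))"
      by (simp flip: exp_double)
    finally show ?thesis .
  qed
  \<comment> \<open>Adding a multiple of 2 pi i leaves the point of \<open>X\<close> and the
    positive factor unchanged but shifts \<open>L\<close>; the form is single-valued on
    \<open>X\<close>.\<close>
  have per: "G (L s0 + of_int m * (2 * of_real pi * \<i>)) = G (L s0)" for m :: int
  proof -
    define t where "t = of_int m * (2 * of_real pi * \<i>)"
    have "exp t = 1" "exp (- t) = 1" using exp_integer_2pi[of "of_int m"] by (simp_all add: t_def mult_ac exp_minus)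
    then have *: "exp (s0 + t) = exp s0" "exp (\<sigma> * (s0 + t)) = exp (\<sigma> * s0)"
      using \<sigma> by (auto simp: exp_add exp_diff algebra_simps)
    have t: "s0 + t \<in> S" "Re (\<sigma> * t) = 0" using s0 \<sigma> by (auto simp: S_def t_def)
    have "exp (Re (\<sigma> * s0)) * (cmod (v s0))\<^sup>2 * G (L (s0 + t)) = exp (Re (\<sigma> * s0)) * (cmod (v s0))\<^sup>2 * G (L s0)"
      using form[OF s0] form[OF t(1)] * t(2) by (auto simp: v_def distrib_left)
    then have "G (L (s0 + t)) = G (L s0)" using vnz[OF s0] by simp
    moreover have "L (s0 + t) = L s0 + t" using * by (simp add: L_def)
    ultimately show ?thesis by (simp add: t_def)
  qed
  have "\<exists>k D. k\<^sup>2 = (cmod (\<alpha> * \<delta> - \<beta> * \<gamma>))\<^sup>2 \<and> (\<forall>L. G L = k * Re L + D)"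
    unfolding G_def
    by (rule quadratic_form_periodic[of _ _ "L s0"]) (use per[of 1] per[of 2] in \<open>simp_all only: G_def; simp\<close>)+
  then obtain k D where k: "k\<^sup>2 = (cmod W)\<^sup>2" "\<And>L. G L = k * Re L + D" using det by auto
  show ?thesis
  proof (intro exI conjI allI impI)
    fix s assume "Re s < ln r"
    then have "s \<in> S" by (simp add: S_def)
    from form[OF this] show "hermitian_form (z0 + exp (\<sigma> * s))
        = exp (Re (\<sigma> * s)) * (cmod (h (exp s)))\<^sup>2 * (k * Re (s + H (exp s)) + D)"
      unfolding k(2) by (simp only: v_def L_def)
  qed (use r h Hh k in auto)
qed

text \<open>With l = ln |y| the form is exp (Re \<sigma> l) |h|^2 k l M, where h and M tend to 1. In
  |W|^2 / J^2 the constant k cancels against W, so phi consists of the stated terms and - 4 ln |h| -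
  2 ln M.\<close>

lemma phi_asymptotics_at_puncture:
  assumes \<sigma>: "\<sigma> = 1 \<or> \<sigma> = (-1 :: complex)" and R: "R holomorphic_on ball 0 \<rho>" "\<rho> > 0" "R 0 = 0"
    and X: "\<And>s. Re s < ln \<rho> \<Longrightarrow> z0 + exp (\<sigma> * s) \<in> X"
    and q: "\<And>s. Re s < ln \<rho> \<Longrightarrow> q (z0 + exp (\<sigma> * s)) * exp (2 * \<sigma> * s) = 1 / 4 - R (exp s)"
    and pt: "\<And>s. pt (exp s) = z0 + exp (\<sigma> * s)"
  shows "\<forall>\<^sub>F y in at 0. pt y \<in> X \<and> hermitian_form (pt y) \<noteq> 0"
    and "((\<lambda>y. phi (ratio_branches X p u1 u2) (pt y) + (2 * Re \<sigma> * ln (norm y) + 2 * ln \<bar>ln (norm y)\<bar>)) \<longlongrightarrow> 0) (at 0)"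
proof -
  obtain r h H k D where r: "0 < r" "r \<le> \<rho>" and h: "h holomorphic_on ball 0 r" and H: "H holomorphic_on ball 0 r"
    and h0: "h 0 = 1" and k: "k\<^sup>2 = (cmod W)\<^sup>2"
    and J: "\<And>s. Re s < ln r \<Longrightarrow> hermitian_form (z0 + exp (\<sigma> * s))
        = exp (Re (\<sigma> * s)) * (cmod (h (exp s)))\<^sup>2 * (k * Re (s + H (exp s)) + D)"
    using hermitian_form_at_puncture[OF \<sigma> R X q] by blast
  have k0: "k \<noteq> 0" using k W_nonzero by auto
  \<comment> \<open>Chosen so that \<open>k * (l + Re (H y)) + D = k * l * M y\<close>; the
    correction dies because l tends to minus infinity.\<close>
  define M where "M = (\<lambda>y. 1 + (Re (H y) + D / k) * inverse (ln (norm y)))"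
  have "isCont h 0" "isCont H 0"
    using continuous_on_interior[OF holomorphic_on_imp_continuous_on[OF h], of 0]
      continuous_on_interior[OF holomorphic_on_imp_continuous_on[OF H], of 0] r by (simp_all add: interior_open)
  then have lim: "(h \<longlongrightarrow> 1) (at 0)" "(H \<longlongrightarrow> H 0) (at 0)" by (simp_all add: isCont_def h0)
  have n0: "filterlim (\<lambda>y::complex. norm y) (at_right 0) (at 0)"
    unfolding filterlim_at by (auto intro!: tendsto_eq_intros simp: eventually_at_filter)
  have lnlim: "filterlim (\<lambda>y::complex. ln (norm y)) at_bot (at 0)"
    by (rule filterlim_compose[OF ln_at_0 n0])
  then have inv: "((\<lambda>y::complex. inverse (ln (norm y))) \<longlongrightarrow> 0) (at 0)"
    by (intro tendsto_inverse_0[THEN filterlim_compose] filterlim_at_bot_imp_at_infinity)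
  have Mlim: "(M \<longlongrightarrow> 1) (at 0)"
    unfolding M_def by (rule tendsto_eq_intros refl lim(2) inv | simp)+
  have ev: "\<forall>\<^sub>F y in at 0. norm y < min 1 r \<and> y \<noteq> (0::complex) \<and> h y \<noteq> 0 \<and> M y > 0"
  proof (intro eventually_conj)
    show "\<forall>\<^sub>F y in at 0. norm (y::complex) < min 1 r"
      unfolding eventually_at using r by (intro exI[of _ "min 1 r"]) auto
    show "\<forall>\<^sub>F y in at 0. y \<noteq> (0::complex)" by (rule eventually_neq_at_within)
    show "\<forall>\<^sub>F y in at 0. h y \<noteq> 0" using lim(1) by (rule tendsto_imp_eventually_ne) simp
    show "\<forall>\<^sub>F y in at 0. M y > 0" by (rule order_tendstoD(1)[OF Mlim]) simp
  qed
  have main: "pt y \<in> X \<and> hermitian_form (pt y) \<noteq> 0 \<and>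
     phi (ratio_branches X p u1 u2) (pt y) + (2 * Re \<sigma> * ln (norm y) + 2 * ln \<bar>ln (norm y)\<bar>) = - 4 * ln (norm (h y)) - 2 * ln (M y)"
    if y: "norm y < min 1 r \<and> y \<noteq> 0 \<and> h y \<noteq> 0 \<and> M y > 0" for y
  proof -
    define l where "l = ln (norm y)"
    have l: "l < 0" using y by (simp add: l_def)
    have lr: "l < ln r" using y r by (simp add: l_def)
    have e: "exp (Ln y) = y" "Re (Ln y) = l" using y by (simp_all add: l_def)
    have pty: "pt y = z0 + exp (\<sigma> * Ln y)" using pt[of "Ln y"] e by simp
    have ptX: "pt y \<in> X" unfolding pty using e lr r by (intro X) (auto intro: order_less_le_trans)
    have Re\<sigma>: "Re (\<sigma> * Ln y) = Re \<sigma> * l" using \<sigma> e by auto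
    have "hermitian_form (pt y) = exp (Re \<sigma> * l) * (norm (h y))\<^sup>2 * (k * (l + Re (H y)) + D)"
      unfolding pty using J[of "Ln y"] lr unfolding Re\<sigma> by (simp add: e)
    also have "k * (l + Re (H y)) + D = k * l * M y"
      using k0 l by (simp add: M_def l_def[symmetric] field_simps)
    finally have Jy: "hermitian_form (pt y) = exp (Re \<sigma> * l) * (norm (h y))\<^sup>2 * (k * l * M y)" .
    then have J0: "hermitian_form (pt y) \<noteq> 0" using y k0 l by simp
    have "phi (ratio_branches X p u1 u2) (pt y) = ln ((cmod W)\<^sup>2 / (hermitian_form (pt y))\<^sup>2)"
      by (rule phi_eq(2)[OF ptX J0])
    also have "(cmod W)\<^sup>2 / (hermitian_form (pt y))\<^sup>2 = inverse (exp (Re \<sigma> * l) * (norm (h y))\<^sup>2 * (\<bar>l\<bar> * M y))^2"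
      unfolding Jy k[symmetric] using k0 l y by (simp add: power_mult_distrib field_simps)
    also have "ln \<dots> = - 2 * (Re \<sigma> * l + 2 * ln (norm (h y)) + (ln \<bar>l\<bar> + ln (M y)))"
    proof -
      have *: "ln ((inverse (exp (Re \<sigma> * l) * (norm (h y))\<^sup>2 * (a * M y)))\<^sup>2)
          = - 2 * (Re \<sigma> * l + 2 * ln (norm (h y)) + (ln a + ln (M y)))" if "a > 0" for a
        using y that by (simp add: ln_realpow ln_inverse ln_mult)
      show ?thesis by (rule *) (use l in simp)
    qed
    finally show ?thesis using ptX J0 by (simp add: l_def algebra_simps)
  qed
  show "\<forall>\<^sub>F y in at 0. pt y \<in> X \<and> hermitian_form (pt y) \<noteq> 0"
    using ev by eventually_elim (use main in blast)
  have "((\<lambda>y. - 4 * ln (norm (h y)) - 2 * ln (M y)) \<longlongrightarrow> - 4 * ln (norm (1::complex)) - 2 * ln 1) (at 0)"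
    by (intro tendsto_intros lim(1) Mlim) auto
  then have "((\<lambda>y. - 4 * ln (norm (h y)) - 2 * ln (M y)) \<longlongrightarrow> 0) (at 0)" by simp
  moreover have "\<forall>\<^sub>F y in at 0. - 4 * ln (norm (h y)) - 2 * ln (M y) =
      phi (ratio_branches X p u1 u2) (pt y) + (2 * Re \<sigma> * ln (norm y) + 2 * ln \<bar>ln (norm y)\<bar>)"
    using ev by eventually_elim (use main in simp)
  ultimately show "((\<lambda>y. phi (ratio_branches X p u1 u2) (pt y) + (2 * Re \<sigma> * ln (norm y) + 2 * ln \<bar>ln (norm y)\<bar>)) \<longlongrightarrow> 0) (at 0)"
    by (rule Lim_transform_eventually)
qed

end

section \<open>Compact real loci are unions of analytic curves\<close>

text \<open>The factor \<open>c\<close> selects a real coordinate of the values: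
  \<open>- \<i>\<close> yields the imaginary part, and the conjugate of the direction the component
  along the line.\<close>

lemma has_real_derivative_along_line:
  fixes f :: "complex \<Rightarrow> complex"
  assumes "(f has_field_derivative d) (at (a + of_real t * b))"
  shows "((\<lambda>s. Re (f (a + of_real s * b) * c)) has_real_derivative Re (d * b * c)) (at t)"
proof -
  have "((\<lambda>s. a + of_real s * b) has_vector_derivative b) (at t)"
    by (auto intro!: derivative_eq_intros)
  then have "(f \<circ> (\<lambda>s. a + of_real s * b) has_vector_derivative b * d) (at t)"
    using assms by (rule field_vector_diff_chain_at)
  then have "((\<lambda>s. f (a + of_real s * b) * c) has_vector_derivative b * d * c) (at t)"
    unfolding o_def by (rule has_vector_derivative_mult_left)
  then have "((\<lambda>s. Re (f (a + of_real s * b) * c)) has_vector_derivative Re (b * d * c)) (at t)"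
    by (rule bounded_linear.has_vector_derivative[OF bounded_linear_Re])
  then show ?thesis by (simp add: has_real_derivative_iff_has_vector_derivative mult_ac)
qed

text \<open>The argument behind the Noshiro-Warschawski theorem.\<close>
lemma Re_increment_pos:
  fixes f :: "complex \<Rightarrow> complex"
  assumes S: "convex S" "x \<in> S" "y \<in> S" "x \<noteq> y"
    and f: "\<And>z. z \<in> S \<Longrightarrow> (f has_field_derivative f' z) (at z)" "\<And>z. z \<in> S \<Longrightarrow> Re (f' z) > 0"
  shows "Re ((f y - f x) * cnj (y - x)) > 0"
proof -
  define g where "g = (\<lambda>s. Re (f (x + of_real s * (y - x)) * cnj (y - x)))"
  have in_S: "x + of_real s * (y - x) \<in> S" if "0 \<le> s" "s \<le> 1" for s
  proof -
    have "(1 - s) *\<^sub>R x + s *\<^sub>R y \<in> S" using S that by (simp add: convex_alt)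
    then show ?thesis by (simp add: scaleR_conv_of_real algebra_simps)
  qed
  have "\<exists>s. 0 < s \<and> s < 1 \<and> g 1 - g 0 = (1 - 0) * Re (f' (x + of_real s * (y - x)) * (y - x) * cnj (y - x))"
    unfolding g_def by (intro MVT2 has_real_derivative_along_line f in_S) auto
  then obtain s where s: "0 < s" "s < 1" "g 1 - g 0 = Re (f' (x + of_real s * (y - x)) * ((y - x) * cnj (y - x)))"
    by (auto simp: mult.assoc)
  have "(y - x) * cnj (y - x) = of_real ((cmod (y - x))\<^sup>2)" by (rule complex_norm_square[symmetric])
  with s(3) have "g 1 - g 0 = Re (f' (x + of_real s * (y - x)) * of_real ((cmod (y - x))\<^sup>2))" by metis
  then have "g 1 - g 0 = Re (f' (x + of_real s * (y - x))) * (cmod (y - x))\<^sup>2" by simp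
  moreover have "\<dots> > 0" using s S f(2)[OF in_S[of s]] by simp
  moreover have "g 1 - g 0 = Re ((f y - f x) * cnj (y - x))" by (simp add: g_def algebra_simps)
  ultimately show ?thesis by simp
qed

section \<open>Canonical arc-length charts\<close>

text \<open>Rigid by design: unit speed on the real segment fixes the parametrization up to
  direction, and sending the upper half to \<open>P\<close> fixes the direction.\<close>

definition arc_chart :: "complex set \<Rightarrow> complex set \<Rightarrow> real \<Rightarrow> complex \<Rightarrow> (complex \<Rightarrow> complex) \<Rightarrow> bool" where
 "arc_chart Z P r w \<psi> \<longleftrightarrow> r > 0 \<and> \<psi> holomorphic_on ball 0 r \<and> inj_on \<psi> (ball 0 r) \<and> \<psi> 0 = w \<and>
    (\<forall>\<zeta>\<in>ball 0 r. (\<psi> \<zeta> \<in> Z \<longleftrightarrow> Im \<zeta> = 0) \<and> (\<psi> \<zeta> \<in> P \<longleftrightarrow> Im \<zeta> > 0) \<and> (Im \<zeta> = 0 \<longrightarrow> norm (deriv \<psi> \<zeta>) = 1))"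

text \<open>Arc length is a primitive of |k'| on the real segment. Extended holomorphically, its
  derivative has positive real part near 0, and \<open>Re_increment_pos\<close> yields both
  injectivity and preservation of the two half-discs.\<close>

lemma arc_length_reparametrization:
  assumes k: "k holomorphic_on ball 0 \<rho>" and \<rho>: "\<rho> > 0" and k0: "deriv k 0 \<noteq> 0"
  shows "\<exists>A \<rho>'. 0 < \<rho>' \<and> \<rho>' \<le> \<rho> \<and> A holomorphic_on ball 0 \<rho>' \<and> inj_on A (ball 0 \<rho>') \<and> A 0 = 0 \<and>
     (\<forall>\<zeta>\<in>ball 0 \<rho>'. deriv A \<zeta> \<noteq> 0 \<and> (Im (A \<zeta>) = 0 \<longleftrightarrow> Im \<zeta> = 0) \<and> (Im (A \<zeta>) > 0 \<longleftrightarrow> Im \<zeta> > 0) \<and>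
        (Im \<zeta> = 0 \<longrightarrow> norm (deriv A \<zeta>) = norm (deriv k \<zeta>)))"
proof -
  \<comment> \<open>The Schwarz reflection of the derivative supplies its conjugate on the real
    axis, so \<open>D\<close> is the holomorphic extension of |k'|^2.\<close>
  define D where "D = (\<lambda>\<zeta>. deriv k \<zeta> * cnj (deriv k (cnj \<zeta>)))"
  have cnj_ball: "cnj ` ball 0 \<rho> = ball 0 \<rho>"
  proof -
    have "x \<in> cnj ` ball 0 \<rho>" if "x \<in> ball 0 \<rho>" for x
      using that by (intro image_eqI[of _ _ "cnj x"]) auto
    then show ?thesis by auto
  qed
  have dk: "deriv k holomorphic_on ball 0 \<rho>" using k by (simp add: holomorphic_deriv)
  have "(cnj \<circ> deriv k \<circ> cnj) holomorphic_on ball 0 \<rho>"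
    by (rule holomorphic_on_compose_cnj_cnj) (use dk in \<open>simp_all add: cnj_ball\<close>)
  then have D: "D holomorphic_on ball 0 \<rho>"
    unfolding D_def o_def using dk by (intro holomorphic_on_mult)
  have Dreal: "D \<zeta> = of_real ((cmod (deriv k \<zeta>))\<^sup>2)" if "Im \<zeta> = 0" for \<zeta>
  proof -
    have "cnj \<zeta> = \<zeta>" using that by (simp add: complex_eq_iff)
    then show ?thesis unfolding D_def complex_norm_square by simp
  qed
  have "isCont D 0"
    using continuous_on_interior[OF holomorphic_on_imp_continuous_on[OF D]] \<rho> by (simp add: interior_open)
  then have "((\<lambda>\<zeta>. Re (D \<zeta>)) \<longlongrightarrow> Re (D 0)) (at 0)" by (simp add: isCont_def tendsto_Re)
  moreover have "Re (D 0) > 0" using Dreal[of 0] k0 by simp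
  ultimately have "\<forall>\<^sub>F \<zeta> in at 0. Re (D \<zeta>) > 0" by (rule order_tendstoD(1))
  then obtain e where e: "e > 0" "\<And>\<zeta>. \<zeta> \<noteq> 0 \<Longrightarrow> dist \<zeta> 0 < e \<Longrightarrow> Re (D \<zeta>) > 0"
    unfolding eventually_at by blast
  define \<rho>' where "\<rho>' = min e \<rho>"
  have \<rho>': "\<rho>' > 0" "\<rho>' \<le> \<rho>" using e \<rho> by (auto simp: \<rho>'_def)
  have Dpos: "Re (D \<zeta>) > 0" if "\<zeta> \<in> ball 0 \<rho>'" for \<zeta>
    using that e(2)[of \<zeta>] Dreal[of 0] k0 by (cases "\<zeta> = 0") (auto simp: \<rho>'_def)
  have D': "(\<lambda>\<zeta>. csqrt (D \<zeta>)) holomorphic_on ball 0 \<rho>'"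
  proof (rule holomorphic_on_csqrt')
    show "D holomorphic_on ball 0 \<rho>'" using D \<rho>' by (auto intro: holomorphic_on_subset)
    show "D \<zeta> \<notin> \<real>\<^sub>\<le>\<^sub>0" if "\<zeta> \<in> ball 0 \<rho>'" for \<zeta> using Dpos[OF that] by (auto simp: complex_nonpos_Reals_iff)
  qed
  obtain A0 where A0: "\<And>\<zeta>. \<zeta> \<in> ball 0 \<rho>' \<Longrightarrow> (A0 has_field_derivative csqrt (D \<zeta>)) (at \<zeta> within ball 0 \<rho>')"
    using holomorphic_convex_primitive'[OF convex_ball open_ball D'] by blast
  define A where "A = (\<lambda>\<zeta>. A0 \<zeta> - A0 0)"
  have dA: "(A has_field_derivative csqrt (D \<zeta>)) (at \<zeta>)" if "\<zeta> \<in> ball 0 \<rho>'" for \<zeta>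
    unfolding A_def using A0[OF that] that at_within_open[OF that open_ball]
    by (auto intro!: derivative_eq_intros)
  have pos: "Re (csqrt (D \<zeta>)) > 0" if "\<zeta> \<in> ball 0 \<rho>'" for \<zeta>
  proof -
    have "Re (csqrt (D \<zeta>)) \<noteq> 0"
    proof
      assume *: "Re (csqrt (D \<zeta>)) = 0"
      have "D \<zeta> = (csqrt (D \<zeta>))\<^sup>2" by simp
      then have "Re (D \<zeta>) = - (Im (csqrt (D \<zeta>)))\<^sup>2" using * by (metis Re_power2 power_zero_numeral diff_0)
      then show False using Dpos[OF that] by (smt (verit) zero_le_power2)
    qed
    then show ?thesis using csqrt_principal[of "D \<zeta>"] by auto
  qed
  have incr: "Re ((A y - A x) * cnj (y - x)) > 0" if "x \<in> ball 0 \<rho>'" "y \<in> ball 0 \<rho>'" "x \<noteq> y" for x y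
    by (rule Re_increment_pos[OF convex_ball that dA pos])
  have A_0: "A 0 = 0" by (simp add: A_def)
  have real: "Im (A (of_real x)) = 0" if x: "\<bar>x\<bar> < \<rho>'" for x
  proof -
    define g where "g = (\<lambda>s. Re (A (0 + of_real s * of_real x) * (-\<i>)))"
    have "\<exists>s. 0 < s \<and> s < 1 \<and> g 1 - g 0 = (1 - 0) * Re (csqrt (D (0 + of_real s * of_real x)) * of_real x * (-\<i>))"
      unfolding g_def
    proof (intro MVT2 has_real_derivative_along_line dA)
      fix s :: real assume s: "0 \<le> s" "s \<le> 1"
      have "\<bar>s\<bar> * \<bar>x\<bar> \<le> 1 * \<bar>x\<bar>" using s by (intro mult_right_mono) auto
      then show "0 + of_real s * of_real x \<in> ball (0::complex) \<rho>'" using x by (simp add: norm_mult)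
    qed auto
    then obtain s where "g 1 - g 0 = Re (csqrt (D (of_real (s * x))) * of_real x * (-\<i>))" by auto
    also have "\<dots> = 0" using Dreal[of "of_real (s * x)"] by simp
    finally show ?thesis by (simp add: g_def A_0)
  qed
  \<comment> \<open>Compare \<open>A \<zeta>\<close> with its value at \<open>Re \<zeta>\<close>,
    which is real: the increment of the argument is i Im \<zeta>, so its positivity says that the
    imaginary parts have equal sign.\<close>
  have sgn: "Im \<zeta> * Im (A \<zeta>) > 0" if "\<zeta> \<in> ball 0 \<rho>'" "Im \<zeta> \<noteq> 0" for \<zeta>
  proof -
    have n: "\<bar>Re \<zeta>\<bar> < \<rho>'" using that abs_Re_le_cmod[of \<zeta>] by simp
    have "Re ((A \<zeta> - A (of_real (Re \<zeta>))) * cnj (\<zeta> - of_real (Re \<zeta>))) > 0"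
      using n that by (intro incr) (auto simp: complex_eq_iff)
    moreover have "\<zeta> - of_real (Re \<zeta>) = \<i> * of_real (Im \<zeta>)" by (simp add: complex_eq_iff)
    ultimately show ?thesis using real[OF n] by (simp add: mult.commute)
  qed
  show ?thesis
  proof (intro exI[of _ A] exI[of _ \<rho>'] conjI ballI impI)
    show "A holomorphic_on ball 0 \<rho>'" using dA by (meson holomorphic_on_open open_ball)
    show "inj_on A (ball 0 \<rho>')" by (rule inj_onI, rule ccontr) (use incr in force)
    fix \<zeta> :: complex assume \<zeta>: "\<zeta> \<in> ball 0 \<rho>'"
    have d: "deriv A \<zeta> = csqrt (D \<zeta>)" using dA[OF \<zeta>] by (rule DERIV_imp_deriv)
    show "deriv A \<zeta> \<noteq> 0" unfolding d using pos[OF \<zeta>] by auto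
    have r: "Im (A \<zeta>) = 0" if "Im \<zeta> = 0"
    proof -
      have "\<zeta> = of_real (Re \<zeta>)" using that by (simp add: complex_eq_iff)
      moreover have "\<bar>Re \<zeta>\<bar> < \<rho>'" using \<zeta> abs_Re_le_cmod[of \<zeta>] by simp
      ultimately show ?thesis using real by metis
    qed
    show "Im (A \<zeta>) = 0 \<longleftrightarrow> Im \<zeta> = 0" using r sgn[OF \<zeta>] by fastforce
    show "Im (A \<zeta>) > 0 \<longleftrightarrow> Im \<zeta> > 0" using r sgn[OF \<zeta>] by (metis less_irrefl zero_less_mult_pos zero_less_mult_pos2)
    assume "Im \<zeta> = 0"
    then have "csqrt (D \<zeta>) = of_real (cmod (deriv k \<zeta>))" using Dreal by simp
    then show "norm (deriv A \<zeta>) = norm (deriv k \<zeta>)" unfolding d by simp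
  qed (use \<rho>' A_0 in auto)
qed

text \<open>The map \<open>f\<close> straightens \<open>Z\<close> and \<open>P\<close> to the real
  axis and the upper half-plane. The chart is the local inverse of \<open>f\<close>, recentred at
  the real number f w, after the inverse of its arc length \<open>A\<close>; unit speed is |kk'| /
  |A'| = 1.\<close>

lemma arc_chart_exists:
  assumes U: "open U" "w \<in> U" "f holomorphic_on U" "deriv f w \<noteq> 0" and w: "w \<in> Z"
    and Z: "\<And>x. x \<in> U \<Longrightarrow> x \<in> Z \<longleftrightarrow> Im (f x) = 0" and P: "\<And>x. x \<in> U \<Longrightarrow> x \<in> P \<longleftrightarrow> Im (f x) > 0"
  shows "\<exists>r \<psi>. arc_chart Z P r w \<psi>"
proof -
  obtain r0 where r0: "r0 > 0" "ball w r0 \<subseteq> U" "inj_on f (ball w r0)"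
    using has_complex_derivative_locally_injective[OF U(3,2,1,4)] by blast
  have f: "f holomorphic_on ball w r0" using U r0 holomorphic_on_subset by blast
  obtain k where k: "k holomorphic_on f ` ball w r0" "\<And>z. z \<in> ball w r0 \<Longrightarrow> deriv f z * deriv k (f z) = 1"
    "\<And>z. z \<in> ball w r0 \<Longrightarrow> k (f z) = z"
    using holomorphic_has_inverse[OF f open_ball r0(3)] by metis
  have "open (f ` ball w r0)" by (rule open_mapping_thm3[OF f open_ball r0(3)])
  then obtain \<rho> where \<rho>: "\<rho> > 0" "ball (f w) \<rho> \<subseteq> f ` ball w r0"
    using r0 open_contains_ball by (metis centre_in_ball imageI)
  define x0 where "x0 = f w"
  have x0: "Im x0 = 0" using Z U w by (simp add: x0_def)
  have kU: "k y \<in> ball w r0" "f (k y) = y" if "y \<in> ball x0 \<rho>" for y using that \<rho> k(3) by (auto simp: x0_def)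
  define kk where "kk = (\<lambda>\<zeta>. k (x0 + \<zeta>))"
  have kb: "k holomorphic_on ball x0 \<rho>" using k(1) \<rho> holomorphic_on_subset unfolding x0_def by blast
  have kk: "kk holomorphic_on ball 0 \<rho>"
  proof -
    have "(k \<circ> (\<lambda>\<zeta>. x0 + \<zeta>)) holomorphic_on ball 0 \<rho>"
      by (intro holomorphic_on_compose_gen[OF _ kb] holomorphic_intros) (auto simp: dist_norm)
    then show ?thesis by (simp add: kk_def o_def)
  qed
  have dkk: "(kk has_field_derivative deriv k (x0 + \<zeta>)) (at \<zeta>)" if "\<zeta> \<in> ball 0 \<rho>" for \<zeta>
  proof -
    have "(k has_field_derivative deriv k (x0 + \<zeta>)) (at (x0 + \<zeta>))"
      using that by (intro holomorphic_derivI[OF kb]) (auto simp: dist_norm)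
    then show ?thesis unfolding kk_def by (simp add: DERIV_shift add.commute)
  qed
  have dk0: "deriv kk 0 \<noteq> 0" using dkk[of 0] \<rho> k(2)[of w] r0 by (auto simp: DERIV_imp_deriv x0_def)
  obtain A \<rho>' where A: "0 < \<rho>'" "\<rho>' \<le> \<rho>" "A holomorphic_on ball 0 \<rho>'" "inj_on A (ball 0 \<rho>')" "A 0 = 0"
    "\<And>\<zeta>. \<zeta> \<in> ball 0 \<rho>' \<Longrightarrow> deriv A \<zeta> \<noteq> 0 \<and> (Im (A \<zeta>) = 0 \<longleftrightarrow> Im \<zeta> = 0) \<and> (Im (A \<zeta>) > 0 \<longleftrightarrow> Im \<zeta> > 0) \<and>
        (Im \<zeta> = 0 \<longrightarrow> norm (deriv A \<zeta>) = norm (deriv kk \<zeta>))"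
    using arc_length_reparametrization[OF kk \<rho>(1) dk0] by blast
  obtain a where a: "a holomorphic_on A ` ball 0 \<rho>'" "\<And>z. z \<in> ball 0 \<rho>' \<Longrightarrow> deriv A z * deriv a (A z) = 1"
    "\<And>z. z \<in> ball 0 \<rho>' \<Longrightarrow> a (A z) = z"
    using holomorphic_has_inverse[OF A(3) open_ball A(4)] by metis
  have "open (A ` ball 0 \<rho>')" by (rule open_mapping_thm3[OF A(3) open_ball A(4)])
  then obtain r where r: "r > 0" "ball 0 r \<subseteq> A ` ball 0 \<rho>'"
    using A(1,5) open_contains_ball by (metis centre_in_ball imageI)
  have aB: "a \<zeta> \<in> ball 0 \<rho>'" "A (a \<zeta>) = \<zeta>" if "\<zeta> \<in> ball 0 r" for \<zeta>
  proof -
    from that r obtain z where "z \<in> ball 0 \<rho>'" "\<zeta> = A z" by blast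
    then show "a \<zeta> \<in> ball 0 \<rho>'" "A (a \<zeta>) = \<zeta>" using a(3) by auto
  qed
  have ah: "a holomorphic_on ball 0 r" using a(1) r holomorphic_on_subset by blast
  have sub: "ball 0 \<rho>' \<subseteq> ball (0::complex) \<rho>" using A(2) by auto
  have ab\<rho>: "a \<zeta> \<in> ball 0 \<rho>" if "\<zeta> \<in> ball 0 r" for \<zeta> using aB(1)[OF that] sub by blast
  define \<psi> where "\<psi> = (\<lambda>\<zeta>. kk (a \<zeta>))"
  have f\<psi>: "f (\<psi> \<zeta>) = x0 + a \<zeta>" "\<psi> \<zeta> \<in> U" if "\<zeta> \<in> ball 0 r" for \<zeta>
  proof -
    have "x0 + a \<zeta> \<in> ball x0 \<rho>" using ab\<rho>[OF that] by (simp add: dist_norm)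
    then show "f (\<psi> \<zeta>) = x0 + a \<zeta>" "\<psi> \<zeta> \<in> U" using kU r0(2) by (auto simp: \<psi>_def kk_def)
  qed
  show ?thesis unfolding arc_chart_def
  proof (intro exI[of _ r] exI[of _ \<psi>] conjI ballI impI)
    have "(kk \<circ> a) holomorphic_on ball 0 r"
      by (rule holomorphic_on_compose_gen[OF ah kk]) (use ab\<rho> in blast)
    then show "\<psi> holomorphic_on ball 0 r" by (simp add: \<psi>_def o_def)
    show "inj_on \<psi> (ball 0 r)"
    proof (rule inj_onI)
      fix x y assume "x \<in> ball 0 r" "y \<in> ball 0 r" "\<psi> x = \<psi> y"
      then show "x = y" using f\<psi>(1) aB(2) by (metis add_left_cancel)
    qed
    have "a 0 = 0" using a(3)[of 0] A by simp
    then show "\<psi> 0 = w" using k(3)[of w] r0 by (simp add: \<psi>_def kk_def x0_def)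
    fix \<zeta> :: complex assume \<zeta>: "\<zeta> \<in> ball 0 r"
    show "\<psi> \<zeta> \<in> Z \<longleftrightarrow> Im \<zeta> = 0" "\<psi> \<zeta> \<in> P \<longleftrightarrow> Im \<zeta> > 0"
      using Z P f\<psi>[OF \<zeta>] A(6)[OF aB(1)[OF \<zeta>]] aB(2)[OF \<zeta>] x0 by auto
    assume im: "Im \<zeta> = 0"
    have d1: "(a has_field_derivative deriv a \<zeta>) (at \<zeta>)" by (rule holomorphic_derivI[OF ah open_ball \<zeta>])
    have d2: "(kk has_field_derivative deriv kk (a \<zeta>)) (at (a \<zeta>))" by (rule holomorphic_derivI[OF kk open_ball ab\<rho>[OF \<zeta>]])
    have "deriv \<psi> \<zeta> = deriv kk (a \<zeta>) * deriv a \<zeta>"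
      unfolding \<psi>_def by (rule DERIV_imp_deriv[OF DERIV_chain2[OF d2 d1]])
    moreover have "norm (deriv A (a \<zeta>)) = norm (deriv kk (a \<zeta>))" "deriv A (a \<zeta>) \<noteq> 0"
      using A(6)[OF aB(1)[OF \<zeta>]] aB(2)[OF \<zeta>] im by auto
    moreover have "norm (deriv A (a \<zeta>)) * norm (deriv a \<zeta>) = 1"
      using a(2)[OF aB(1)[OF \<zeta>]] aB(2)[OF \<zeta>] by (metis norm_mult norm_one)
    ultimately show "norm (deriv \<psi> \<zeta>) = 1" by (simp add: norm_mult)
  qed (use r in auto)
qed

lemma arc_chart_restrict: "arc_chart Z P r w \<psi> \<Longrightarrow> 0 < r' \<Longrightarrow> r' \<le> r \<Longrightarrow> arc_chart Z P r' w \<psi>"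
  unfolding arc_chart_def by (auto intro: holomorphic_on_subset inj_on_subset)

lemma arc_chart_shift:
  assumes "arc_chart Z P r w \<psi>" "\<bar>s\<bar> < r"
  shows "arc_chart Z P (r - \<bar>s\<bar>) (\<psi> (of_real s)) (\<lambda>\<zeta>. \<psi> (of_real s + \<zeta>))"
proof -
  have c: "\<psi> holomorphic_on ball 0 r" "inj_on \<psi> (ball 0 r)"
    "\<And>\<zeta>. \<zeta>\<in>ball 0 r \<Longrightarrow> (\<psi> \<zeta> \<in> Z \<longleftrightarrow> Im \<zeta> = 0) \<and> (\<psi> \<zeta> \<in> P \<longleftrightarrow> Im \<zeta> > 0) \<and> (Im \<zeta> = 0 \<longrightarrow> norm (deriv \<psi> \<zeta>) = 1)"
    using assms by (auto simp: arc_chart_def)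
  have B: "of_real s + \<zeta> \<in> ball 0 r" if "\<zeta> \<in> ball 0 (r - \<bar>s\<bar>)" for \<zeta> :: complex
    using that norm_triangle_ineq[of "of_real s" \<zeta>] by simp
  show ?thesis unfolding arc_chart_def
  proof (intro conjI ballI)
    have "(\<psi> \<circ> (\<lambda>\<zeta>. of_real s + \<zeta>)) holomorphic_on ball 0 (r - \<bar>s\<bar>)"
      by (intro holomorphic_on_compose_gen[OF _ c(1)] holomorphic_intros) (use B in blast)
    then show "(\<lambda>\<zeta>. \<psi> (of_real s + \<zeta>)) holomorphic_on ball 0 (r - \<bar>s\<bar>)" by (simp add: o_def)
    show "inj_on (\<lambda>\<zeta>. \<psi> (of_real s + \<zeta>)) (ball 0 (r - \<bar>s\<bar>))"
      by (rule inj_onI) (use c(2) B in \<open>auto dest: inj_onD\<close>)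
    fix \<zeta> :: complex assume \<zeta>: "\<zeta> \<in> ball 0 (r - \<bar>s\<bar>)"
    note * = c(3)[OF B[OF \<zeta>]]
    show "\<psi> (of_real s + \<zeta>) \<in> Z \<longleftrightarrow> Im \<zeta> = 0" "\<psi> (of_real s + \<zeta>) \<in> P \<longleftrightarrow> Im \<zeta> > 0" using * by auto
    have "(\<psi> has_field_derivative deriv \<psi> (of_real s + \<zeta>)) (at (of_real s + \<zeta>))"
      by (rule holomorphic_derivI[OF c(1) open_ball B[OF \<zeta>]])
    then have "((\<lambda>\<zeta>. \<psi> (of_real s + \<zeta>)) has_field_derivative deriv \<psi> (of_real s + \<zeta>)) (at \<zeta>)"
      by (simp add: DERIV_shift add.commute)
    then show "Im \<zeta> = 0 \<longrightarrow> norm (deriv (\<lambda>\<zeta>. \<psi> (of_real s + \<zeta>)) \<zeta>) = 1"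
      using * by (simp add: DERIV_imp_deriv)
  qed (use assms in auto)
qed

text \<open>The transition map \<open>\<kappa>\<close> preserves the real axis, its speed there is
  1, and it does not exchange the half-discs; so \<kappa>' = 1 on a real segment. The identity
  theorem, first for \<kappa>' and then for the two charts on their common ball, gives
  equality.\<close>

lemma arc_chart_unique:
  assumes 1: "arc_chart Z P r1 w \<psi>1" and 2: "arc_chart Z P r2 w \<psi>2" and \<zeta>: "norm \<zeta> < min r1 r2"
  shows "\<psi>1 \<zeta> = \<psi>2 \<zeta>"
proof -
  have c1: "r1 > 0" "\<psi>1 holomorphic_on ball 0 r1" "inj_on \<psi>1 (ball 0 r1)" "\<psi>1 0 = w"
    "\<And>\<zeta>. \<zeta>\<in>ball 0 r1 \<Longrightarrow> (\<psi>1 \<zeta> \<in> Z \<longleftrightarrow> Im \<zeta> = 0) \<and> (\<psi>1 \<zeta> \<in> P \<longleftrightarrow> Im \<zeta> > 0) \<and> (Im \<zeta> = 0 \<longrightarrow> norm (deriv \<psi>1 \<zeta>) = 1)"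
    using 1 by (auto simp: arc_chart_def)
  have c2: "r2 > 0" "\<psi>2 holomorphic_on ball 0 r2" "inj_on \<psi>2 (ball 0 r2)" "\<psi>2 0 = w"
    "\<And>\<zeta>. \<zeta>\<in>ball 0 r2 \<Longrightarrow> (\<psi>2 \<zeta> \<in> Z \<longleftrightarrow> Im \<zeta> = 0) \<and> (\<psi>2 \<zeta> \<in> P \<longleftrightarrow> Im \<zeta> > 0) \<and> (Im \<zeta> = 0 \<longrightarrow> norm (deriv \<psi>2 \<zeta>) = 1)"
    using 2 by (auto simp: arc_chart_def)
  obtain k where k: "k holomorphic_on \<psi>2 ` ball 0 r2" "\<And>z. z \<in> ball 0 r2 \<Longrightarrow> deriv \<psi>2 z * deriv k (\<psi>2 z) = 1"
    "\<And>z. z \<in> ball 0 r2 \<Longrightarrow> k (\<psi>2 z) = z"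
    using holomorphic_has_inverse[OF c2(2) open_ball c2(3)] by metis
  define V where "V = \<psi>2 ` ball 0 r2"
  have V: "open V" unfolding V_def by (rule open_mapping_thm3[OF c2(2) open_ball c2(3)])
  have "open (ball 0 r1 \<inter> \<psi>1 -` V)"
    using c1(2) V by (intro continuous_open_preimage holomorphic_on_imp_continuous_on) auto
  moreover have "0 \<in> ball 0 r1 \<inter> \<psi>1 -` V"
    using c1(1,4) c2(1,4) unfolding V_def by (metis IntI centre_in_ball image_eqI vimageI)
  ultimately obtain e where e: "e > 0" "ball 0 e \<subseteq> ball 0 r1 \<inter> \<psi>1 -` V" by (meson open_contains_ball)
  define \<kappa> where "\<kappa> = (\<lambda>\<zeta>. k (\<psi>1 \<zeta>))"
  have e1: "\<zeta> \<in> ball 0 r1" "\<psi>1 \<zeta> \<in> V" if "\<zeta> \<in> ball 0 e" for \<zeta> using that e by auto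
  have \<kappa>2: "\<kappa> \<zeta> \<in> ball 0 r2" "\<psi>2 (\<kappa> \<zeta>) = \<psi>1 \<zeta>" if "\<zeta> \<in> ball 0 e" for \<zeta>
    using e1(2)[OF that] k(3) by (auto simp: V_def \<kappa>_def)
  have hol1: "\<psi>1 holomorphic_on ball 0 e" using c1(2) e1 holomorphic_on_subset by blast
  have "(k \<circ> \<psi>1) holomorphic_on ball 0 e"
    using e1 by (intro holomorphic_on_compose_gen[OF hol1 k(1)]) (auto simp: V_def)
  then have hol: "\<kappa> holomorphic_on ball 0 e" by (simp add: \<kappa>_def o_def)
  have \<kappa>sgn: "Im (\<kappa> \<zeta>) = 0 \<longleftrightarrow> Im \<zeta> = 0" "Im (\<kappa> \<zeta>) > 0 \<longleftrightarrow> Im \<zeta> > 0" if "\<zeta> \<in> ball 0 e" for \<zeta>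
    using c1(5)[OF e1(1)[OF that]] c2(5)[OF \<kappa>2(1)[OF that]] \<kappa>2(2)[OF that] by auto
  have d\<kappa>: "(\<kappa> has_field_derivative deriv \<kappa> \<zeta>) (at \<zeta>)" if "\<zeta> \<in> ball 0 e" for \<zeta>
    by (rule holomorphic_derivI[OF hol open_ball that])
  have real: "deriv \<kappa> x = 1" if x: "x \<in> ball 0 e" "Im x = 0" for x
  proof -
    have "norm (deriv \<kappa> x) = 1"
    proof -
      have "deriv \<psi>1 x = deriv (\<lambda>\<zeta>. \<psi>2 (\<kappa> \<zeta>)) x"
      proof (rule deriv_cong_ev)
        have "\<forall>\<^sub>F y in nhds x. y \<in> ball 0 e" using x by (intro eventually_nhds_in_open) auto
        then show "\<forall>\<^sub>F y in nhds x. \<psi>1 y = \<psi>2 (\<kappa> y)" by eventually_elim (use \<kappa>2 in auto)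
      qed simp
      also have "\<dots> = deriv \<psi>2 (\<kappa> x) * deriv \<kappa> x"
        by (rule DERIV_imp_deriv[OF DERIV_chain2[OF holomorphic_derivI[OF c2(2) open_ball \<kappa>2(1)[OF x(1)]] d\<kappa>[OF x(1)]]])
      finally have "norm (deriv \<psi>1 x) = norm (deriv \<psi>2 (\<kappa> x)) * norm (deriv \<kappa> x)" by (simp add: norm_mult)
      then show ?thesis
        using c1(5)[OF e1(1)[OF x(1)]] c2(5)[OF \<kappa>2(1)[OF x(1)]] \<kappa>sgn[OF x(1)] x(2) by simp
    qed
    \<comment> \<open>The imaginary part of \<kappa> vanishes along the real axis, and so does its
      derivative in that direction.\<close>
    moreover have "Im (deriv \<kappa> x) = 0"
    proof -
      have "((\<lambda>s. Re (\<kappa> (x + of_real s * 1) * (-\<i>))) has_real_derivative Re (deriv \<kappa> x * 1 * (-\<i>))) (at 0)"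
        using d\<kappa>[OF x(1)] by (intro has_real_derivative_along_line) simp
      moreover have "((\<lambda>s. Re (\<kappa> (x + of_real s * 1) * (-\<i>))) has_real_derivative 0) (at 0)"
      proof (rule DERIV_cong_ev[THEN iffD1, OF refl _ refl, OF _ DERIV_const[of 0]])
        show "\<forall>\<^sub>F s in nhds 0. 0 = Re (\<kappa> (x + of_real s * 1) * (-\<i>))"
          unfolding eventually_nhds_metric
        proof (intro exI[of _ "e - norm x"] conjI allI impI)
          show "e - norm x > 0" using x by simp
          fix s :: real assume "dist s 0 < e - norm x"
          then have "x + of_real s \<in> ball 0 e" using norm_triangle_ineq[of x "of_real s"] by simp
          then show "0 = Re (\<kappa> (x + of_real s * 1) * (-\<i>))" using \<kappa>sgn(1)[of "x + of_real s"] x by simp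
        qed
      qed
      ultimately have "Re (deriv \<kappa> x * 1 * (-\<i>)) = 0" by (rule DERIV_unique)
      then show ?thesis by simp
    qed
    \<comment> \<open>With negative real part of the derivative, a short step upwards from x would
      land in the lower half-plane.\<close>
    moreover have "Re (deriv \<kappa> x) \<ge> 0"
    proof (rule ccontr)
      assume neg: "\<not> Re (deriv \<kappa> x) \<ge> 0"
      have "((\<lambda>s. Re (\<kappa> (x + of_real s * \<i>) * (-\<i>))) has_real_derivative Re (deriv \<kappa> x * \<i> * (-\<i>))) (at 0)"
        using d\<kappa>[OF x(1)] by (intro has_real_derivative_along_line) simp
      from DERIV_neg_dec_right[OF this] neg obtain d where d: "d > 0"
        "\<And>h. h > 0 \<Longrightarrow> h < d \<Longrightarrow> Im (\<kappa> x) > Im (\<kappa> (x + of_real h * \<i>))" by auto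
      define h where "h = min d (e - norm x) / 2"
      have h: "h > 0" "h < d" "h < e - norm x" using d x by (auto simp: h_def min_def)
      have "x + of_real h * \<i> \<in> ball 0 e"
        using norm_triangle_ineq[of x "of_real h * \<i>"] h by (simp add: norm_mult)
      then have "Im (\<kappa> (x + of_real h * \<i>)) > 0" using \<kappa>sgn(2)[of "x + of_real h * \<i>"] h x by simp
      then show False using d(2)[OF h(1,2)] \<kappa>sgn(1)[OF x(1)] x(2) by simp
    qed
    ultimately have "norm (deriv \<kappa> x) = Re (deriv \<kappa> x)" "norm (deriv \<kappa> x) = 1" "Im (deriv \<kappa> x) = 0"
      by (simp_all add: cmod_eq_Re)
    then show ?thesis by (simp add: complex_eq_iff)
  qed
  have d1: "deriv \<kappa> \<zeta> = 1" if "\<zeta> \<in> ball 0 e" for \<zeta>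
  proof -
    have lim: "0 islimpt {x \<in> ball (0::complex) e. Im x = 0}"
      unfolding islimpt_approachable
    proof (intro allI impI)
      fix \<epsilon> :: real assume "\<epsilon> > 0"
      then show "\<exists>x'\<in>{x \<in> ball 0 e. Im x = 0}. x' \<noteq> 0 \<and> dist x' 0 < \<epsilon>"
        using e by (intro bexI[of _ "of_real (min \<epsilon> e / 2)"]) (auto simp: min_def)
    qed
    have "deriv \<kappa> \<zeta> - 1 = 0"
      by (rule analytic_continuation[OF _ open_ball connected_ball _ _ lim _ that])
         (use hol real e in \<open>auto intro!: holomorphic_intros holomorphic_deriv\<close>)
    then show ?thesis by simp
  qed
  have id: "\<kappa> \<zeta> = \<zeta>" if \<zeta>: "\<zeta> \<in> ball 0 e" for \<zeta>
  proof -
    have "\<exists>c. \<forall>x\<in>ball (0::complex) e. \<kappa> x - x = c"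
    proof (rule has_field_derivative_zero_constant)
      fix x :: complex assume x: "x \<in> ball 0 e"
      have "((\<lambda>x. \<kappa> x - x) has_field_derivative 0) (at x)"
        using d\<kappa>[OF x] d1[OF x] by (auto intro!: derivative_eq_intros)
      then show "((\<lambda>x. \<kappa> x - x) has_field_derivative 0) (at x within ball 0 e)" by (rule has_field_derivative_at_within)
    qed auto
    then obtain c where c: "\<And>x. x \<in> ball 0 e \<Longrightarrow> \<kappa> x - x = c" by blast
    have "\<kappa> 0 = 0" using k(3)[of 0] c1(4) c2(1,4) by (simp add: \<kappa>_def)
    then show ?thesis using c[of 0] c[OF \<zeta>] e by simp
  qed
  define r where "r = min r1 r2"
  have "\<psi>1 \<zeta> - \<psi>2 \<zeta> = 0"
  proof (rule analytic_continuation[of "\<lambda>\<zeta>. \<psi>1 \<zeta> - \<psi>2 \<zeta>" "ball 0 r" "ball 0 (min e r)" 0])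
    show "(\<lambda>\<zeta>. \<psi>1 \<zeta> - \<psi>2 \<zeta>) holomorphic_on ball 0 r"

      by (intro holomorphic_intros holomorphic_on_subset[OF c1(2)] holomorphic_on_subset[OF c2(2)]) (auto simp: r_def)
    show "0 islimpt ball (0::complex) (min e r)" using e(1) c1(1) c2(1) by (simp add: islimpt_ball r_def)
    fix z :: complex assume "z \<in> ball 0 (min e r)"
    then have "z \<in> ball 0 e" by simp
    then show "\<psi>1 z - \<psi>2 z = 0" using \<kappa>2(2)[of z] id[of z] by simp
  qed (use \<zeta> c1(1) c2(1) in \<open>auto simp: r_def\<close>)
  then show ?thesis by simp
qed

text \<open>A Lebesgue-number argument: finitely many half-radius charts cover \<open>Z\<close>, and
  shifting such a chart along its real axis to any point of its inner half leaves at least half of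
  its radius.\<close>

lemma arc_chart_uniform_radius:
  assumes Z: "compact Z" and ex: "\<And>w. w \<in> Z \<Longrightarrow> \<exists>r \<psi>. arc_chart Z P r w \<psi>"
  shows "\<exists>r>0. \<forall>w\<in>Z. \<exists>\<psi>. arc_chart Z P r w \<psi>"
proof -
  obtain R \<Psi> where c: "\<And>w. w \<in> Z \<Longrightarrow> arc_chart Z P (R w) w (\<Psi> w)" using ex by metis
  define V where "V = (\<lambda>w. \<Psi> w ` ball 0 (R w / 2))"
  have R: "R w > 0" if "w \<in> Z" for w using c[OF that] by (simp add: arc_chart_def)
  have "open (V w)" if "w \<in> Z" for w
  proof -
    have "arc_chart Z P (R w / 2) w (\<Psi> w)" using c[OF that] R[OF that] by (auto intro: arc_chart_restrict)
    then have "\<Psi> w holomorphic_on ball 0 (R w / 2)" "inj_on (\<Psi> w) (ball 0 (R w / 2))"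
      by (simp_all add: arc_chart_def)
    then show ?thesis unfolding V_def by (intro open_mapping_thm3) auto
  qed
  moreover have "Z \<subseteq> (\<Union>w\<in>Z. V w)"
  proof
    fix w assume w: "w \<in> Z"
    have "\<Psi> w 0 = w" "0 \<in> ball (0::complex) (R w / 2)" using c[OF w] R[OF w] by (simp_all add: arc_chart_def)
    then have "w \<in> V w" unfolding V_def by (metis image_eqI)
    then show "w \<in> (\<Union>w\<in>Z. V w)" using w by blast
  qed
  ultimately obtain F where F: "F \<subseteq> Z" "finite F" "Z \<subseteq> (\<Union>w\<in>F. V w)"
    by (rule compactE_image[OF Z])
  define r where "r = Min (insert 1 ((\<lambda>w. R w / 2) ` F))"
  have r: "r > 0" using F R by (auto simp: r_def)
  have rR: "r \<le> R w / 2" if "w \<in> F" for w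
    unfolding r_def using F(2) that by (intro Min_le) auto
  have "\<exists>\<psi>. arc_chart Z P r w \<psi>" if w: "w \<in> Z" for w
  proof -
    obtain v \<zeta> where v: "v \<in> F" "\<zeta> \<in> ball 0 (R v / 2)" "w = \<Psi> v \<zeta>" using F(3) w by (auto simp: V_def)
    have vZ: "v \<in> Z" using F v by auto
    have "\<zeta> \<in> ball 0 (R v)" using v R[OF vZ] by simp
    then have "\<Psi> v \<zeta> \<in> Z \<longleftrightarrow> Im \<zeta> = 0" using c[OF vZ] by (simp add: arc_chart_def)
    then have "Im \<zeta> = 0" using v(3) w by simp
    then obtain x where \<zeta>: "\<zeta> = of_real x" by (metis complex_is_Real_iff Reals_cases)
    have n: "\<bar>x\<bar> < R v / 2" using v(2) unfolding \<zeta> by simp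
    have "arc_chart Z P (R v - \<bar>x\<bar>) (\<Psi> v (of_real x)) (\<lambda>\<xi>. \<Psi> v (of_real x + \<xi>))"
      using R[OF vZ] n by (intro arc_chart_shift[OF c[OF vZ]]) auto
    then have "arc_chart Z P r w (\<lambda>\<xi>. \<Psi> v (of_real x + \<xi>))"
      unfolding v(3) \<zeta> by (rule arc_chart_restrict) (use r rR[OF v(1)] n in auto)
    then show ?thesis by blast
  qed
  then show ?thesis using r by blast
qed

section \<open>The flow along the locus and its closed orbits\<close>

locale arc_flow =
  fixes Z P :: "complex set" and r :: real and \<Psi> :: "complex \<Rightarrow> complex \<Rightarrow> complex"
  assumes compact_Z: "compact Z" and chart: "w \<in> Z \<Longrightarrow> arc_chart Z P r w (\<Psi> w)"
begin

lemma \<Psi>_in_Z_iff: "w \<in> Z \<Longrightarrow> norm \<zeta> < r \<Longrightarrow> \<Psi> w \<zeta> \<in> Z \<longleftrightarrow> Im \<zeta> = 0"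
  and \<Psi>_0: "w \<in> Z \<Longrightarrow> \<Psi> w 0 = w"
  and \<Psi>_holo: "w \<in> Z \<Longrightarrow> \<Psi> w holomorphic_on ball 0 r"
  and \<Psi>_inj: "w \<in> Z \<Longrightarrow> inj_on (\<Psi> w) (ball 0 r)"
  and \<Psi>_deriv: "w \<in> Z \<Longrightarrow> 0 < r \<Longrightarrow> deriv (\<Psi> w) 0 \<noteq> 0"
  and r_pos: "w \<in> Z \<Longrightarrow> 0 < r"
  using chart[of w] by (auto simp: arc_chart_def dest!: bspec[of _ _ 0])

text \<open>Both sides are charts at the same point of \<open>Z\<close>, and charts are unique. This
  is the local group law of the flow, for complex times as well.\<close>

lemma \<Psi>_add:
  assumes w: "w \<in> Z" and s: "\<bar>s\<bar> < r" "norm \<zeta> < r - \<bar>s\<bar>"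
  shows "\<Psi> (\<Psi> w (of_real s)) \<zeta> = \<Psi> w (of_real s + \<zeta>)"
proof -
  have "\<Psi> w (of_real s) \<in> Z" using w s by (simp add: \<Psi>_in_Z_iff)
  then have "arc_chart Z P r (\<Psi> w (of_real s)) (\<Psi> (\<Psi> w (of_real s)))" by (rule chart)
  then show ?thesis using arc_chart_shift[OF chart[OF w] s(1)] s by (elim arc_chart_unique) auto
qed

text \<open>A quarter of the chart radius: sums of two steps stay below \<open>r\<close>, as
  \<open>flow_add\<close> demands.\<close>

abbreviation h :: real where "h \<equiv> r / 4"

definition flow :: "real \<Rightarrow> complex \<Rightarrow> complex" where "flow s w = \<Psi> w (of_real s)"

lemma flow_in_Z: "w \<in> Z \<Longrightarrow> \<bar>s\<bar> < r \<Longrightarrow> flow s w \<in> Z"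
  by (simp add: flow_def \<Psi>_in_Z_iff)

lemma flow_add: "w \<in> Z \<Longrightarrow> \<bar>s\<bar> + \<bar>t\<bar> < r \<Longrightarrow> flow t (flow s w) = flow (s + t) w"
  unfolding flow_def by (subst \<Psi>_add) auto

lemma flow_0: "w \<in> Z \<Longrightarrow> flow 0 w = w"
  by (simp add: flow_def \<Psi>_0)

lemma flow_inj: "w \<in> Z \<Longrightarrow> \<bar>s\<bar> < r \<Longrightarrow> flow s w = w \<Longrightarrow> s = 0"
  using inj_onD[OF \<Psi>_inj, of w "of_real s" 0] r_pos[of w] by (simp add: flow_def \<Psi>_0)

text \<open>A global orbit, described through steps shorter than \<open>h\<close> because the flow
  itself is defined for short times.\<close>

definition flow_line :: "(real \<Rightarrow> complex) \<Rightarrow> bool" where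
  "flow_line \<gamma> \<longleftrightarrow> (\<forall>t. \<gamma> t \<in> Z) \<and> (\<forall>t s. \<bar>s\<bar> < h \<longrightarrow> \<gamma> (t + s) = flow s (\<gamma> t))"

text \<open>Iterating the flow for time \<open>h\<close> in both directions gives the orbit at the
  multiples of \<open>h\<close>; between them one flows for the remaining fraction. The group law
  makes the pieces fit.\<close>

lemma flow_line_exists:
  assumes w: "w \<in> Z"
  shows "\<exists>\<gamma>. flow_line \<gamma> \<and> \<gamma> 0 = w"
proof -
  note r = r_pos[OF w]
  define orb where "orb = (\<lambda>k::int. if k \<ge> 0 then (flow h ^^ nat k) w else (flow (- h) ^^ nat (- k)) w)"
  have iter_Z: "(flow s ^^ n) w \<in> Z" if "\<bar>s\<bar> < r" for s n
    by (induction n) (use w that flow_in_Z in auto)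
  have orbZ: "orb k \<in> Z" for k using r by (auto simp: orb_def intro!: iter_Z)
  have orb_Suc: "orb (k + 1) = flow h (orb k)" for k
  proof (cases "k \<ge> 0")
    case True
    then have "nat (k + 1) = Suc (nat k)" by simp
    then show ?thesis using True by (simp add: orb_def)
  next
    case False
    then have "nat (- k) = Suc (nat (- (k + 1)))" by simp
    then have "orb k = flow (- h) ((flow (- h) ^^ nat (- (k + 1))) w)" using False by (simp add: orb_def)
    moreover have "orb (k + 1) = (flow (- h) ^^ nat (- (k + 1))) w"
      using False by (cases "k = -1") (auto simp: orb_def)
    ultimately have "orb k = flow (- h) (orb (k + 1))" by simp
    then show ?thesis using flow_add[OF orbZ, of "-h" h "k + 1"] r by (simp add: flow_0 orbZ)
  qed
  define \<gamma> where "\<gamma> = (\<lambda>t. flow (t - h * of_int \<lfloor>t / h\<rfloor>) (orb \<lfloor>t / h\<rfloor>))"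
  have frac: "0 \<le> t - h * of_int \<lfloor>t / h\<rfloor>" "t - h * of_int \<lfloor>t / h\<rfloor> < h" for t
  proof -
    have "h * of_int \<lfloor>t / h\<rfloor> \<le> h * (t / h)" using r by (intro mult_left_mono) auto
    moreover have "h * (t / h) < h * (of_int \<lfloor>t / h\<rfloor> + 1)" using r by (intro mult_strict_left_mono) (linarith, simp)
    moreover have "h * (t / h) = t" using r by simp
    ultimately show "0 \<le> t - h * of_int \<lfloor>t / h\<rfloor>" "t - h * of_int \<lfloor>t / h\<rfloor> < h"
      by (simp_all only: distrib_left mult_1_right; linarith)+
  qed
  have \<gamma>Z: "\<gamma> t \<in> Z" for t
    unfolding \<gamma>_def using frac[of t] r by (intro flow_in_Z orbZ) auto
  \<comment> \<open>A step shorter than \<open>h\<close> crosses at most one multiple of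
    \<open>h\<close>, hence the two cases. Negative steps follow by inverting positive ones.\<close>
  have pos: "\<gamma> (t + s) = flow s (\<gamma> t)" if s: "0 \<le> s" "s < h" for t s
  proof -
    define k where "k = \<lfloor>t / h\<rfloor>"
    define a where "a = t - h * of_int k"
    have a: "0 \<le> a" "a < h" using frac[of t] by (auto simp: a_def k_def)
    have t: "t / h = of_int k + a / h" using r by (simp add: a_def field_simps)
    have \<gamma>t: "\<gamma> t = flow a (orb k)" by (simp add: \<gamma>_def a_def k_def)
    have R: "flow s (\<gamma> t) = flow (a + s) (orb k)"
      unfolding \<gamma>t using a s r by (intro flow_add orbZ) auto
    show ?thesis
    proof (cases "a + s < h")
      case True
      have "(t + s) / h = of_int k + (a + s) / h" using t by (simp add: add_divide_distrib)
      moreover have "0 \<le> (a + s) / h" "(a + s) / h < 1" using True a s r by (auto simp: field_simps)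
      ultimately have "\<lfloor>(t + s) / h\<rfloor> = k" by linarith
      then have "\<gamma> (t + s) = flow (a + s) (orb k)" by (simp add: \<gamma>_def a_def algebra_simps)
      then show ?thesis using R by simp
    next
      case False
      have "(t + s) / h = of_int k + (a + s) / h" using t by (simp add: add_divide_distrib)
      moreover have "1 \<le> (a + s) / h" "(a + s) / h < 2" using False a s r by (auto simp: field_simps)
      ultimately have "\<lfloor>(t + s) / h\<rfloor> = k + 1" by linarith
      then have "\<gamma> (t + s) = flow (t + s - h * of_int (k + 1)) (orb (k + 1))" by (simp only: \<gamma>_def)
      also have "t + s - h * of_int (k + 1) = a + s - h" by (simp add: a_def distrib_left)
      finally have "\<gamma> (t + s) = flow (a + s - h) (flow h (orb k))" by (simp only: orb_Suc)
      also have "\<dots> = flow (h + (a + s - h)) (orb k)" using a s r False by (intro flow_add orbZ) auto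
      finally show ?thesis using R by simp
    qed
  qed
  have "\<gamma> (t + s) = flow s (\<gamma> t)" if s: "\<bar>s\<bar> < h" for t s
  proof (cases "s \<ge> 0")
    case False
    have "\<gamma> t = flow (- s) (\<gamma> (t + s))" using pos[of "- s" "t + s"] s False by simp
    then have "flow s (\<gamma> t) = flow (- s + s) (\<gamma> (t + s))" using s r by (simp add: flow_add \<gamma>Z)
    then show ?thesis by (simp add: flow_0 \<gamma>Z)
  qed (use pos s in auto)
  moreover have "\<gamma> 0 = w" using r by (simp add: \<gamma>_def orb_def flow_0 w)
  ultimately show ?thesis using \<gamma>Z unfolding flow_line_def by blast
qed

text \<open>The time \<open>u\<close> is divided into \<open>N\<close> equal steps shorter than
  \<open>h\<close>, each of which is prescribed by the flow.\<close>

lemma flow_line_determined: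
  assumes "flow_line \<gamma>" "flow_line \<delta>" "\<gamma> a = \<delta> b"
  shows "\<gamma> (a + u) = \<delta> (b + u)"
proof -
  have "\<gamma> a \<in> Z" using assms by (simp add: flow_line_def)
  note r = r_pos[OF this]
  obtain N :: nat where N: "\<bar>u\<bar> / h < real N" using reals_Archimedean2 by blast
  then have N0: "N > 0" using r by (intro gr0I) (auto simp: field_simps)
  have small: "\<bar>u / N\<bar> < h" using N N0 r by (simp add: field_simps)
  have "\<gamma> (a + real j * (u / N)) = \<delta> (b + real j * (u / N))" for j :: nat
  proof (induction j)
    case (Suc j)
    have "\<gamma> ((a + real j * (u / N)) + u / N) = \<delta> ((b + real j * (u / N)) + u / N)"
      using assms Suc small unfolding flow_line_def by simp
    then show ?case by (simp add: algebra_simps add_divide_distrib)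
  qed (use assms in auto)
  from this[of N] show ?thesis using N0 by simp
qed

text \<open>By compactness the points at times h k of an injective orbit accumulate at some w in
  \<open>Z\<close>. Two of them lie in one small chart at w and differ by a flow time shorter than
  \<open>h\<close>; injectivity turns this into a difference of times that distinct multiples of
  \<open>h\<close> cannot have.\<close>

lemma flow_line_recurrent:
  assumes "flow_line \<gamma>"
  shows "\<exists>a b. a \<noteq> b \<and> \<gamma> a = \<gamma> b"
proof (rule ccontr)
  assume "\<not> ?thesis"
  then have inj: "\<gamma> a = \<gamma> b \<Longrightarrow> a = b" for a b by blast
  have \<gamma>Z: "\<gamma> t \<in> Z" for t using assms by (simp add: flow_line_def)
  note r = r_pos[OF \<gamma>Z[of 0]]
  define x where "x = (\<lambda>k::nat. \<gamma> (h * real k))"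
  have "inj x"
  proof (rule injI)
    fix k l assume "x k = x l"
    then have "h * real k = h * real l" unfolding x_def by (rule inj)
    then show "k = l" using r by simp
  qed
  then have "infinite (range x)" by (simp add: finite_image_iff)
  moreover have "range x \<subseteq> Z" using \<gamma>Z by (auto simp: x_def)
  ultimately obtain w where w: "w \<in> Z" "w islimpt range x"
    using compact_Z unfolding compact_eq_Bolzano_Weierstrass by blast
  \<comment> \<open>Radius \<open>h / 2\<close>, so that two flow times measured from w differ by
    less than \<open>h\<close>.\<close>
  define V where "V = \<Psi> w ` ball 0 (h / 2)"
  have sub: "ball 0 (h / 2) \<subseteq> ball (0::complex) r" using r by auto
  have "open V"
    unfolding V_def
  proof (rule open_mapping_thm3)
    show "\<Psi> w holomorphic_on ball 0 (h / 2)" by (rule holomorphic_on_subset[OF \<Psi>_holo[OF w(1)] sub])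
    show "inj_on (\<Psi> w) (ball 0 (h / 2))" by (rule inj_on_subset[OF \<Psi>_inj[OF w(1)] sub])
  qed simp
  moreover have "w \<in> V" unfolding V_def using r w by (intro image_eqI[of _ _ 0]) (auto simp: \<Psi>_0)
  ultimately have inf: "infinite (V \<inter> range x)" using w(2) unfolding islimpt_eq_acc_point by blast
  then have "V \<inter> range x \<noteq> {}" by (metis finite.emptyI)
  then obtain y1 where y1: "y1 \<in> V \<inter> range x" by blast
  from inf have "infinite (V \<inter> range x - {y1})" by simp
  then have "V \<inter> range x - {y1} \<noteq> {}" by (metis finite.emptyI)
  then obtain y2 where y2: "y2 \<in> V \<inter> range x" "y2 \<noteq> y1" by blast
  have Vreal: "\<exists>s. \<bar>s\<bar> < h / 2 \<and> y = flow s w" if yV: "y \<in> V" and yZ: "y \<in> Z" for y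
  proof -
    obtain \<zeta> where "\<zeta> \<in> ball 0 (h / 2)" and y: "y = \<Psi> w \<zeta>" using yV unfolding V_def by blast
    then have \<zeta>: "norm \<zeta> < h / 2" "y = \<Psi> w \<zeta>" by auto
    then have "norm \<zeta> < r" using r by simp
    then have "Im \<zeta> = 0" using \<Psi>_in_Z_iff[OF w(1)] \<zeta>(2) yZ by simp
    then obtain s where "\<zeta> = of_real s" by (metis complex_is_Real_iff Reals_cases)
    then show ?thesis using \<zeta> by (auto simp: flow_def)
  qed
  obtain k1 where k1: "y1 = \<gamma> (h * real k1)" using y1 by (auto simp: x_def)
  obtain k2 where k2: "y2 = \<gamma> (h * real k2)" using y2 by (auto simp: x_def)
  obtain s1 where s1: "\<bar>s1\<bar> < h / 2" "y1 = flow s1 w" using Vreal[of y1] y1 k1 \<gamma>Z by auto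
  obtain s2 where s2: "\<bar>s2\<bar> < h / 2" "y2 = flow s2 w" using Vreal[of y2] y2 k2 \<gamma>Z by auto
  have "flow (s2 - s1) y1 = flow (s1 + (s2 - s1)) w"
    unfolding s1(2) using s1(1) s2(1) r by (intro flow_add w) auto
  also have "\<dots> = y2" using s2 by simp
  finally have "flow (s2 - s1) (\<gamma> (h * real k1)) = \<gamma> (h * real k2)" unfolding k1 k2 .
  moreover have "\<bar>s2 - s1\<bar> < h" using s1(1) s2(1) by linarith
  ultimately have "\<gamma> (h * real k1 + (s2 - s1)) = \<gamma> (h * real k2)"
    using assms unfolding flow_line_def by metis
  then have eq: "h * real k1 + (s2 - s1) = h * real k2" by (rule inj)
  have "h * \<bar>real k2 - real k1\<bar> < h * 1"
  proof -
    have "\<bar>h * real k2 - h * real k1\<bar> = \<bar>h\<bar> * \<bar>real k2 - real k1\<bar>"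
      by (simp only: flip: right_diff_distrib abs_mult)
    then have "h * \<bar>real k2 - real k1\<bar> = \<bar>h * real k2 - h * real k1\<bar>" using r by simp
    also have "\<dots> = \<bar>s2 - s1\<bar>" using eq by simp
    also have "\<dots> < h * 1" using s1(1) s2(1) by linarith
    finally show ?thesis .
  qed
  then have "\<bar>real k2 - real k1\<bar> < 1" using r by (simp add: mult_less_cancel_left_pos)
  then have "k1 = k2" by linarith
  then show False using y2 k1 k2 by simp
qed

text \<open>Distinct times at which the orbit takes the same value are at least \<open>h\<close>
  apart, so the set of positive periods has a least element, and the orbit is injective on one such
  period.\<close>

lemma flow_line_period:
  assumes fl: "flow_line \<gamma>"
  obtains T where "T > 0" "\<And>t. \<gamma> (t + T) = \<gamma> t" "\<And>a b. 0 \<le> a \<Longrightarrow> a < T \<Longrightarrow> 0 \<le> b \<Longrightarrow> b < T \<Longrightarrow> \<gamma> a = \<gamma> b \<Longrightarrow> a = b"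
proof -
  have \<gamma>Z: "\<gamma> t \<in> Z" for t using assms by (simp add: flow_line_def)
  note r = r_pos[OF \<gamma>Z[of 0]]
  have shift: "\<gamma> (a + u) = \<gamma> (b + u)" if "\<gamma> a = \<gamma> b" for a b u
    using flow_line_determined[OF fl fl that] .
  have loc: "\<bar>b - a\<bar> \<ge> h" if "\<gamma> a = \<gamma> b" "a \<noteq> b" for a b
  proof (rule ccontr)
    assume "\<not> \<bar>b - a\<bar> \<ge> h"
    then have *: "\<bar>b - a\<bar> < h" by simp
    then have "\<gamma> (a + (b - a)) = flow (b - a) (\<gamma> a)" using fl unfolding flow_line_def by blast
    then have "flow (b - a) (\<gamma> a) = \<gamma> a" using that by simp
    then have "b - a = 0" using * r by (intro flow_inj[OF \<gamma>Z[of a]]) auto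
    then show False using that by simp
  qed
  define S where "S = {T. T > 0 \<and> \<gamma> T = \<gamma> 0}"
  have "S \<noteq> {}"
  proof -
    have ex: "\<exists>a b. a < b \<and> \<gamma> a = \<gamma> b" using flow_line_recurrent[OF fl] by (metis linorder_neqE_linordered_idom)
    then obtain a b where "a < b" "\<gamma> a = \<gamma> b" by blast
    then have "b - a \<in> S" using shift[of a b "-a"] by (simp add: S_def)
    then show ?thesis by blast
  qed
  have Sh: "T \<ge> h" if "T \<in> S" for T using loc[of 0 T] that by (auto simp: S_def)
  have bdd: "bdd_below S" by (rule bdd_belowI[of _ h]) (rule Sh)
  define I where "I = Inf S"
  have lower: "I \<le> T" if "T \<in> S" for T unfolding I_def by (rule cInf_lower[OF that bdd])
  have close: "\<exists>T\<in>S. T < I + e" if "e > 0" for e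
    using cInf_lessD[OF \<open>S \<noteq> {}\<close>, of "I + e"] that by (auto simp: I_def)
  \<comment> \<open>A period within \<open>h / 2\<close> of the infimum is already the least one: a
    smaller one would be closer to it than \<open>h\<close>.\<close>
  obtain T where T: "T \<in> S" "T < I + h / 2" using close[of "h / 2"] r by auto
  have TI: "T \<le> T'" if "T' \<in> S" for T'
  proof (rule ccontr)
    assume "\<not> T \<le> T'"
    then have "\<bar>T - T'\<bar> < h" using lower[OF that] T(2) r by auto
    moreover have "\<gamma> T' = \<gamma> T" using that T by (simp add: S_def)
    ultimately show False using loc[of T' T] \<open>\<not> T \<le> T'\<close> by auto
  qed
  show ?thesis
  proof
    show "T > 0" using T by (simp add: S_def)
    show "\<gamma> (t + T) = \<gamma> t" for t using T shift[of T 0 t] by (simp add: S_def add.commute)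
    have *: "False" if "0 \<le> a" "a < b" "b < T" "\<gamma> a = \<gamma> b" for a b
      using shift[OF that(4), of "-a"] that TI[of "b - a"] by (auto simp: S_def)
    show "a = b" if "0 \<le> a" "a < T" "0 \<le> b" "b < T" "\<gamma> a = \<gamma> b" for a b
      using *[of a b] *[of b a] that by (metis linorder_neqE_linordered_idom)
  qed
qed

lemma periodic_int:
  fixes \<gamma> :: "real \<Rightarrow> complex"
  assumes "\<And>t. \<gamma> (t + T) = \<gamma> t"
  shows "\<gamma> (t + of_int m * T) = \<gamma> t"
proof -
  have nat: "\<gamma> (t + real n * T) = \<gamma> t" for n t
  proof (induction n)
    case (Suc n)
    have "\<gamma> (t + real (Suc n) * T) = \<gamma> ((t + real n * T) + T)" by (simp add: algebra_simps)
    then show ?case using assms Suc by simp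
  qed simp
  show ?thesis
  proof (cases "m \<ge> 0")
    case True
    then show ?thesis using nat[of t "nat m"] by simp
  next
    case False
    then show ?thesis using nat[of "t + of_int m * T" "nat (- m)"] by simp
  qed
qed

text \<open>The charts extend the orbit to complex times near the real axis. Written in the variable
  exp (t / c), periodicity becomes single-valuedness near the unit circle.\<close>

lemma flow_line_analytic_curve:
  assumes fl: "flow_line \<gamma>"
  shows "simple_closed_analytic_curve (range \<gamma>)"
proof -
  have \<gamma>Z: "\<gamma> t \<in> Z" for t using assms by (simp add: flow_line_def)
  note r = r_pos[OF \<gamma>Z[of 0]]
  obtain T where T: "T > 0" "\<And>t. \<gamma> (t + T) = \<gamma> t"
    and inj: "\<And>a b. 0 \<le> a \<Longrightarrow> a < T \<Longrightarrow> 0 \<le> b \<Longrightarrow> b < T \<Longrightarrow> \<gamma> a = \<gamma> b \<Longrightarrow> a = b"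
    using flow_line_period[OF fl] by blast
  \<comment> \<open>Complex time is c Ln w; with this constant one turn around the circle, 2 pi i,
    corresponds to the period \<open>T\<close>.\<close>
  define c where "c = of_real T / (2 * of_real pi * \<i>)"
  have c0: "c \<noteq> 0" using T by (simp add: c_def)
  \<comment> \<open>Flow along the orbit for the real part of the time, then leave it through the
    chart by the imaginary part.\<close>
  define G where "G = (\<lambda>w. \<Psi> (\<gamma> (Re (c * Ln w))) (\<i> * of_real (Im (c * Ln w))))"
  define E where "E = (\<lambda>t. exp (of_real t / c))"
  \<comment> \<open>Crossing the cut of Ln changes the time by a multiple of \<open>T\<close>, which
    the orbit ignores; hence near each point \<open>G\<close> is one chart after a logarithm that is
    holomorphic there.\<close>
  have local: "\<forall>\<^sub>F w in nhds (E t0). G w = \<Psi> (\<gamma> t0) (c * Ln (w / E t0))" for t0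
  proof -
    have E0: "E t0 \<noteq> 0" by (simp add: E_def)
    have "isCont (\<lambda>w. c * Ln (w / E t0)) (E t0)" using E0 by (intro continuous_intros) auto
    then have "((\<lambda>w. c * Ln (w / E t0)) \<longlongrightarrow> c * Ln (E t0 / E t0)) (nhds (E t0))"
      unfolding isCont_def tendsto_at_iff_tendsto_nhds[of "\<lambda>w. c * Ln (w / E t0)" "E t0"] .
    then have "\<forall>\<^sub>F w in nhds (E t0). dist (c * Ln (w / E t0)) (c * Ln (E t0 / E t0)) < h"
      by (rule tendstoD) (use r in simp)
    moreover have "\<forall>\<^sub>F w in nhds (E t0). w \<noteq> 0" using E0 by (rule t1_space_nhds)
    ultimately show ?thesis
    proof eventually_elim
      case (elim w)
      define \<tau> where "\<tau> = c * Ln (w / E t0)"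
      have n\<tau>: "norm \<tau> < h" using elim(1) E0 by (simp add: \<tau>_def)
      have Re\<tau>: "\<bar>Re \<tau>\<bar> < h" "\<bar>Im \<tau>\<bar> < h" using abs_Re_le_cmod[of \<tau>] abs_Im_le_cmod[of \<tau>] n\<tau> by linarith+
      have "exp (Ln w) = exp (of_real t0 / c + \<tau> / c)"
        using elim E0 c0 by (simp add: exp_add \<tau>_def E_def)
      then obtain m :: int where "Ln w = of_real t0 / c + \<tau> / c + of_real (of_int (2 * m) * pi) * \<i>"
        unfolding exp_eq by blast
      then have "c * Ln w = of_real t0 + \<tau> + c * (of_real (of_int (2 * m) * pi) * \<i>)"
        using c0 by (simp add: algebra_simps)
      also have "c * (of_real (of_int (2 * m) * pi) * \<i>) = of_real (of_int (2 * m) * pi) * (c * \<i>)"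
        by (simp only: mult_ac)
      also have "c * \<i> = of_real (T / (2 * pi))" by (simp add: c_def)
      also have "of_real (of_int (2 * m) * pi) * of_real (T / (2 * pi))
          = (of_real (of_int (2 * m) * pi * (T / (2 * pi))) :: complex)"
        by (rule of_real_mult[symmetric])
      also have "of_int (2 * m) * pi * (T / (2 * pi)) = of_int m * T" by simp
      also have "of_real (of_int m * T) = (of_int m * of_real T :: complex)" by simp
      finally have eq: "c * Ln w = of_real t0 + \<tau> + of_int m * of_real T" .
      then have re: "Re (c * Ln w) = (t0 + Re \<tau>) + of_int m * T" and im: "Im (c * Ln w) = Im \<tau>" by simp_all
      have "\<gamma> (Re (c * Ln w)) = \<gamma> (t0 + Re \<tau>)" unfolding re by (rule periodic_int[of \<gamma>]) (rule T(2))
      also have "\<dots> = \<Psi> (\<gamma> t0) (of_real (Re \<tau>))" using fl Re\<tau> by (simp add: flow_line_def flow_def)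
      finally have re': "\<gamma> (Re (c * Ln w)) = \<Psi> (\<gamma> t0) (of_real (Re \<tau>))" .
      have "G w = \<Psi> (\<Psi> (\<gamma> t0) (of_real (Re \<tau>))) (\<i> * of_real (Im \<tau>))" unfolding G_def re' im ..
      also have "\<dots> = \<Psi> (\<gamma> t0) (of_real (Re \<tau>) + \<i> * of_real (Im \<tau>))"
        using Re\<tau> r by (intro \<Psi>_add \<gamma>Z) (auto simp: norm_mult)
      also have "of_real (Re \<tau>) + \<i> * of_real (Im \<tau>) = \<tau>" by (simp add: complex_eq_iff)
      finally show ?case by (simp add: \<tau>_def)
    qed
  qed
  have GE: "G (E t) = \<gamma> t" for t
    using eventually_nhds_x_imp_x[OF local[of t]] by (simp add: \<Psi>_0 \<gamma>Z E_def)
  have dG: "(G has_field_derivative deriv (\<Psi> (\<gamma> t)) 0 * (c / E t)) (at (E t))" for t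
  proof -
    have E0: "E t \<noteq> 0" by (simp add: E_def)
    have d1: "((\<lambda>w. c * Ln (w / E t)) has_field_derivative c / E t) (at (E t))"
      using E0 by (auto intro!: derivative_eq_intros)
    have "(\<Psi> (\<gamma> t) has_field_derivative deriv (\<Psi> (\<gamma> t)) 0) (at (c * Ln (E t / E t)))"
      using E0 r holomorphic_derivI[OF \<Psi>_holo[OF \<gamma>Z[of t]] open_ball, of 0] by simp
    then have "((\<lambda>w. \<Psi> (\<gamma> t) (c * Ln (w / E t))) has_field_derivative deriv (\<Psi> (\<gamma> t)) 0 * (c / E t)) (at (E t))"
      using d1 by (rule DERIV_chain2)
    then show ?thesis
      using DERIV_cong_ev[OF refl local[of t] refl] by blast
  qed
  have anG: "G analytic_on {E t}" for t
  proof -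
    have E0: "E t \<noteq> 0" by (simp add: E_def)
    have "(\<lambda>w. c * Ln (w / E t)) analytic_on {E t}"
      using E0 by (intro analytic_intros) auto
    moreover have "\<Psi> (\<gamma> t) analytic_on (\<lambda>w. c * Ln (w / E t)) ` {E t}"
      using E0 r \<Psi>_holo[OF \<gamma>Z[of t]] by (auto simp: analytic_at intro!: exI[of _ "ball 0 r"])
    ultimately have "(\<Psi> (\<gamma> t) \<circ> (\<lambda>w. c * Ln (w / E t))) analytic_on {E t}" by (rule analytic_on_compose)
    then show ?thesis using local[of t] analytic_at_cong[of G _ "E t" "E t"] by (simp add: o_def)
  qed
  have Esph: "\<exists>t. 0 \<le> t \<and> t < T \<and> w = E t" if w: "w \<in> sphere 0 1" for w
  proof -
    have "w = exp (\<i> * of_real (Arg2pi w))" using Arg2pi_eq[of w] w by simp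
    also have "\<dots> = E (T * Arg2pi w / (2 * pi))" using T by (simp add: E_def c_def field_simps)
    finally have "w = E (T * Arg2pi w / (2 * pi))" .
    moreover have "T * Arg2pi w / (2 * pi) < T"
      using T Arg2pi_lt_2pi[of w] pi_gt_zero by (simp add: divide_less_eq)
    ultimately show ?thesis using T Arg2pi_ge_0[of w] by (intro exI[of _ "T * Arg2pi w / (2 * pi)"]) auto
  qed
  have Esph': "E t \<in> sphere 0 1" for t
  proof -
    have "of_real t / c = \<i> * of_real (2 * pi * t / T) * (-1)* (-1)" using T by (simp add: c_def field_simps)
    then have "E t = exp (\<i> * of_real (2 * pi * t / T))" by (simp add: E_def)
    then show ?thesis by simp
  qed
  have "analytic_parametrization G (range \<gamma>)"
    unfolding analytic_parametrization_def
  proof (intro conjI ballI)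
    show "G analytic_on sphere 0 1" using anG Esph by (subst analytic_on_analytic_at) blast
    show "inj_on G (sphere 0 1)"
    proof (rule inj_onI)
      fix x y assume xy: "x \<in> sphere 0 1" "y \<in> sphere 0 1" and eq: "G x = G y"
      obtain s where s: "0 \<le> s" "s < T" "x = E s" using Esph xy by blast
      obtain t where t: "0 \<le> t" "t < T" "y = E t" using Esph xy by blast
      have "\<gamma> s = \<gamma> t" using eq by (simp add: s t GE)
      then have "s = t" by (rule inj[OF s(1,2) t(1,2)])
      then show "x = y" by (simp add: s t)
    qed
    show "deriv G w \<noteq> 0" if w: "w \<in> sphere 0 1" for w
    proof -
      obtain t where t: "w = E t" using Esph w by blast
      have "deriv G w = deriv (\<Psi> (\<gamma> t)) 0 * (c / E t)" unfolding t by (rule DERIV_imp_deriv[OF dG])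
      then show ?thesis using \<Psi>_deriv[OF \<gamma>Z r, of t] c0 by (simp add: E_def)
    qed
    show "G ` sphere 0 1 = range \<gamma>"
    proof (intro equalityI subsetI)
      fix x assume "x \<in> G ` sphere 0 1"
      then obtain w where "w \<in> sphere 0 1" "x = G w" by blast
      then show "x \<in> range \<gamma>" using Esph[of w] GE by auto
    next
      fix x assume "x \<in> range \<gamma>"
      then obtain t where "x = G (E t)" using GE by auto
      then show "x \<in> G ` sphere 0 1" using Esph' by blast
    qed
  qed
  then show ?thesis unfolding simple_closed_analytic_curve_def by blast
qed

text \<open>Orbits that meet have the same range, which gives disjointness. Points of
  \<open>Z\<close> in the small chart at v lie on the orbit of v, so finitely many charts covering
  \<open>Z\<close> leave finitely many orbits.\<close>

theorem finite_union_of_curves: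
  "\<exists>\<C>. finite \<C> \<and> disjoint \<C> \<and> \<Union>\<C> = Z \<and> (\<forall>C\<in>\<C>. simple_closed_analytic_curve C)"
proof -
  have "\<forall>w\<in>Z. \<exists>\<gamma>. flow_line \<gamma> \<and> \<gamma> 0 = w" using flow_line_exists by blast
  then obtain \<Gamma> where \<Gamma>: "\<And>w. w \<in> Z \<Longrightarrow> flow_line (\<Gamma> w) \<and> \<Gamma> w 0 = w" by metis
  define \<C> where "\<C> = (\<lambda>w. range (\<Gamma> w)) ` Z"
  have same: "range (\<Gamma> v) = range (\<Gamma> w)" if "v \<in> Z" "w \<in> Z" "\<Gamma> v a = \<Gamma> w b" for v w a b
  proof -
    have *: "\<Gamma> v (a + u) = \<Gamma> w (b + u)" for u using flow_line_determined \<Gamma> that by blast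
    have 1: "\<Gamma> v t = \<Gamma> w (b + (t - a))" for t using *[of "t - a"] by simp
    have 2: "\<Gamma> w t = \<Gamma> v (a + (t - b))" for t using *[of "t - b"] by simp
    show ?thesis
    proof (intro equalityI image_subsetI)
      show "\<Gamma> v t \<in> range (\<Gamma> w)" for t by (subst 1) (rule rangeI)
      show "\<Gamma> w t \<in> range (\<Gamma> v)" for t by (subst 2) (rule rangeI)
    qed
  qed
  have cover: "\<exists>F\<subseteq>Z. finite F \<and> Z \<subseteq> (\<Union>w\<in>F. \<Psi> w ` ball 0 h)"
  proof -
    have "open (\<Psi> w ` ball 0 h)" if w: "w \<in> Z" for w
    proof (rule open_mapping_thm3)
      have sub: "ball 0 h \<subseteq> ball (0::complex) r" using r_pos[OF w] by auto
      show "\<Psi> w holomorphic_on ball 0 h" by (rule holomorphic_on_subset[OF \<Psi>_holo[OF w] sub])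
      show "inj_on (\<Psi> w) (ball 0 h)" by (rule inj_on_subset[OF \<Psi>_inj[OF w] sub])
    qed simp
    moreover have "Z \<subseteq> (\<Union>w\<in>Z. \<Psi> w ` ball 0 h)"
    proof
      fix w assume w: "w \<in> Z"
      have "w \<in> \<Psi> w ` ball 0 h" using r_pos[OF w] \<Psi>_0[OF w] by (intro image_eqI[of _ _ 0]) auto
      then show "w \<in> (\<Union>w\<in>Z. \<Psi> w ` ball 0 h)" using w by blast
    qed
    ultimately obtain F where "F \<subseteq> Z" "finite F" "Z \<subseteq> (\<Union>w\<in>F. \<Psi> w ` ball 0 h)"
      by (rule compactE_image[OF compact_Z])
    then show ?thesis by blast
  qed
  then obtain F where F: "F \<subseteq> Z" "finite F" "Z \<subseteq> (\<Union>w\<in>F. \<Psi> w ` ball 0 h)" by blast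
  have "\<C> \<subseteq> (\<lambda>w. range (\<Gamma> w)) ` F"
  proof
    fix C assume "C \<in> \<C>"
    then obtain w where w: "w \<in> Z" "C = range (\<Gamma> w)" by (auto simp: \<C>_def)
    then have "w \<in> (\<Union>w\<in>F. \<Psi> w ` ball 0 h)" using F(3) by blast
    then obtain v \<zeta> where v: "v \<in> F" "norm \<zeta> < h" "w = \<Psi> v \<zeta>" by auto
    have vZ: "v \<in> Z" using v F by blast
    note r = r_pos[OF vZ]
    have "norm \<zeta> < r" using v r by simp
    then have "Im \<zeta> = 0" using \<Psi>_in_Z_iff[OF vZ] v(3) w(1) by simp
    then obtain s where s: "\<zeta> = of_real s" by (metis complex_is_Real_iff Reals_cases)
    have sh: "\<bar>s\<bar> < h" using v(2) by (simp add: s)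
    have "\<Gamma> v (0 + s) = flow s (\<Gamma> v 0)" using \<Gamma>[OF vZ] sh unfolding flow_line_def by blast
    then have "\<Gamma> v s = \<Gamma> w 0" using \<Gamma>[OF vZ] \<Gamma>[OF w(1)] v(3) s by (simp add: flow_def)
    then show "C \<in> (\<lambda>w. range (\<Gamma> w)) ` F" using same[OF vZ w(1)] v(1) w(2) by blast
  qed
  then have "finite \<C>" using F(2) finite_surj by blast
  moreover have "disjoint \<C>"
    unfolding disjoint_def
  proof (intro ballI impI)
    fix A B assume AB: "A \<in> \<C>" "B \<in> \<C>" "A \<noteq> B"
    then obtain v w where vw: "v \<in> Z" "w \<in> Z" "A = range (\<Gamma> v)" "B = range (\<Gamma> w)" by (auto simp: \<C>_def)
    show "A \<inter> B = {}"
    proof (rule ccontr)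
      assume "A \<inter> B \<noteq> {}"
      then obtain a b where "\<Gamma> v a = \<Gamma> w b" using vw by auto
      then show False using same vw AB(3) by blast
    qed
  qed
  moreover have "\<Union>\<C> = Z"
  proof (intro equalityI subsetI)
    fix x assume "x \<in> \<Union>\<C>"
    then obtain w t where "w \<in> Z" "x = \<Gamma> w t" by (auto simp: \<C>_def)
    then show "x \<in> Z" using \<Gamma>[of w] by (simp add: flow_line_def)
  next
    fix x assume x: "x \<in> Z"
    then have "x \<in> range (\<Gamma> x)" using \<Gamma>[OF x] by (metis rangeI)
    then show "x \<in> \<Union>\<C>" using x by (auto simp: \<C>_def)
  qed
  moreover have "\<forall>C\<in>\<C>. simple_closed_analytic_curve C"
    using \<Gamma> flow_line_analytic_curve by (auto simp: \<C>_def)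
  ultimately show ?thesis by blast
qed

end

text \<open>The set \<open>P\<close> is one and the same for all points of \<open>Z\<close>; it
  orients the local arcs coherently, which makes their charts unique.\<close>

theorem compact_level_set_union_of_curves:
  assumes Z: "compact Z"
    and loc: "\<And>w. w \<in> Z \<Longrightarrow> \<exists>U f. open U \<and> w \<in> U \<and> f holomorphic_on U \<and> deriv f w \<noteq> 0 \<and>
               (\<forall>x\<in>U. (x \<in> Z \<longleftrightarrow> Im (f x) = 0) \<and> (x \<in> P \<longleftrightarrow> Im (f x) > 0))"
  shows "\<exists>\<C>. finite \<C> \<and> disjoint \<C> \<and> \<Union>\<C> = Z \<and> (\<forall>C\<in>\<C>. simple_closed_analytic_curve C)"
proof -
  have "\<exists>r \<psi>. arc_chart Z P r w \<psi>" if w: "w \<in> Z" for w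
  proof -
    obtain U f where "open U" "w \<in> U" "f holomorphic_on U" "deriv f w \<noteq> 0"
      "\<And>x. x \<in> U \<Longrightarrow> (x \<in> Z \<longleftrightarrow> Im (f x) = 0) \<and> (x \<in> P \<longleftrightarrow> Im (f x) > 0)" using loc[OF w] by blast
    then show ?thesis using w by (intro arc_chart_exists[of U w f]) auto
  qed
  then obtain r \<Psi> where "\<And>w. w \<in> Z \<Longrightarrow> arc_chart Z P r w (\<Psi> w)"
    using arc_chart_uniform_radius[OF Z] by metis
  then interpret arc_flow Z P r \<Psi> by unfold_locales (use Z in auto)
  show ?thesis by (rule finite_union_of_curves)
qed

section \<open>The Liouville equation\<close>

text \<open>Differentiability and both Wirtinger derivatives travel through the calculus rules
  together.\<close>

definition has_wirtinger :: "(complex \<Rightarrow> complex) \<Rightarrow> complex \<Rightarrow> complex \<Rightarrow> complex \<Rightarrow> bool" where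
  "has_wirtinger f A B x \<longleftrightarrow> (f has_derivative (\<lambda>h. A * h + B * cnj h)) (at x)"

lemma has_wirtinger_D:
  assumes "has_wirtinger f A B x"
  shows "f differentiable (at x)" "wirtinger f x = A" "wirtinger_bar f x = B"
proof -
  have d: "(f has_derivative (\<lambda>h. A * h + B * cnj h)) (at x)" using assms by (simp add: has_wirtinger_def)
  then show "f differentiable (at x)" by (rule differentiableI)
  have "frechet_derivative f (at x) = (\<lambda>h. A * h + B * cnj h)" using frechet_derivative_at[OF d] by simp
  then show "wirtinger f x = A" "wirtinger_bar f x = B"
    by (simp_all add: wirtinger_def wirtinger_bar_def algebra_simps)
qed

lemma has_wirtinger_holomorphic: "(f has_field_derivative A) (at x) \<Longrightarrow> has_wirtinger f A 0 x"
  by (simp add: has_wirtinger_def has_field_derivative_def)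

lemma has_wirtinger_cnj:
  assumes "has_wirtinger f A B x"
  shows "has_wirtinger (\<lambda>x. cnj (f x)) (cnj B) (cnj A) x"
  using has_derivative_cnj[OF assms[unfolded has_wirtinger_def]]
  by (simp add: has_wirtinger_def add.commute)

lemma has_wirtinger_diff:
  assumes "has_wirtinger f A B x" "has_wirtinger g C D x"
  shows "has_wirtinger (\<lambda>x. f x - g x) (A - C) (B - D) x"
  using has_derivative_diff[OF assms[unfolded has_wirtinger_def]]
  by (simp add: has_wirtinger_def algebra_simps)

lemma has_wirtinger_mult:
  assumes "has_wirtinger f A B x" "has_wirtinger g C D x"
  shows "has_wirtinger (\<lambda>x. f x * g x) (f x * C + A * g x) (f x * D + B * g x) x"
  using has_derivative_mult[OF assms[unfolded has_wirtinger_def]]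
  by (simp add: has_wirtinger_def algebra_simps)

lemma has_wirtinger_compose:
  assumes "has_wirtinger f A B x" "(g has_field_derivative d) (at (f x))"
  shows "has_wirtinger (\<lambda>x. g (f x)) (d * A) (d * B) x"
  using has_derivative_compose[OF assms(1)[unfolded has_wirtinger_def], of g "(*) d"] assms(2)
  by (simp add: has_wirtinger_def has_field_derivative_def algebra_simps)

lemma has_wirtinger_cong_ev:
  assumes "has_wirtinger f A B x" "\<forall>\<^sub>F y in nhds x. f y = g y"
  shows "has_wirtinger g A B x"
  unfolding has_wirtinger_def
proof (rule has_derivative_transform_eventually)
  show "(f has_derivative (\<lambda>h. A * h + B * cnj h)) (at x)" using assms(1) by (simp add: has_wirtinger_def)
  show "\<forall>\<^sub>F y in at x. f y = g y" using assms(2) by (auto simp: eventually_at_filter elim: eventually_mono)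
  show "f x = g x" using assms(2) by (rule eventually_nhds_x_imp_x)
qed simp

lemma has_wirtinger_hermitian:
  assumes "(v1 has_field_derivative d1) (at x)" "(v2 has_field_derivative d2) (at x)"
  shows "has_wirtinger (\<lambda>x. v1 x * cnj (v2 x) - cnj (v1 x) * v2 x)
     (d1 * cnj (v2 x) - cnj (v1 x) * d2) (v1 x * cnj d2 - cnj d1 * v2 x) x"
  using has_wirtinger_diff[OF has_wirtinger_mult[OF has_wirtinger_holomorphic[OF assms(1)] has_wirtinger_cnj[OF has_wirtinger_holomorphic[OF assms(2)]]]
    has_wirtinger_mult[OF has_wirtinger_cnj[OF has_wirtinger_holomorphic[OF assms(1)]] has_wirtinger_holomorphic[OF assms(2)]]]
  by simp

lemma Im_via_cnj: "of_real (Im (a * cnj b)) = (a * cnj b - cnj a * b) / (2 * \<i>)"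
proof -
  have "a * cnj b - cnj a * b = 2 * \<i> * of_real (Im (a * cnj b))"
    by (simp add: complex_eq_iff algebra_simps)
  moreover have "t = 2 * \<i> * t / (2 * \<i>)" for t :: complex by simp
  ultimately show ?thesis by presburger
qed

text \<open>The factor \<open>2 \<i>\<close> in the denominator of \<open>J = (v1 cnj v2 - cnj v1 v2) / (2 \<i>)\<close> is cleared throughout.\<close>
lemma liouville_equation_hermitian:
  fixes \<phi> J :: "complex \<Rightarrow> real"
  assumes U: "open U" "w \<in> U" and v: "v1 holomorphic_on U" "v2 holomorphic_on U"
    and W: "\<And>x. x \<in> U \<Longrightarrow> wronskian v1 v2 x = W" "W \<noteq> 0"
    and J: "\<And>x. x \<in> U \<Longrightarrow> J x = Im (v1 x * cnj (v2 x))" "\<And>x. x \<in> U \<Longrightarrow> J x \<noteq> 0"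
    and \<phi>: "\<And>x. x \<in> U \<Longrightarrow> \<phi> x = ln ((cmod W)\<^sup>2 / (J x)\<^sup>2)"
  shows "(\<lambda>x. complex_of_real (\<phi> x)) differentiable (at w)"
    and "wirtinger_bar (\<lambda>x. complex_of_real (\<phi> x)) differentiable (at w)"
    and "wirtinger (wirtinger_bar (\<lambda>x. complex_of_real (\<phi> x))) w = 1 / 2 * complex_of_real (exp (\<phi> w))"
proof -
  define N where "N = (\<lambda>x. v1 x * cnj (v2 x) - cnj (v1 x) * v2 x)"
  define Nz where "Nz = (\<lambda>x. deriv v1 x * cnj (v2 x) - cnj (v1 x) * deriv v2 x)"
  define Nzb where "Nzb = (\<lambda>x. v1 x * cnj (deriv v2 x) - cnj (deriv v1 x) * v2 x)"
  have JN: "of_real (J x) = N x / (2 * \<i>)" if "x \<in> U" for x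
    using J(1)[OF that] Im_via_cnj[of "v1 x" "v2 x"] by (simp add: N_def)
  have N0: "N x \<noteq> 0" if "x \<in> U" for x using JN[OF that] J(2)[OF that] by auto
  note d1 = holomorphic_derivI[OF v(1) U(1)] and d2 = holomorphic_derivI[OF v(2) U(1)]
  have dN: "has_wirtinger N (Nz x) (Nzb x) x" if x: "x \<in> U" for x
    unfolding N_def Nz_def Nzb_def by (rule has_wirtinger_hermitian[OF d1[OF x] d2[OF x]])
  have ev: "\<forall>\<^sub>F y in nhds x. y \<in> U" if "x \<in> U" for x using U(1) that by (rule eventually_nhds_in_open)
  have d\<phi>: "has_wirtinger (\<lambda>x. of_real (\<phi> x)) (- 2 * Nz x / N x) (- 2 * Nzb x / N x) x" if x: "x \<in> U" for x
  proof -
    have NJ: "of_real (J y) = Re (N y / (2 * \<i>))" if "y \<in> U" for y using JN[OF that] by (metis Re_complex_of_real of_real_eq_id id_apply)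
    have "(N has_derivative (\<lambda>h. Nz x * h + Nzb x * cnj h)) (at x)" using dN[OF x] by (simp add: has_wirtinger_def)
    then have "((\<lambda>y. Re (N y / (2 * \<i>))) has_derivative (\<lambda>h. Re ((Nz x * h + Nzb x * cnj h) / (2 * \<i>)))) (at x)"
      by (intro has_derivative_Re bounded_linear.has_derivative[OF bounded_linear_divide])
    moreover have "\<forall>\<^sub>F y in at x. Re (N y / (2 * \<i>)) = J y"
      using ev[OF x] unfolding eventually_at_filter by eventually_elim (use NJ in auto)
    ultimately have dJ: "(J has_derivative (\<lambda>h. Re ((Nz x * h + Nzb x * cnj h) / (2 * \<i>)))) (at x)"
      using NJ[OF x] by (elim has_derivative_transform_eventually) auto
    have pos: "0 < cmod W * cmod W / (J x * J x)"
      using J(2)[OF x] W(2) by (metis norm_eq_zero not_real_square_gt_zero zero_less_divide_iff)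
    have "((\<lambda>t. ln ((cmod W)\<^sup>2 / t\<^sup>2)) has_field_derivative - 2 / J x) (at (J x))"
      using J(2)[OF x] W(2) pos by (auto intro!: derivative_eq_intros simp: field_simps power2_eq_square)
    then have "((\<lambda>y. ln ((cmod W)\<^sup>2 / (J y)\<^sup>2)) has_derivative (\<lambda>h. Re ((Nz x * h + Nzb x * cnj h) / (2 * \<i>)) * (- 2 / J x))) (at x)"
      by (rule DERIV_compose_FDERIV[OF _ dJ])
    moreover have "\<forall>\<^sub>F y in at x. ln ((cmod W)\<^sup>2 / (J y)\<^sup>2) = \<phi> y"
      using ev[OF x] unfolding eventually_at_filter by eventually_elim (use \<phi> in auto)
    ultimately have "(\<phi> has_derivative (\<lambda>h. Re ((Nz x * h + Nzb x * cnj h) / (2 * \<i>)) * (- 2 / J x))) (at x)"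
      using \<phi>[OF x] by (elim has_derivative_transform_eventually) auto
    then have "((\<lambda>y. complex_of_real (\<phi> y)) has_derivative (\<lambda>h. complex_of_real (Re ((Nz x * h + Nzb x * cnj h) / (2 * \<i>)) * (- 2 / J x)))) (at x)"
      by (rule has_derivative_of_real)
    also have "(\<lambda>h. complex_of_real (Re ((Nz x * h + Nzb x * cnj h) / (2 * \<i>)) * (- 2 / J x)))
       = (\<lambda>h. (- 2 * Nz x / N x) * h + (- 2 * Nzb x / N x) * cnj h)"
    proof
      fix h
      \<comment> \<open>The two coefficients satisfy Nzb = - cnj Nz, since \<open>N\<close> is
        imaginary; so the increment divided by 2 i is real and taking its real part loses
        nothing.\<close>
      have "cnj ((Nz x * h + Nzb x * cnj h) / (2 * \<i>)) = (Nz x * h + Nzb x * cnj h) / (2 * \<i>)"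
        by (simp add: Nz_def Nzb_def field_simps)
      then have "complex_of_real (Re ((Nz x * h + Nzb x * cnj h) / (2 * \<i>))) = (Nz x * h + Nzb x * cnj h) / (2 * \<i>)"
        by (metis Reals_cnj_iff complex_is_Real_iff of_real_Re)
      then have "complex_of_real (Re ((Nz x * h + Nzb x * cnj h) / (2 * \<i>)) * (- 2 / J x))
         = (Nz x * h + Nzb x * cnj h) / (2 * \<i>) * (- 2 / (N x / (2 * \<i>)))"
        unfolding JN[OF x, symmetric] by simp
      also have "\<dots> = (- 2 * Nz x / N x) * h + (- 2 * Nzb x / N x) * cnj h"
        using N0[OF x] by (simp add: field_simps)
      finally show "complex_of_real (Re ((Nz x * h + Nzb x * cnj h) / (2 * \<i>)) * (- 2 / J x))
         = (- 2 * Nz x / N x) * h + (- 2 * Nzb x / N x) * cnj h" .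
    qed
    finally show ?thesis by (simp only: has_wirtinger_def)
  qed
  show "(\<lambda>x. complex_of_real (\<phi> x)) differentiable (at w)" by (rule has_wirtinger_D(1)[OF d\<phi>[OF U(2)]])
  have bar: "wirtinger_bar (\<lambda>x. complex_of_real (\<phi> x)) x = - 2 * Nzb x / N x" if "x \<in> U" for x
    by (rule has_wirtinger_D(3)[OF d\<phi>[OF that]])
  have h: "deriv v1 holomorphic_on U" "deriv v2 holomorphic_on U" using v U(1) by (simp_all add: holomorphic_deriv)
  note dd1 = holomorphic_derivI[OF h(1) U(1,2)] and dd2 = holomorphic_derivI[OF h(2) U(1,2)]
  note d1 = d1[OF U(2)] and d2 = d2[OF U(2)]
  define Nzz where "Nzz = deriv v1 w * cnj (deriv v2 w) - cnj (deriv v1 w) * deriv v2 w"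
  have "\<exists>B. has_wirtinger Nzb Nzz B w"
    using has_wirtinger_diff[OF has_wirtinger_mult[OF has_wirtinger_holomorphic[OF d1] has_wirtinger_cnj[OF has_wirtinger_holomorphic[OF dd2]]]
      has_wirtinger_mult[OF has_wirtinger_cnj[OF has_wirtinger_holomorphic[OF dd1]] has_wirtinger_holomorphic[OF d2]]]
    unfolding Nzb_def Nzz_def by (simp; blast)
  then obtain B where B: "has_wirtinger Nzb Nzz B w" by blast
  have "((\<lambda>t. - 2 / t) has_field_derivative 2 / (N w)\<^sup>2) (at (N w))"
    using N0[OF U(2)] by (auto intro!: derivative_eq_intros simp: power2_eq_square)
  note inv = has_wirtinger_compose[OF dN[OF U(2)] this]
  have "has_wirtinger (\<lambda>x. Nzb x * (- 2 / N x)) (Nzb w * (2 / (N w)\<^sup>2 * Nz w) + Nzz * (- 2 / N w))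
      (Nzb w * (2 / (N w)\<^sup>2 * Nzb w) + B * (- 2 / N w)) w"
    by (rule has_wirtinger_mult[OF B inv])
  moreover have "\<forall>\<^sub>F x in nhds w. Nzb x * (- 2 / N x) = wirtinger_bar (\<lambda>x. complex_of_real (\<phi> x)) x"
    using ev[OF U(2)] by eventually_elim (simp add: bar)
  ultimately have fin: "has_wirtinger (wirtinger_bar (\<lambda>x. complex_of_real (\<phi> x))) (Nzb w * (2 / (N w)\<^sup>2 * Nz w) + Nzz * (- 2 / N w))
      (Nzb w * (2 / (N w)\<^sup>2 * Nzb w) + B * (- 2 / N w)) w"
    by (rule has_wirtinger_cong_ev)
  show "wirtinger_bar (\<lambda>x. complex_of_real (\<phi> x)) differentiable (at w)" by (rule has_wirtinger_D(1)[OF fin])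
  have "wirtinger (wirtinger_bar (\<lambda>x. complex_of_real (\<phi> x))) w = Nzb w * (2 / (N w)\<^sup>2 * Nz w) + Nzz * (- 2 / N w)"
    by (rule has_wirtinger_D(2)[OF fin])
  also have "\<dots> = 2 * (Nzb w * Nz w - Nzz * N w) / (N w)\<^sup>2"
    using N0[OF U(2)] by (simp add: power2_eq_square field_simps)
  \<comment> \<open>Arranged as a 2 x 2 matrix, \<open>N\<close> and its derivatives are the
    Wronskian matrix times the skew unit matrix times the conjugate transpose of the Wronskian
    matrix. Its determinant N Nzz - Nz Nzb is therefore W cnj W.\<close>
  also have "Nzb w * Nz w - Nzz * N w = - (W * cnj W)"
    using W(1)[OF U(2)] unfolding wronskian_def by (simp add: Nzb_def Nz_def Nzz_def N_def flip: W(1)[OF U(2)]) (simp add: wronskian_def algebra_simps)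
  also have "W * cnj W = of_real ((cmod W)\<^sup>2)" by (rule complex_norm_square[symmetric])
  also have "(N w)\<^sup>2 = - 4 * of_real ((J w)\<^sup>2)"
  proof -
    have "N w = 2 * \<i> * of_real (J w)" unfolding JN[OF U(2)] by simp
    then show ?thesis by (simp add: power_mult_distrib)
  qed
  also have "2 * (- of_real ((cmod W)\<^sup>2)) / (- 4 * of_real ((J w)\<^sup>2)) = (1 / 2 * of_real ((cmod W)\<^sup>2 / (J w)\<^sup>2) :: complex)"
    using J(2)[OF U(2)] by (simp add: field_simps)
  also have "(cmod W)\<^sup>2 / (J w)\<^sup>2 = exp (\<phi> w)" using \<phi>[OF U(2)] J(2)[OF U(2)] W(2) by simp
  finally show "wirtinger (wirtinger_bar (\<lambda>x. complex_of_real (\<phi> x))) w = 1 / 2 * complex_of_real (exp (\<phi> w))" .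
qed

section \<open>Linear approximation of the Hermitian form\<close>

lemma holomorphic_second_order_remainder:
  assumes "f holomorphic_on ball a r" "r > 0"
  shows "\<exists>K e. 0 < e \<and> e < r \<and> 0 \<le> K \<and> (\<forall>x\<in>ball a e. norm (f x - (f a + deriv f a * (x - a))) \<le> K * (norm (x - a))\<^sup>2)"
proof -
  define e where "e = r / 2"
  have e: "0 < e" "e < r" using assms by (auto simp: e_def)
  have sub: "cball a e \<subseteq> ball a r" using e by auto
  have h: "deriv f holomorphic_on ball a r" "deriv (deriv f) holomorphic_on ball a r"
    using assms by (simp_all add: holomorphic_deriv)
  have "compact (deriv (deriv f) ` cball a e)"
    by (intro compact_continuous_image holomorphic_on_imp_continuous_on holomorphic_on_subset[OF h(2) sub]) auto
  then obtain K where K: "K > 0" "\<And>x. x \<in> cball a e \<Longrightarrow> norm (deriv (deriv f) x) \<le> K"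
    by (metis compact_imp_bounded bounded_pos imageI)
  have "norm (f x - (f a + deriv f a * (x - a))) \<le> K * (norm (x - a))\<^sup>2" if x: "x \<in> ball a e" for x
  proof -
    have "cmod ((deriv ^^ 0) f x - (\<Sum>i\<le>1. (deriv ^^ i) f a * (x - a) ^ i / fact i)) \<le> K * cmod (x - a) ^ (Suc 1) / fact 1"
    proof (rule complex_Taylor[OF convex_ball])
      fix i y assume "y \<in> ball a e" "i \<le> (1::nat)"
      then have "(deriv ^^ i) f holomorphic_on ball a r" "y \<in> ball a r" using assms e by (auto intro: holomorphic_higher_deriv)
      then have "((deriv ^^ i) f has_field_derivative (deriv ^^ Suc i) f y) (at y)"
        using holomorphic_derivI open_ball by fastforce
      then show "((deriv ^^ i) f has_field_derivative (deriv ^^ Suc i) f y) (at y within ball a e)"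
        by (rule has_field_derivative_at_within)
    next
      fix y assume "y \<in> ball a e"
      then show "cmod ((deriv ^^ Suc 1) f y) \<le> K" using K(2)[of y] by simp
    qed (use x e in auto)
    then show ?thesis by (simp add: power2_eq_square)
  qed
  then show ?thesis using e K(1) by (intro exI[of _ K] exI[of _ e]) auto
qed

text \<open>Only the imaginary part matters, so the antilinear term v1 cnj (v2' \<delta>) may be
  replaced by minus its conjugate; the linear part of J then becomes Im (A \<delta>) with one
  complex number \<open>A\<close>.\<close>

lemma hermitian_second_order_remainder:
  assumes v: "v1 holomorphic_on ball a r" "v2 holomorphic_on ball a r" "r > 0" and J0: "Im (v1 a * cnj (v2 a)) = 0"
  defines "A \<equiv> deriv v1 a * cnj (v2 a) - cnj (v1 a) * deriv v2 a"
  shows "\<exists>K e. 0 < e \<and> e < r \<and> 0 \<le> K \<and>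
     (\<forall>x\<in>ball a e. \<bar>Im (v1 x * cnj (v2 x)) - Im (A * (x - a))\<bar> \<le> K * (norm (x - a))\<^sup>2)"
proof -
  obtain K1 e1 where 1: "0 < e1" "e1 < r" "0 \<le> K1"
    "\<And>x. x \<in> ball a e1 \<Longrightarrow> norm (v1 x - (v1 a + deriv v1 a * (x - a))) \<le> K1 * (norm (x - a))\<^sup>2"
    using holomorphic_second_order_remainder[OF v(1,3)] by blast
  obtain K2 e2 where 2: "0 < e2" "e2 < r" "0 \<le> K2"
    "\<And>x. x \<in> ball a e2 \<Longrightarrow> norm (v2 x - (v2 a + deriv v2 a * (x - a))) \<le> K2 * (norm (x - a))\<^sup>2"
    using holomorphic_second_order_remainder[OF v(2,3)] by blast
  define e where "e = min 1 (min e1 e2)"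
  have e: "0 < e" "e \<le> 1" "e \<le> e1" "e \<le> e2" "e < r" using 1 2 by (auto simp: e_def)
  define p p' s s' where ps: "p = v1 a" "p' = deriv v1 a" "s = v2 a" "s' = deriv v2 a"
  \<comment> \<open>One summand for each term of \<open>Er\<close> below; \<open>e \<le> 1\<close>
    lets higher powers of |\<delta>| be bounded by the square.\<close>
  define K where "K = norm p' * norm s' + K1 * (norm s + norm s' + K2) + (norm p + norm p') * K2"
  have "\<bar>Im (v1 x * cnj (v2 x)) - Im (A * (x - a))\<bar> \<le> K * (norm (x - a))\<^sup>2" if x: "x \<in> ball a e" for x
  proof -
    define \<delta> where "\<delta> = x - a"
    define r1 r2 where rr: "r1 = v1 x - (p + p' * \<delta>)" "r2 = v2 x - (s + s' * \<delta>)"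
    have \<delta>: "norm \<delta> \<le> 1" using x e by (simp add: \<delta>_def dist_norm norm_minus_commute)
    have r1: "norm r1 \<le> K1 * (norm \<delta>)\<^sup>2" unfolding rr ps \<delta>_def using x e by (intro 1(4)) auto
    have r2: "norm r2 \<le> K2 * (norm \<delta>)\<^sup>2" unfolding rr ps \<delta>_def using x e by (intro 2(4)) auto
    have v: "v1 x = p + p' * \<delta> + r1" "v2 x = s + s' * \<delta> + r2" by (simp_all add: rr)
    define Er where "Er = p' * \<delta> * cnj (s' * \<delta>) + r1 * cnj (v2 x) + (p + p' * \<delta>) * cnj r2"
    have "v1 x * cnj (v2 x) = p * cnj s + (p' * \<delta> * cnj s + p * cnj (s' * \<delta>)) + Er"
      by (simp add: Er_def v algebra_simps)
    moreover have "Im (p' * \<delta> * cnj s + p * cnj (s' * \<delta>)) = Im (A * \<delta>)"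
      unfolding A_def ps[symmetric] by (simp add: algebra_simps)
    moreover have "Im (p * cnj s) = 0" using J0 by (simp add: ps)
    ultimately have "Im (v1 x * cnj (v2 x)) - Im (A * (x - a)) = Im Er" by (simp add: \<delta>_def)
    then have "\<bar>Im (v1 x * cnj (v2 x)) - Im (A * (x - a))\<bar> \<le> norm Er" using abs_Im_le_cmod by simp
    also have "\<dots> \<le> norm (p' * \<delta> * cnj (s' * \<delta>)) + norm (r1 * cnj (v2 x)) + norm ((p + p' * \<delta>) * cnj r2)"
      unfolding Er_def by (intro norm_triangle_le add_mono) auto
    also have "norm (p' * \<delta> * cnj (s' * \<delta>)) = (norm p' * norm s') * (norm \<delta>)\<^sup>2"
      by (simp add: norm_mult power2_eq_square)
    also have "norm (r1 * cnj (v2 x)) \<le> (K1 * (norm s + norm s' + K2)) * (norm \<delta>)\<^sup>2"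
    proof -
      have d2: "(norm \<delta>)\<^sup>2 \<le> 1" using \<delta> by (simp add: power_le_one)
      have "norm (v2 x) \<le> norm s + norm s' * norm \<delta> + norm r2"
        unfolding v(2) by (intro norm_triangle_le add_mono) (auto simp: norm_mult)
      also have "\<dots> \<le> norm s + norm s' * 1 + K2 * 1"
        using \<delta> d2 2(3) r2 by (intro add_mono mult_left_mono order_refl order_trans[OF r2]) auto
      finally have "norm (v2 x) \<le> norm s + norm s' + K2" by simp
      then have "norm r1 * norm (v2 x) \<le> (K1 * (norm \<delta>)\<^sup>2) * (norm s + norm s' + K2)"
        using r1 1(3) by (intro mult_mono) auto
      then show ?thesis by (simp add: norm_mult mult_ac)
    qed
    also have "norm ((p + p' * \<delta>) * cnj r2) \<le> ((norm p + norm p') * K2) * (norm \<delta>)\<^sup>2"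
    proof -
      have "norm (p + p' * \<delta>) \<le> norm p + norm p' * norm \<delta>" by (intro norm_triangle_le) (auto simp: norm_mult)
      also have "\<dots> \<le> norm p + norm p' * 1" using \<delta> by (intro add_mono mult_left_mono) auto
      finally have "norm (p + p' * \<delta>) * norm r2 \<le> (norm p + norm p') * (K2 * (norm \<delta>)\<^sup>2)"
        using r2 by (intro mult_mono) auto
      then show ?thesis by (simp add: norm_mult mult_ac)
    qed
    finally show ?thesis unfolding K_def \<delta>_def by (simp add: algebra_simps)
  qed
  moreover have "K \<ge> 0" using 1(3) 2(3) by (simp add: K_def)
  ultimately show ?thesis using e by blast
qed

section \<open>The Schwarz function\<close>

text \<open>On the real locus \<open>A dz\<close> is real along \<open>C\<close>, so \<open>S'(z0) = A / cnj A\<close>, where \<open>Im (A (x - z0))\<close> is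
  the linear part of the form \<open>J\<close> at \<open>z0\<close>.\<close>
lemma schwarz_derivative_at_real_locus:
  assumes v: "v1 holomorphic_on ball z0 r" "v2 holomorphic_on ball z0 r" "r > 0"
    and J: "\<And>x. x \<in> C \<Longrightarrow> x \<in> ball z0 r \<Longrightarrow> Im (v1 x * cnj (v2 x)) = 0"
    and C: "simple_closed_analytic_curve C" "z0 \<in> C" and S: "schwarz_function S C"
  defines "A \<equiv> deriv v1 z0 * cnj (v2 z0) - cnj (v1 z0) * deriv v2 z0"
  shows "A = cnj A * deriv S z0"
    and "A \<noteq> 0 \<Longrightarrow> \<not> tangent_to v C z0 \<Longrightarrow> Im (A * v) \<noteq> 0"
proof -
  obtain g where g: "analytic_parametrization g C" using C unfolding simple_closed_analytic_curve_def by blast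
  then obtain w0 where w0: "w0 \<in> sphere 0 1" "g w0 = z0" using C(2) by (auto simp: analytic_parametrization_def)
  \<comment> \<open>The curve near \<open>z0\<close> with real parameter, and \<open>\<tau>\<close>
    its velocity there.\<close>
  define \<gamma> where "\<gamma> = (\<lambda>t::real. g (w0 * exp (\<i> * of_real t)))"
  define \<tau> where "\<tau> = \<i> * w0 * deriv g w0"
  have w0n: "norm w0 = 1" using w0 by simp
  have \<tau>0: "\<tau> \<noteq> 0" using g w0 w0n unfolding analytic_parametrization_def \<tau>_def by auto
  have \<gamma>C: "\<gamma> t \<in> C" for t
    using g w0n unfolding analytic_parametrization_def \<gamma>_def by (auto simp: norm_mult)
  have \<gamma>0: "\<gamma> 0 = z0" using w0 by (simp add: \<gamma>_def)
  have d\<gamma>: "(\<gamma> has_vector_derivative \<tau>) (at 0)"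
  proof -
    have "g analytic_on {w0}" using g w0(1) unfolding analytic_parametrization_def by (meson analytic_on_analytic_at)
    then have "(g has_field_derivative deriv g w0) (at (w0 * exp (\<i> * of_real 0)))"
      by (simp add: analytic_at_imp_isCont analytic_on_imp_differentiable_at DERIV_deriv_iff_field_differentiable)
    moreover have "((\<lambda>t. w0 * exp (\<i> * of_real t)) has_vector_derivative \<i> * w0) (at 0)"
    proof -
      have "((\<lambda>t. w0 * exp (\<i> * t)) has_field_derivative \<i> * w0) (at (of_real 0))"
        by (auto intro!: derivative_eq_intros)
      then show ?thesis by (rule has_vector_derivative_real_field)
    qed
    ultimately have "(g \<circ> (\<lambda>t. w0 * exp (\<i> * of_real t)) has_vector_derivative \<i> * w0 * deriv g w0) (at 0)"
      by (intro field_vector_diff_chain_at) auto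
    then show ?thesis by (simp add: \<gamma>_def \<tau>_def o_def)
  qed
  have along: "((\<lambda>t. f (\<gamma> t)) has_vector_derivative \<tau> * f') (at 0)" if "(f has_field_derivative f') (at z0)" for f f'
    using field_vector_diff_chain_at[OF d\<gamma>, of f f'] that by (simp add: \<gamma>0 o_def)
  obtain U where U: "open U" "C \<subseteq> U" "S holomorphic_on U" "C = {x \<in> U. cnj x = S x}"
    using S unfolding schwarz_function_def by blast
  have "(S has_field_derivative deriv S z0) (at z0)" using U C(2) by (intro holomorphic_derivI[OF U(3,1)]) auto
  then have "((\<lambda>t. S (\<gamma> t)) has_vector_derivative \<tau> * deriv S z0) (at 0)" by (rule along)
  moreover have "S (\<gamma> t) = cnj (\<gamma> t)" for t using \<gamma>C[of t] U(4) by auto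
  ultimately have "((\<lambda>t. cnj (\<gamma> t)) has_vector_derivative \<tau> * deriv S z0) (at 0)" by simp
  \<comment> \<open>Differentiate S = cnj along the curve.\<close>
  then have S\<tau>: "cnj \<tau> = \<tau> * deriv S z0"
    using has_vector_derivative_cnj[OF d\<gamma>] by (rule vector_derivative_unique_at[rotated])
  have "(v1 has_field_derivative deriv v1 z0) (at z0)" "(v2 has_field_derivative deriv v2 z0) (at z0)"
    using v by (auto intro!: holomorphic_derivI[of _ "ball z0 r"])
  note d1 = along[OF this(1)] and d2 = has_vector_derivative_cnj[OF along[OF this(2)]]
  have "((\<lambda>t. Im (v1 (\<gamma> t) * cnj (v2 (\<gamma> t)))) has_vector_derivative
      Im (v1 (\<gamma> 0) * cnj (\<tau> * deriv v2 z0) + \<tau> * deriv v1 z0 * cnj (v2 (\<gamma> 0)))) (at 0)"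
    by (rule bounded_linear.has_vector_derivative[OF bounded_linear_Im has_vector_derivative_mult[OF d1 d2]])
  then have D1: "((\<lambda>t. Im (v1 (\<gamma> t) * cnj (v2 (\<gamma> t)))) has_real_derivative Im (A * \<tau>)) (at 0)"
    by (simp add: has_real_derivative_iff_has_vector_derivative \<gamma>0 A_def algebra_simps)
  have "isCont \<gamma> 0" using d\<gamma> by (rule has_vector_derivative_continuous)
  then obtain d where d: "d > 0" "\<And>t. dist t 0 < d \<Longrightarrow> dist (\<gamma> t) (\<gamma> 0) < r"
    using v(3) unfolding continuous_at_eps_delta by blast
  have "\<forall>\<^sub>F t in nhds 0. Im (v1 (\<gamma> t) * cnj (v2 (\<gamma> t))) = 0"
    unfolding eventually_nhds_metric
    by (rule exI[of _ d]) (use d J \<gamma>C \<gamma>0 in \<open>auto simp: dist_commute\<close>)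
  from DERIV_cong_ev[OF refl this refl, THEN iffD1, OF D1]
  have "((\<lambda>t. 0) has_real_derivative Im (A * \<tau>)) (at 0)" .
  then have im: "Im (A * \<tau>) = 0" using DERIV_const DERIV_unique by blast
  have "A * \<tau> = cnj (A * \<tau>)" using im by (simp add: complex_eq_iff)
  also have "\<dots> = (cnj A * deriv S z0) * \<tau>" by (simp add: S\<tau> mult_ac)
  finally show "A = cnj A * deriv S z0" using \<tau>0 by simp
  assume A0: "A \<noteq> 0" and nt: "\<not> tangent_to v C z0"
  show "Im (A * v) \<noteq> 0"
  proof
    \<comment> \<open>Then \<open>A\<close> maps both v and the tangent vector \<tau> to the real
      axis, so v is a real multiple of \<tau>.\<close>
    assume "Im (A * v) = 0"
    then obtain x where x: "A * v = of_real x" by (metis complex_is_Real_iff Reals_cases)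
    obtain y where y: "A * \<tau> = of_real y" using im by (metis complex_is_Real_iff Reals_cases)
    have "y \<noteq> 0" using y A0 \<tau>0 by auto
    have "A * (v - (x / y) *\<^sub>R \<tau>) = of_real x - of_real (x / y) * (A * \<tau>)"
      by (simp add: x[symmetric] scaleR_conv_of_real algebra_simps)
    also have "\<dots> = 0" unfolding y using \<open>y \<noteq> 0\<close> by simp
    finally have "v = (x / y) *\<^sub>R \<tau>" using A0 by simp
    then have "tangent_to v C z0" unfolding tangent_to_def \<tau>_def using g w0 by blast
    then show False using nt by blast
  qed
qed

text \<open>With t = |x - z0|, J = N + O(t^2) and |N| \<ge> c t, the quotient N^2 / J^2 - 1 = (N -
  J)(N + J) / J^2 is O(t^2) O(t) / t^2. The lower bound on N is where non-tangential approach
  enters.\<close>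

lemma bigo_square_ratio:
  fixes N J :: "complex \<Rightarrow> real"
  assumes F: "filterlim (\<lambda>x. x) (at z0) F"
    and lower: "\<forall>\<^sub>F x in F. c * norm (x - z0) \<le> \<bar>N x\<bar>" "c > 0"
    and upper: "\<And>x. \<bar>N x\<bar> \<le> M * norm (x - z0)"
    and close: "\<And>x. x \<in> ball z0 e \<Longrightarrow> \<bar>J x - N x\<bar> \<le> K * (norm (x - z0))\<^sup>2" "e > 0" "K \<ge> 0"
  shows "\<forall>\<^sub>F x in F. x \<in> ball z0 e \<and> J x \<noteq> 0 \<and> N x \<noteq> 0"
    and "(\<lambda>x. complex_of_real ((N x)\<^sup>2 / (J x)\<^sup>2 - 1)) \<in> O[F](\<lambda>x. x - z0)"
proof -
  \<comment> \<open>For t below the second bound, K t \<le> c / 2, so |J| keeps half of the lower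
    bound of |N|. Writing K + 1 keeps the denominator positive when K = 0.\<close>
  define e' where "e' = min (min 1 e) (c / (2 * (K + 1)))"
  have e': "e' > 0" using close lower by (simp add: e'_def)
  have "\<forall>\<^sub>F x in at z0. x \<noteq> z0 \<and> dist x z0 < e'"
    unfolding eventually_at using e' by blast
  then have "\<forall>\<^sub>F x in F. x \<noteq> z0 \<and> dist x z0 < e'"
    using F unfolding filterlim_iff by blast
  with lower(1) have ev: "\<forall>\<^sub>F x in F. x \<in> ball z0 e \<and> x \<noteq> z0 \<and> norm (x - z0) \<le> 1 \<and>
      c * norm (x - z0) \<le> \<bar>N x\<bar> \<and> c / 2 * norm (x - z0) \<le> \<bar>J x\<bar> \<and> \<bar>J x - N x\<bar> \<le> K * (norm (x - z0))\<^sup>2"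
  proof eventually_elim
    case (elim x)
    define t where "t = norm (x - z0)"
    have t: "0 < t" "t < e'" using elim by (auto simp: t_def dist_norm)
    have "t < c / (2 * (K + 1))" using t by (simp add: e'_def)
    then have "t * (2 * (K + 1)) < c" using close(3) by (simp add: less_divide_eq)
    then have "K * t \<le> c / 2" using t close(3) by (simp add: algebra_simps)
    then have "K * t * t \<le> c / 2 * t" using t by (intro mult_right_mono) auto
    moreover have x: "x \<in> ball z0 e" using t by (simp add: t_def dist_norm norm_minus_commute e'_def)
    moreover have "\<bar>J x - N x\<bar> \<le> K * t\<^sup>2" using close(1)[OF x] by (simp add: t_def)
    moreover have Nt: "c * t \<le> \<bar>N x\<bar>" using elim(1) by (simp add: t_def)
    moreover have "K * t\<^sup>2 = K * t * t" "c * t = c / 2 * t + c / 2 * t" by (simp_all add: power2_eq_square)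
    ultimately have "c / 2 * t \<le> \<bar>J x\<bar>" by linarith
    moreover have "t \<le> 1" using t by (simp add: e'_def)
    ultimately show ?case using elim(2) x Nt close(1)[OF x] unfolding t_def by blast
  qed
  then show "\<forall>\<^sub>F x in F. x \<in> ball z0 e \<and> J x \<noteq> 0 \<and> N x \<noteq> 0"
  proof eventually_elim
    case (elim x)
    then have "0 < c * norm (x - z0)" "0 < c / 2 * norm (x - z0)" using lower(2) by simp_all
    then show ?case using elim by linarith
  qed
  show "(\<lambda>x. complex_of_real ((N x)\<^sup>2 / (J x)\<^sup>2 - 1)) \<in> O[F](\<lambda>x. x - z0)"
  proof (rule bigoI)
    show "\<forall>\<^sub>F x in F. norm (complex_of_real ((N x)\<^sup>2 / (J x)\<^sup>2 - 1)) \<le> (K * (2 * M + K) / (c / 2)\<^sup>2) * norm (x - z0)"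
      using ev
    proof eventually_elim
      case (elim x)
      define t where "t = norm (x - z0)"
      have t: "0 < t" "t \<le> 1" using elim by (auto simp: t_def)
      have J: "c / 2 * t \<le> \<bar>J x\<bar>" "0 < c / 2 * t" using elim lower(2) t by (auto simp: t_def)
      have JN: "\<bar>J x - N x\<bar> \<le> K * t\<^sup>2" using elim by (simp add: t_def)
      have "K * t\<^sup>2 \<le> K * t" using t close(3) by (intro mult_left_mono) (auto simp: power2_eq_square)
      then have sum: "\<bar>N x + J x\<bar> \<le> (2 * M + K) * t" using JN upper[of x] by (simp add: t_def algebra_simps)
      have J2: "(c / 2 * t)\<^sup>2 \<le> (J x)\<^sup>2" using power_mono[OF J(1), of 2] J(2) by simp
      have J20: "0 < (c / 2 * t)\<^sup>2" using J(2) by (rule zero_less_power)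
      have "(N x)\<^sup>2 / (J x)\<^sup>2 - 1 = (N x - J x) * (N x + J x) / (J x)\<^sup>2"
        using J by (auto simp: field_simps power2_eq_square)
      then have "\<bar>(N x)\<^sup>2 / (J x)\<^sup>2 - 1\<bar> = \<bar>J x - N x\<bar> * \<bar>N x + J x\<bar> / (J x)\<^sup>2"
        by (simp add: abs_mult abs_minus_commute)
      also have "\<dots> \<le> (K * t\<^sup>2) * ((2 * M + K) * t) / (c / 2 * t)\<^sup>2"
      proof (rule frac_le[OF _ _ J20 J2])
        have "0 \<le> (2 * M + K) * t" using sum by linarith
        moreover have "0 \<le> K * t\<^sup>2" using close(3) by simp
        ultimately show "0 \<le> K * t\<^sup>2 * ((2 * M + K) * t)" by (simp only: mult_nonneg_nonneg)
        show "\<bar>J x - N x\<bar> * \<bar>N x + J x\<bar> \<le> K * t\<^sup>2 * ((2 * M + K) * t)"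
          by (rule mult_mono[OF JN sum \<open>0 \<le> K * t\<^sup>2\<close>]) simp
      qed
      also have "K * t\<^sup>2 * (a * t) / (b * t)\<^sup>2 = K * a / b\<^sup>2 * t" for a b
        using t by (simp add: power_mult_distrib)
      finally show ?case by (simp only: norm_of_real t_def)
    qed
  qed
qed

text \<open>Since S' = A / cnj A, the expression under the square is - 2 i N / cnj A with N = Im (A
  (x - z0)). As |A| = |W| on the curve, - 4 S' over its square is |W|^2 / N^2, and the factor 1 + E
  is N^2 / J^2.\<close>

lemma schwarz_asymptotics:
  assumes v: "v1 holomorphic_on ball z0 r" "v2 holomorphic_on ball z0 r" "r > 0"
    and W: "wronskian v1 v2 z0 = W" "W \<noteq> 0"
    and J: "\<And>x. x \<in> ball z0 r \<Longrightarrow> J x = Im (v1 x * cnj (v2 x))" and JC: "\<And>x. x \<in> C \<Longrightarrow> J x = 0"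
    and C: "simple_closed_analytic_curve C" "z0 \<in> C" and S: "schwarz_function S C"
    and nt: "\<not> tangent_to v C z0" and F: "approaches_along F z0 v"
  shows "\<exists>E. E \<in> O[F](\<lambda>x. x - z0) \<and> (\<forall>\<^sub>F x in F. x \<in> ball z0 r \<and> J x \<noteq> 0 \<and>
     complex_of_real ((cmod W)\<^sup>2 / (J x)\<^sup>2) = - (4 * deriv S z0 / (cnj x - cnj z0 - deriv S z0 * (x - z0))\<^sup>2) * (1 + E x))"
proof -
  define A where "A = deriv v1 z0 * cnj (v2 z0) - cnj (v1 z0) * deriv v2 z0"
  have z0B: "z0 \<in> ball z0 r" using v by simp
  have J0: "Im (v1 z0 * cnj (v2 z0)) = 0" using J[OF z0B] JC[OF C(2)] by simp
  have AW: "cmod A = cmod W"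
  proof -
    have "v1 z0 * cnj (v2 z0) - cnj (v1 z0) * v2 z0 = 0" using J0 by (simp add: complex_eq_iff)
    \<comment> \<open>The difference contains the factor 2 i J, which vanishes at
      \<open>z0\<close>.\<close>
    moreover have "A * cnj A - W * cnj W = (v1 z0 * cnj (v2 z0) - cnj (v1 z0) * v2 z0)
        * (deriv v2 z0 * cnj (deriv v1 z0) - deriv v1 z0 * cnj (deriv v2 z0))"
      unfolding A_def W(1)[symmetric] wronskian_def by (simp add: algebra_simps)
    ultimately have "A * cnj A = W * cnj W" by simp
    then have "of_real ((cmod A)\<^sup>2) = (of_real ((cmod W)\<^sup>2) :: complex)" by (simp only: complex_norm_square)
    then have "(cmod A)\<^sup>2 = (cmod W)\<^sup>2" by (simp only: of_real_eq_iff)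
    then show ?thesis by simp
  qed
  have A0: "A \<noteq> 0" using AW W(2) by auto
  have JC': "Im (v1 x * cnj (v2 x)) = 0" if "x \<in> C" "x \<in> ball z0 r" for x using J[OF that(2)] JC[OF that(1)] by simp
  have sch1: "A = cnj A * deriv S z0"
    unfolding A_def by (rule schwarz_derivative_at_real_locus(1)[OF v _ C S]) (rule JC')
  have sch2: "Im (A * v) \<noteq> 0"
    unfolding A_def by (rule schwarz_derivative_at_real_locus(2)[OF v _ C S _ nt]) (use JC' A0 in \<open>auto simp: A_def\<close>)
  define N where "N = (\<lambda>x. Im (A * (x - z0)))"
  obtain K e where K: "0 < e" "e < r" "0 \<le> K"
     "\<And>x. x \<in> ball z0 e \<Longrightarrow> \<bar>Im (v1 x * cnj (v2 x)) - Im (A * (x - z0))\<bar> \<le> K * (norm (x - z0))\<^sup>2"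
    using hermitian_second_order_remainder[OF v J0, folded A_def] by blast
  have close: "\<bar>J x - N x\<bar> \<le> K * (norm (x - z0))\<^sup>2" if "x \<in> ball z0 e" for x
    using K(4)[OF that] J[of x] that K(2) by (simp add: N_def)
  have upper: "\<bar>N x\<bar> \<le> cmod A * norm (x - z0)" for x
    unfolding N_def using abs_Im_le_cmod[of "A * (x - z0)"] by (simp add: norm_mult)
  \<comment> \<open>Half of the limit of |N| / |x - z0| along the direction v, hence eventually a
    lower bound.\<close>
  define c where "c = \<bar>Im (A * v)\<bar> / 2"
  have c: "c > 0" using sch2 by (simp add: c_def)
  have Fl: "filterlim (\<lambda>x. x) (at z0) F" "((\<lambda>x. sgn (x - z0)) \<longlongrightarrow> v) F"
    using F by (auto simp: approaches_along_def)
  have "((\<lambda>x. \<bar>Im (A * sgn (x - z0))\<bar>) \<longlongrightarrow> \<bar>Im (A * v)\<bar>) F" by (intro tendsto_intros Fl)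
  moreover have "c < \<bar>Im (A * v)\<bar>" using c by (simp add: c_def)
  ultimately have "\<forall>\<^sub>F x in F. c < \<bar>Im (A * sgn (x - z0))\<bar>" by (rule order_tendstoD(1))
  then have lower: "\<forall>\<^sub>F x in F. c * norm (x - z0) \<le> \<bar>N x\<bar>"
  proof eventually_elim
    case (elim x)
    have "A * (x - z0) = of_real (norm (x - z0)) * (A * sgn (x - z0))"
      by (cases "x = z0") (simp_all add: sgn_div_norm scaleR_conv_of_real)
    then have "\<bar>N x\<bar> = norm (x - z0) * \<bar>Im (A * sgn (x - z0))\<bar>"
      unfolding N_def by (simp only: Im_complex_of_real Re_complex_of_real times_complex.sel mult_zero_left add_0_right abs_mult abs_norm_cancel)
    then show ?case using elim mult_left_mono[of c "\<bar>Im (A * sgn (x - z0))\<bar>" "norm (x - z0)"] by (simp add: mult.commute)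
  qed
  have big1: "\<forall>\<^sub>F x in F. x \<in> ball z0 e \<and> J x \<noteq> 0 \<and> N x \<noteq> 0"
    by (rule bigo_square_ratio(1)[OF Fl(1) lower c upper _ K(1,3)]) (rule close)
  define E where "E = (\<lambda>x. complex_of_real ((N x)\<^sup>2 / (J x)\<^sup>2 - 1))"
  have "E \<in> O[F](\<lambda>x. x - z0)" unfolding E_def
    by (rule bigo_square_ratio(2)[OF Fl(1) lower c upper _ K(1,3)]) (rule close)
  moreover from big1 have "\<forall>\<^sub>F x in F. x \<in> ball z0 r \<and> J x \<noteq> 0 \<and>
     complex_of_real ((cmod W)\<^sup>2 / (J x)\<^sup>2) = - (4 * deriv S z0 / (cnj x - cnj z0 - deriv S z0 * (x - z0))\<^sup>2) * (1 + E x)"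
  proof eventually_elim
    case (elim x)
    have cA: "cnj A \<noteq> 0" using A0 by simp
    have S': "deriv S z0 = A / cnj A" using sch1 cA by (metis nonzero_mult_div_cancel_left)
    have "cnj A * (cnj x - cnj z0) - A * (x - z0) = cnj (A * (x - z0)) - A * (x - z0)" by simp
    then have "cnj A * (cnj x - cnj z0) - A * (x - z0) = - (2 * \<i> * of_real (N x))" by (simp add: N_def complex_eq_iff algebra_simps)
    moreover have "(cnj x - cnj z0 - deriv S z0 * (x - z0)) * cnj A = cnj A * (cnj x - cnj z0) - A * (x - z0)"
    proof -
      have 1: "A / cnj A * (x - z0) * cnj A = A * (x - z0)" using cA by simp
      show ?thesis unfolding S' left_diff_distrib[of "cnj x - cnj z0"] 1 by (simp only: mult.commute)
    qed
    ultimately have "(cnj x - cnj z0 - deriv S z0 * (x - z0)) * cnj A = - (2 * \<i> * of_real (N x))" by (simp only:)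
    then have den: "cnj x - cnj z0 - deriv S z0 * (x - z0) = - (2 * \<i> * of_real (N x)) / cnj A"
      by (rule nonzero_eq_divide_eq[OF cA, THEN iffD2])
    have sq: "(cnj x - cnj z0 - deriv S z0 * (x - z0))\<^sup>2 = - 4 * of_real ((N x)\<^sup>2) / (cnj A)\<^sup>2"
      unfolding den by (simp add: power_divide power_mult_distrib)
    have AA: "A * cnj A = of_real ((cmod W)\<^sup>2)" unfolding AW[symmetric] by (rule complex_norm_square[symmetric])
    have N0: "complex_of_real ((N x)\<^sup>2) \<noteq> 0" using elim by simp
    have "- (4 * deriv S z0 / (cnj x - cnj z0 - deriv S z0 * (x - z0))\<^sup>2) = (A * cnj A) / of_real ((N x)\<^sup>2)"
      unfolding sq unfolding S' using cA N0 by (simp add: field_simps power2_eq_square)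
    then have 1: "- (4 * deriv S z0 / (cnj x - cnj z0 - deriv S z0 * (x - z0))\<^sup>2) = of_real ((cmod W)\<^sup>2 / (N x)\<^sup>2)"
      unfolding AA by (simp only: of_real_divide)
    have "1 + E x = of_real ((N x)\<^sup>2 / (J x)\<^sup>2)" by (simp add: E_def)
    then have "- (4 * deriv S z0 / (cnj x - cnj z0 - deriv S z0 * (x - z0))\<^sup>2) * (1 + E x)
       = of_real ((cmod W)\<^sup>2 / (N x)\<^sup>2 * ((N x)\<^sup>2 / (J x)\<^sup>2))" unfolding 1 by (simp only: of_real_mult)
    also have "(cmod W)\<^sup>2 / (N x)\<^sup>2 * ((N x)\<^sup>2 / (J x)\<^sup>2) = (cmod W)\<^sup>2 / (J x)\<^sup>2" using elim by simp
    finally show ?case using elim K(2) by simp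
  qed
  ultimately show ?thesis by blast
qed

section \<open>Proof of the theorem\<close>

context real_solution_pair
begin

lemma continuous_on_hermitian_form: "continuous_on X hermitian_form"
proof (rule continuous_at_imp_continuous_on, rule ballI)
  fix w assume w: "w \<in> X"
  obtain \<rho> v1 v2 where \<rho>: "\<rho> > 0" "v1 holomorphic_on ball w \<rho>" "v2 holomorphic_on ball w \<rho>"
    and J: "\<And>x. x \<in> ball w \<rho> \<Longrightarrow> hermitian_form x = Im (v1 x * cnj (v2 x))"
    using hermitian_form_local[OF w] by metis
  have "continuous_on (ball w \<rho>) (\<lambda>x. Im (v1 x * cnj (v2 x)))"
    by (intro continuous_intros holomorphic_on_imp_continuous_on \<rho>)
  then have "continuous_on (ball w \<rho>) hermitian_form"
    by (rule continuous_on_cong[THEN iffD1, rotated -1]) (auto simp: J)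
  then show "isCont hermitian_form w" using \<rho>(1) by (simp add: continuous_on_eq_continuous_at)
qed

text \<open>Im (v1 / v2) = J / |v2|^2 has the sign of J, and the derivative of v1 / v2 is - W /
  v2^2.\<close>

lemma quotient_chart:
  assumes v: "v1 holomorphic_on ball w r" "v2 holomorphic_on ball w r" "r > 0" and nz: "v2 w \<noteq> 0"
    and Wr: "wronskian v1 v2 w = W" and J: "\<And>x. x \<in> ball w r \<Longrightarrow> hermitian_form x = Im (v1 x * cnj (v2 x))"
    and X: "ball w r \<subseteq> X"
  shows "\<exists>U f. open U \<and> w \<in> U \<and> f holomorphic_on U \<and> deriv f w \<noteq> 0 \<and>
     (\<forall>x\<in>U. (x \<in> {x \<in> X. hermitian_form x = 0} \<longleftrightarrow> Im (f x) = 0) \<and>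
            (x \<in> {x \<in> X. hermitian_form x > 0} \<longleftrightarrow> Im (f x) > 0))"
proof (intro exI conjI ballI)
  let ?U = "ball w r \<inter> v2 -` (- {0})" and ?f = "\<lambda>x. v1 x / v2 x"
  show "open ?U" using v(2) by (intro continuous_open_preimage holomorphic_on_imp_continuous_on) auto
  show "w \<in> ?U" using v(3) nz by simp
  show "?f holomorphic_on ?U" using v by (intro holomorphic_intros) (auto intro: holomorphic_on_subset)
  have d: "(v1 has_field_derivative deriv v1 w) (at w)" "(v2 has_field_derivative deriv v2 w) (at w)"
    using holomorphic_derivI[OF v(1) open_ball] holomorphic_derivI[OF v(2) open_ball] v(3) by simp_all
  have "deriv ?f w = (deriv v1 w * v2 w - v1 w * deriv v2 w) / (v2 w * v2 w)"
    by (rule DERIV_imp_deriv[OF DERIV_divide[OF d nz]])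
  also have "\<dots> = - W / (v2 w * v2 w)" unfolding Wr[symmetric] wronskian_def by simp
  finally show "deriv ?f w \<noteq> 0" using W_nonzero nz by simp
  fix x assume x: "x \<in> ?U"
  then have xX: "x \<in> X" and v2x: "v2 x \<noteq> 0" using X by auto
  have "v1 x / v2 x = v1 x * cnj (v2 x) / of_real ((cmod (v2 x))\<^sup>2)"
    unfolding complex_norm_square using v2x by simp
  then have "Im (v1 x / v2 x) = hermitian_form x / (cmod (v2 x))\<^sup>2"
    using J[of x] x by (simp only: Im_divide_of_real IntD1)
  moreover have "(cmod (v2 x))\<^sup>2 > 0" using v2x by simp
  ultimately show "x \<in> {x \<in> X. hermitian_form x = 0} \<longleftrightarrow> Im (?f x) = 0"
     "x \<in> {x \<in> X. hermitian_form x > 0} \<longleftrightarrow> Im (?f x) > 0"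
    using xX v2x by (simp_all add: zero_less_divide_iff)
qed

text \<open>At a zero of \<open>v2\<close> the pair (- v2, v1) takes over: it has the same Wronskian
  and the same form, and \<open>v1\<close> does not vanish there.\<close>

lemma real_locus_chart:
  assumes w: "w \<in> X"
  shows "\<exists>U f. open U \<and> w \<in> U \<and> f holomorphic_on U \<and> deriv f w \<noteq> 0 \<and>
     (\<forall>x\<in>U. (x \<in> {x \<in> X. hermitian_form x = 0} \<longleftrightarrow> Im (f x) = 0) \<and>
            (x \<in> {x \<in> X. hermitian_form x > 0} \<longleftrightarrow> Im (f x) > 0))"
proof -
  obtain \<rho> v1 v2 where \<rho>: "\<rho> > 0" "ball w \<rho> \<subseteq> X" and v: "v1 holomorphic_on ball w \<rho>" "v2 holomorphic_on ball w \<rho>"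
    and Wr: "\<And>x. x \<in> ball w \<rho> \<Longrightarrow> wronskian v1 v2 x = W"
    and J: "\<And>x. x \<in> ball w \<rho> \<Longrightarrow> hermitian_form x = Im (v1 x * cnj (v2 x))"
    using hermitian_form_local[OF w] by blast
  have Ww: "wronskian v1 v2 w = W" using Wr \<rho>(1) by simp
  show ?thesis
  proof (cases "v2 w = 0")
    case False
    then show ?thesis by (rule quotient_chart[OF v \<rho>(1) _ Ww J \<rho>(2)])
  next
    case True
    then have v1w: "v1 w \<noteq> 0" using Ww W_nonzero by (auto simp: wronskian_def)
    have d: "deriv (\<lambda>x. - v2 x) w = - deriv v2 w"
      using holomorphic_derivI[OF v(2) open_ball] \<rho>(1) by (auto intro!: DERIV_imp_deriv derivative_intros)
    show ?thesis
    proof (rule quotient_chart[OF _ v(1) \<rho>(1) v1w _ _ \<rho>(2)])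
      show "(\<lambda>x. - v2 x) holomorphic_on ball w \<rho>" using v(2) by (intro holomorphic_intros)
      show "wronskian (\<lambda>x. - v2 x) v1 w = W" using Ww by (simp add: wronskian_def d algebra_simps)
      show "hermitian_form x = Im (- v2 x * cnj (v1 x))" if "x \<in> ball w \<rho>" for x
        using J[OF that] by (simp add: algebra_simps)
    qed
  qed
qed

lemma liouville_equation_phi:
  fixes \<phi> defines "\<phi> \<equiv> phi (ratio_branches X p u1 u2)"
  assumes w: "w \<in> X" "hermitian_form w \<noteq> 0"
  shows "(\<lambda>x. complex_of_real (\<phi> x)) differentiable (at w)"
    and "wirtinger_bar (\<lambda>x. complex_of_real (\<phi> x)) differentiable (at w)"
    and "wirtinger (wirtinger_bar (\<lambda>x. complex_of_real (\<phi> x))) w = 1 / 2 * complex_of_real (exp (\<phi> w))"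
proof -
  obtain \<rho> v1 v2 where \<rho>: "\<rho> > 0" "ball w \<rho> \<subseteq> X" and v: "v1 holomorphic_on ball w \<rho>" "v2 holomorphic_on ball w \<rho>"
    and Wr: "\<And>x. x \<in> ball w \<rho> \<Longrightarrow> wronskian v1 v2 x = W"
    and J: "\<And>x. x \<in> ball w \<rho> \<Longrightarrow> hermitian_form x = Im (v1 x * cnj (v2 x))"
    using hermitian_form_local[OF w(1)] by blast
  define U where "U = ball w \<rho> \<inter> hermitian_form -` (- {0})"
  have U: "open U" "w \<in> U"
    unfolding U_def using w \<rho> continuous_on_subset[OF continuous_on_hermitian_form \<rho>(2)]
    by (auto intro!: continuous_open_preimage)
  have vU: "v1 holomorphic_on U" "v2 holomorphic_on U" using v by (auto simp: U_def intro: holomorphic_on_subset)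
  have U': "x \<in> ball w \<rho>" "hermitian_form x \<noteq> 0" "x \<in> X" if "x \<in> U" for x using that \<rho>(2) by (auto simp: U_def)
  have \<phi>: "\<phi> x = ln ((cmod W)\<^sup>2 / (hermitian_form x)\<^sup>2)" if "x \<in> U" for x
    unfolding \<phi>_def using U'[OF that] by (intro phi_eq(2))
  note l = liouville_equation_hermitian[OF U vU Wr[OF U'(1)] W_nonzero J[OF U'(1)] U'(2) \<phi>]
  show "(\<lambda>x. complex_of_real (\<phi> x)) differentiable (at w)"
    "wirtinger_bar (\<lambda>x. complex_of_real (\<phi> x)) differentiable (at w)"
    "wirtinger (wirtinger_bar (\<lambda>x. complex_of_real (\<phi> x))) w = 1 / 2 * complex_of_real (exp (\<phi> w))"
    by (rule l; assumption)+
qed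

lemma phi_schwarz_asymptotics:
  fixes \<phi> defines "\<phi> \<equiv> phi (ratio_branches X p u1 u2)"
  assumes C: "simple_closed_analytic_curve C" "C \<subseteq> {x \<in> X. hermitian_form x = 0}" "z0 \<in> C"
    and S: "schwarz_function S C"
    and nt: "\<not> tangent_to v C z0" and F: "approaches_along F z0 v"
  shows "\<exists>E. E \<in> O[F](\<lambda>x. x - z0) \<and> (\<forall>\<^sub>F x in F. x \<in> X \<and> hermitian_form x \<noteq> 0 \<and>
     complex_of_real (exp (\<phi> x)) = - (4 * deriv S z0 / (cnj x - cnj z0 - deriv S z0 * (x - z0))\<^sup>2) * (1 + E x))"
proof -
  have z0X: "z0 \<in> X" using C by auto
  obtain \<rho> v1 v2 where \<rho>: "\<rho> > 0" "ball z0 \<rho> \<subseteq> X" and v: "v1 holomorphic_on ball z0 \<rho>" "v2 holomorphic_on ball z0 \<rho>"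
    and Wr: "\<And>x. x \<in> ball z0 \<rho> \<Longrightarrow> wronskian v1 v2 x = W"
    and J: "\<And>x. x \<in> ball z0 \<rho> \<Longrightarrow> hermitian_form x = Im (v1 x * cnj (v2 x))"
    using hermitian_form_local[OF z0X] by blast
  have W0: "wronskian v1 v2 z0 = W" using Wr \<rho>(1) by simp
  have JC: "hermitian_form x = 0" if "x \<in> C" for x using C(2) that by auto
  obtain E where E: "E \<in> O[F](\<lambda>x. x - z0)" and ev: "\<forall>\<^sub>F x in F. x \<in> ball z0 \<rho> \<and> hermitian_form x \<noteq> 0 \<and>
     complex_of_real ((cmod W)\<^sup>2 / (hermitian_form x)\<^sup>2) = - (4 * deriv S z0 / (cnj x - cnj z0 - deriv S z0 * (x - z0))\<^sup>2) * (1 + E x)"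
    using schwarz_asymptotics[OF v \<rho>(1) W0 W_nonzero J JC C(1,3) S nt F] by blast
  have "\<forall>\<^sub>F x in F. x \<in> X \<and> hermitian_form x \<noteq> 0 \<and>
     complex_of_real (exp (\<phi> x)) = - (4 * deriv S z0 / (cnj x - cnj z0 - deriv S z0 * (x - z0))\<^sup>2) * (1 + E x)"
    using ev
  proof eventually_elim
    case (elim x)
    then have xX: "x \<in> X" using \<rho>(2) by blast
    have "exp (\<phi> x) = (cmod W)\<^sup>2 / (hermitian_form x)\<^sup>2"
      unfolding \<phi>_def using elim xX by (intro phi_eq(3)) auto
    then show ?case using elim xX by simp
  qed
  then show ?thesis using E by blast
qed

end

section \<open>The given equation at its punctures\<close>

definition potential :: "nat \<Rightarrow> (nat \<Rightarrow> complex) \<Rightarrow> (nat \<Rightarrow> complex) \<Rightarrow> complex \<Rightarrow> complex" where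
  "potential n z c w = 1 / 2 * (\<Sum>i = 1..n - 1. 1 / (2 * (w - z i)\<^sup>2) + c i / (w - z i))"

lemma punctured_plane_open_connected:
  "open (punctured_plane n z)" "connected (punctured_plane n z)"
proof -
  have fin: "finite (z ` {1..n - 1})" by simp
  then show "open (punctured_plane n z)" unfolding punctured_plane_def by (intro open_Diff) (auto intro: finite_imp_closed)
  show "connected (punctured_plane n z)" unfolding punctured_plane_def
    using fin by (intro connected_open_delete_finite) auto
qed

lemma potential_holomorphic: "potential n z c holomorphic_on punctured_plane n z"
  unfolding potential_def[abs_def] punctured_plane_def by (intro holomorphic_intros) auto

text \<open>Independence is given for germs, and W \<noteq> 0 must be derived from it. In a local
  basis W is the determinant of the coefficients; if it vanished, \<gamma> u1 = \<alpha> u2 and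
  \<delta> u1 = \<beta> u2 would force all coefficients of u1 to be 0.\<close>

lemma solution_basis_imp_solution_pair:
  assumes b: "solution_basis n z c p u1 u2"
  shows "\<exists>W. solution_pair (punctured_plane n z) (potential n z c) p u1 u2 W"
proof -
  let ?X = "punctured_plane n z" and ?q = "potential n z c"
  obtain U1 where U1: "open U1" "p \<in> U1" "U1 \<subseteq> ?X" "solves_on ?q U1 u1"
    using b unfolding solution_basis_def solution_near_def solves_on_def potential_def by blast
  obtain U2 where U2: "open U2" "p \<in> U2" "U2 \<subseteq> ?X" "solves_on ?q U2 u2"
    using b unfolding solution_basis_def solution_near_def solves_on_def potential_def by blast
  have pX: "p \<in> ?X" using U1 by blast
  obtain \<rho>0 e1 e2 where e: "\<rho>0 > 0" "ball p \<rho>0 \<subseteq> ?X" "solves_on ?q (ball p \<rho>0) e1" "solves_on ?q (ball p \<rho>0) e2"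
    "\<And>x. x \<in> ball p \<rho>0 \<Longrightarrow> wronskian e1 e2 x = 1"
    using solves_on_local_basis[OF punctured_plane_open_connected(1) potential_holomorphic pX] by metis
  have "open (U1 \<inter> U2 \<inter> ball p \<rho>0)" "p \<in> U1 \<inter> U2 \<inter> ball p \<rho>0" using U1 U2 e by auto
  then obtain \<rho> where \<rho>: "\<rho> > 0" "ball p \<rho> \<subseteq> U1 \<inter> U2 \<inter> ball p \<rho>0" by (meson open_contains_ball)
  define B where "B = ball p \<rho>"
  have B: "open B" "connected B" "p \<in> B" "B \<subseteq> U1" "B \<subseteq> U2" "B \<subseteq> ball p \<rho>0" using \<rho> by (auto simp: B_def)
  note u = solves_on_subset[OF U1(4) B(4)] solves_on_subset[OF U2(4) B(5)]
  note e' = solves_on_subset[OF e(3) B(6)] solves_on_subset[OF e(4) B(6)]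
  have e1: "wronskian e1 e2 p = 1" using e(5) B by blast
  then have ne: "wronskian e1 e2 p \<noteq> 0" by simp
  obtain \<alpha> \<beta> where 1: "\<And>x. x \<in> B \<Longrightarrow> u1 x = \<alpha> * e1 x + \<beta> * e2 x"
    by (rule solves_on_combination[OF B(1,2) u(1) e' B(3) ne]) blast
  obtain \<gamma> \<delta> where 2: "\<And>x. x \<in> B \<Longrightarrow> u2 x = \<gamma> * e1 x + \<delta> * e2 x"
    by (rule solves_on_combination[OF B(1,2) u(2) e' B(3) ne]) blast
  have evB: "\<forall>\<^sub>F x in nhds p. x \<in> B" using B(1,3) by (rule eventually_nhds_in_open)
  have indep: "a = 0 \<and> b = 0" if "\<And>x. x \<in> B \<Longrightarrow> a * u1 x + b * u2 x = 0" for a b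
  proof -
    have "\<forall>\<^sub>F x in nhds p. a * u1 x + b * u2 x = 0" using evB by eventually_elim (rule that)
    then show ?thesis using b unfolding solution_basis_def by blast
  qed
  define W where "W = wronskian u1 u2 p"
  have "W = wronskian (\<lambda>x. \<alpha> * e1 x + \<beta> * e2 x) (\<lambda>x. \<gamma> * e1 x + \<delta> * e2 x) p"
    unfolding W_def by (rule wronskian_cong; rule eventually_mono[OF evB]) (use 1 2 in auto)
  then have W: "W = \<alpha> * \<delta> - \<beta> * \<gamma>" using solves_on_lincomb(2)[OF B(1) e' B(3)] e1 by simp
  have "W \<noteq> 0"
  proof
    assume W0: "W = 0"
    have "\<gamma> * u1 x + (- \<alpha>) * u2 x = 0" if "x \<in> B" for x
    proof -
      have "\<gamma> * u1 x + (- \<alpha>) * u2 x = - W * e2 x" unfolding 1[OF that] 2[OF that] W by (simp add: algebra_simps)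
      then show ?thesis using W0 by simp
    qed
    from indep[OF this] have 3: "\<gamma> = 0" "\<alpha> = 0" by auto
    have "\<delta> * u1 x + (- \<beta>) * u2 x = 0" if "x \<in> B" for x
    proof -
      have "\<delta> * u1 x + (- \<beta>) * u2 x = W * e1 x" unfolding 1[OF that] 2[OF that] W by (simp add: algebra_simps)
      then show ?thesis using W0 by simp
    qed
    from indep[OF this] have "\<beta> = 0" by auto
    then have "1 * u1 x + 0 * u2 x = 0" if "x \<in> B" for x using 1[OF that] 3 by simp
    from indep[OF this] show False by simp
  qed
  moreover have "wronskian u1 u2 x = W" if "x \<in> ball p \<rho>" for x
    unfolding W_def using wronskian_const[OF B(1,2) u _ B(3)] that by (simp add: B_def)
  ultimately have "solution_pair ?X ?q p u1 u2 W"
    using \<rho>(1) B(4) U1(3) u punctured_plane_open_connected potential_holomorphic unfolding B_def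
    by unfold_locales blast+
  then show ?thesis by blast
qed

text \<open>Multiplied by y^2 with y = w - z_i, the double pole contributes 1/2 times 1/2 and all
  other terms vanish at y = 0.\<close>

lemma potential_at_finite_puncture:
  assumes inj: "inj_on z {1..n - 1}" and i: "i \<in> {1..n - 1}"
  shows "\<exists>R \<rho>. R holomorphic_on ball 0 \<rho> \<and> \<rho> > 0 \<and> R 0 = 0 \<and>
    (\<forall>s. Re s < ln \<rho> \<longrightarrow> z i + exp (1 * s) \<in> punctured_plane n z \<and>
        potential n z c (z i + exp (1 * s)) * exp (2 * 1 * s) = 1 / 4 - R (exp s))"
proof -
  define I where "I = {1..n - 1} - {i}"
  have I: "finite I" "{1..n - 1} = insert i I" "i \<notin> I" using i by (auto simp: I_def)
  have "finite (z ` I)" using I by simp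
  then obtain \<rho> where \<rho>: "\<rho> > 0" "\<And>x. x \<in> z ` I \<Longrightarrow> x \<noteq> z i \<Longrightarrow> \<rho> \<le> dist (z i) x"
    using finite_set_avoid by metis
  have nz: "y + z i - z j \<noteq> 0" if "j \<in> I" "y \<in> ball 0 \<rho>" for y j
  proof
    assume "y + z i - z j = 0"
    then have "y = z j - z i" by (simp add: algebra_simps)
    then have "norm y = dist (z i) (z j)" by (simp add: dist_norm norm_minus_commute)
    moreover have "z j \<noteq> z i" using inj_onD[OF inj, of j i] that(1) i by (auto simp: I_def)
    ultimately show False using \<rho>(2)[of "z j"] that by auto
  qed
  define R where "R = (\<lambda>y. - (1 / 2) * (c i * y + (\<Sum>j\<in>I. y\<^sup>2 / (2 * (y + z i - z j)\<^sup>2) + c j * y\<^sup>2 / (y + z i - z j))))"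
  have "R holomorphic_on ball 0 \<rho>" unfolding R_def using nz by (intro holomorphic_intros) auto
  moreover have "R 0 = 0" by (simp add: R_def)
  moreover have "z i + exp (1 * s) \<in> punctured_plane n z"
     "potential n z c (z i + exp (1 * s)) * exp (2 * 1 * s) = 1 / 4 - R (exp s)" if s: "Re s < ln \<rho>" for s
  proof -
    define y where "y = exp s"
    have y: "y \<in> ball 0 \<rho>" "y \<noteq> 0" using s \<rho>(1) exp_less_mono[of "Re s" "ln \<rho>"] by (simp_all add: y_def)
    show "z i + exp (1 * s) \<in> punctured_plane n z"
      unfolding punctured_plane_def I(2) using y nz[OF _ y(1)] by (auto simp: y_def[symmetric] algebra_simps)
    have y2: "exp (2 * 1 * s) = y\<^sup>2" by (simp add: y_def exp_double)
    have "potential n z c (z i + y) * y\<^sup>2 = 1 / 2 * (\<Sum>j\<in>insert i I. y\<^sup>2 * (1 / (2 * (z i + y - z j)\<^sup>2) + c j / (z i + y - z j)))"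
      unfolding potential_def I(2) by (simp only: sum_distrib_left sum_distrib_right mult_ac)
    also have "(\<Sum>j\<in>insert i I. y\<^sup>2 * (1 / (2 * (z i + y - z j)\<^sup>2) + c j / (z i + y - z j)))
        = y\<^sup>2 * (1 / (2 * y\<^sup>2) + c i / y) + (\<Sum>j\<in>I. y\<^sup>2 * (1 / (2 * (z i + y - z j)\<^sup>2) + c j / (z i + y - z j)))"
      using I(1,3) by simp
    also have "y\<^sup>2 * (1 / (2 * y\<^sup>2) + c i / y) = 1 / 2 + c i * y" using y(2) by (simp add: field_simps power2_eq_square)
    also have "(\<Sum>j\<in>I. y\<^sup>2 * (1 / (2 * (z i + y - z j)\<^sup>2) + c j / (z i + y - z j)))
        = (\<Sum>j\<in>I. y\<^sup>2 / (2 * (y + z i - z j)\<^sup>2) + c j * y\<^sup>2 / (y + z i - z j))"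
      by (intro sum.cong refl) (simp add: distrib_left add.commute mult.commute)
    also have "1 / 2 * (1 / 2 + c i * y + \<dots>) = 1 / 4 - R y" by (simp add: R_def algebra_simps)
    finally show "potential n z c (z i + exp (1 * s)) * exp (2 * 1 * s) = 1 / 4 - R (exp s)"
      unfolding y2 by (simp add: y_def)
  qed
  ultimately show ?thesis using \<rho>(1) by blast
qed

text \<open>With w = 1 / y the condition that the c_i sum to 0 removes a pole at y = 0, and the
  other condition gives the value (1/2) ((n - 1) / 2 + 1 - n / 2) = 1/4. Infinity is thus a puncture
  of the same kind as the z_i.\<close>

lemma potential_at_infinity:
  assumes n: "n \<ge> 3" and c0: "(\<Sum>i = 1..n - 1. c i) = 0" and c1: "(\<Sum>i = 1..n - 1. z i * c i) = 1 - of_nat n / 2"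
  shows "\<exists>R \<rho>. R holomorphic_on ball 0 \<rho> \<and> \<rho> > 0 \<and> R 0 = 0 \<and>
    (\<forall>s. Re s < ln \<rho> \<longrightarrow> 0 + exp ((- 1) * s) \<in> punctured_plane n z \<and>
        potential n z c (0 + exp ((- 1) * s)) * exp (2 * (- 1) * s) = 1 / 4 - R (exp s))"
proof -
  \<comment> \<open>Small enough that |z_j y| < 1 for every j, so 1 - z_j y has no zero.\<close>
  define \<rho> where "\<rho> = 1 / (1 + (\<Sum>j = 1..n - 1. norm (z j)))"
  have pos: "0 < 1 + (\<Sum>j = 1..n - 1. norm (z j))" by (simp add: add_pos_nonneg sum_nonneg)
  then have \<rho>: "\<rho> > 0" by (simp add: \<rho>_def)
  have nz: "1 - z j * y \<noteq> 0" if j: "j \<in> {1..n - 1}" and y: "y \<in> ball 0 \<rho>" for j y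
  proof
    assume "1 - z j * y = 0"
    then have 1: "norm (z j) * norm y = 1" by (metis eq_iff_diff_eq_0 norm_mult norm_one)
    have "norm (z j) \<le> (\<Sum>j = 1..n - 1. norm (z j))" using j by (intro member_le_sum) auto
    then have "norm (z j) * norm y \<le> (1 + (\<Sum>j = 1..n - 1. norm (z j))) * norm y" by (intro mult_right_mono) auto
    also have "\<dots> < 1" using y pos by (simp add: \<rho>_def less_divide_eq mult.commute)
    finally show False using 1 by simp
  qed
  define R where "R = (\<lambda>y. 1 / 4 - 1 / 2 * (\<Sum>j = 1..n - 1. 1 / (2 * (1 - z j * y)\<^sup>2) + c j * z j / (1 - z j * y)))"
  have "R holomorphic_on ball 0 \<rho>" unfolding R_def using nz by (intro holomorphic_intros) auto
  moreover have "R 0 = 0"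
  proof -
    have 1: "(\<Sum>j = 1..n - 1. c j * z j) = 1 - of_nat n / 2" using c1 by (simp add: mult.commute)
    have 2: "(of_nat (n - 1) :: complex) = of_nat n - 1" using n by (simp add: of_nat_diff)
    have "R 0 = 1 / 4 - 1 / 2 * (of_nat (n - 1) * (1 / 2) + (\<Sum>j = 1..n - 1. c j * z j))"
      by (simp add: R_def sum.distrib)
    then show ?thesis unfolding 1 2 by (simp add: field_simps)
  qed
  moreover have "0 + exp ((- 1) * s) \<in> punctured_plane n z"
     "potential n z c (0 + exp ((- 1) * s)) * exp (2 * (- 1) * s) = 1 / 4 - R (exp s)" if s: "Re s < ln \<rho>" for s
  proof -
    define y where "y = exp s"
    have y: "y \<in> ball 0 \<rho>" "y \<noteq> 0" using s \<rho> exp_less_mono[of "Re s" "ln \<rho>"] by (simp_all add: y_def)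
    have E: "0 + exp ((- 1) * s) = 1 / y" "exp (2 * (- 1) * s) = 1 / y\<^sup>2"
      by (simp_all add: y_def exp_minus divide_inverse flip: exp_double)
    show "0 + exp ((- 1) * s) \<in> punctured_plane n z"
      unfolding E punctured_plane_def using y nz[OF _ y(1)] by (auto simp: field_simps)
    have summand: "(1 / (2 * (1 / y - z j)\<^sup>2) + c j / (1 / y - z j)) * (1 / y\<^sup>2)
        = (1 / (2 * (1 - z j * y)\<^sup>2) + c j * z j / (1 - z j * y)) + c j / y" if "j \<in> {1..n - 1}" for j
    proof -
      have d: "1 / y - z j = (1 - z j * y) / y" using y(2) by (simp add: field_simps)
      define t where "t = 1 - z j * y"
      have t: "t \<noteq> 0" "z j = (1 - t) / y" using nz[OF that y(1)] y(2) by (simp_all add: t_def)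
      have "(1 / (2 * (t / y)\<^sup>2) + c j / (t / y)) * (1 / y\<^sup>2) = (1 / (2 * t\<^sup>2) + c j * ((1 - t) / y) / t) + c j / y"
        using t(1) y(2) by (simp add: field_simps power2_eq_square)
      then show ?thesis unfolding d t_def[symmetric] t(2)[symmetric] .
    qed
    have "potential n z c (1 / y) * (1 / y\<^sup>2) = 1 / 2 * (\<Sum>j = 1..n - 1. (1 / (2 * (1 / y - z j)\<^sup>2) + c j / (1 / y - z j)) * (1 / y\<^sup>2))"
      unfolding potential_def by (simp only: sum_distrib_right mult.assoc)
    also have "(\<Sum>j = 1..n - 1. (1 / (2 * (1 / y - z j)\<^sup>2) + c j / (1 / y - z j)) * (1 / y\<^sup>2))
       = (\<Sum>j = 1..n - 1. (1 / (2 * (1 - z j * y)\<^sup>2) + c j * z j / (1 - z j * y)) + c j / y)"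
      by (intro sum.cong refl summand)
    also have "\<dots> = (\<Sum>j = 1..n - 1. 1 / (2 * (1 - z j * y)\<^sup>2) + c j * z j / (1 - z j * y)) + (\<Sum>j = 1..n - 1. c j) / y"
      by (simp only: sum.distrib sum_divide_distrib)
    finally have "potential n z c (1 / y) * (1 / y\<^sup>2) = 1 / 4 - R y"
      unfolding c0 R_def by simp
    then show "potential n z c (0 + exp ((- 1) * s)) * exp (2 * (- 1) * s) = 1 / 4 - R (exp s)"
      unfolding E y_def[symmetric] .
  qed
  ultimately show ?thesis using \<rho> by blast
qed

theorem mainTheorem2:
  fixes n :: nat and z c :: "nat \<Rightarrow> complex" and \<eta> :: multivalued_map
  defines "X \<equiv> punctured_plane n z"
    and "Z \<equiv> preimage_real_line \<eta>"
    and "\<phi> \<equiv> phi \<eta>"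
  assumes "n \<ge> 3"
    and "inj_on z {1..n - 1}" and "z (n - 2) = 0" and "z (n - 1) = 1"
    and "(\<Sum>i = 1..n - 1. c i) = 0"
    and "(\<Sum>i = 1..n - 1. z i * c i) = 1 - of_nat n / 2"
    and "real_monodromy n z c"
    and "ratio_of_solutions n z c \<eta>"
    and "branches_related_by PSL2R \<eta>"
  shows
    "\<exists>\<C>. (finite \<C> \<and> disjoint \<C> \<and> \<Union>\<C> = Z \<and>
           (\<forall>C\<in>\<C>. simple_closed_analytic_curve C \<and> C \<subseteq> X)) \<and>
       ((\<forall>w\<in>X - Z. \<exists>!r. phi_value \<eta> w r) \<and>
        (\<forall>w\<in>X - Z.
           (\<lambda>x. complex_of_real (\<phi> x)) differentiable (at w) \<and>
           wirtinger_bar (\<lambda>x. complex_of_real (\<phi> x)) differentiable (at w) \<and>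
           wirtinger (wirtinger_bar (\<lambda>x. complex_of_real (\<phi> x))) w
             = 1 / 2 * complex_of_real (exp (\<phi> w))) \<and>
        (\<forall>i\<in>{1..n - 1}.
           (\<lambda>w. \<phi> w - (- 2 * ln (cmod (w - z i)) - 2 * ln \<bar>ln (cmod (w - z i))\<bar>))
             \<in> o[at (z i)](\<lambda>_. 1)) \<and>
        (\<lambda>w. \<phi> w - (- 2 * ln (cmod w) - 2 * ln (ln (cmod w)))) \<in> o[at_infinity](\<lambda>_. 1)) \<and>
       (\<forall>C\<in>\<C>. \<forall>S z0 v F.
          schwarz_function S C \<longrightarrow> z0 \<in> C \<longrightarrow> \<not> tangent_to v C z0 \<longrightarrow> approaches_along F z0 v \<longrightarrow>
          (\<exists>E. E \<in> O[F](\<lambda>x. x - z0) \<and>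
             (\<forall>\<^sub>F x in F. x \<in> X - Z \<and>
                complex_of_real (exp (\<phi> x)) =
                  - (4 * deriv S z0 / (cnj x - cnj z0 - deriv S z0 * (x - z0))\<^sup>2) * (1 + E x))))"
proof -
  obtain p u1 u2 where basis: "solution_basis n z c p u1 u2" and \<eta>: "\<eta> = ratio_branches X p u1 u2"
    using \<open>ratio_of_solutions n z c \<eta>\<close> unfolding ratio_of_solutions_def X_def by blast
  obtain W where "solution_pair X (potential n z c) p u1 u2 W"
    using solution_basis_imp_solution_pair[OF basis] unfolding X_def by blast
  then interpret solution_pair X "potential n z c" p u1 u2 W .
  interpret real_solution_pair X "potential n z c" p u1 u2 W
    by unfold_locales (use \<open>branches_related_by PSL2R \<eta>\<close> \<eta> in simp)
  have Z: "Z = {w \<in> X. hermitian_form w = 0}"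
    unfolding Z_def \<eta> using preimage_real_line_iff by blast
  have XZ: "x \<in> X - Z \<longleftrightarrow> x \<in> X \<and> hermitian_form x \<noteq> 0" for x unfolding Z by blast
  have wX: "w \<in> X" "hermitian_form w \<noteq> 0" if "w \<in> X - Z" for w using that unfolding XZ by simp_all
  have \<phi>: "\<phi> = phi (ratio_branches X p u1 u2)" by (simp add: \<phi>_def \<eta>)
  have finite_puncture:
    "\<forall>\<^sub>F w in at (z i). w \<in> X - Z"
    "((\<lambda>w. \<phi> w - (- 2 * ln (cmod (w - z i)) - 2 * ln \<bar>ln (cmod (w - z i))\<bar>)) \<longlongrightarrow> 0) (at (z i))"
    if i: "i \<in> {1..n - 1}" for i
  proof -
    obtain R \<rho> where R: "R holomorphic_on ball 0 \<rho>" "\<rho> > 0" "R 0 = 0"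
      and 1: "\<And>s. Re s < ln \<rho> \<Longrightarrow> z i + exp (1 * s) \<in> X"
      and 2: "\<And>s. Re s < ln \<rho> \<Longrightarrow> potential n z c (z i + exp (1 * s)) * exp (2 * 1 * s) = 1 / 4 - R (exp s)"
      using potential_at_finite_puncture[OF \<open>inj_on z {1..n - 1}\<close> i, of c] unfolding X_def by blast
    have lim: "filterlim (\<lambda>w. w - z i) (at 0) (at (z i))"
      unfolding filterlim_at by (auto intro!: tendsto_eq_intros simp: eventually_at_filter)
    note asy = phi_asymptotics_at_puncture[OF disjI1[OF refl] R 1 2, of "\<lambda>y. z i + y"]
    have "\<forall>\<^sub>F y in at 0. z i + y \<in> X \<and> hermitian_form (z i + y) \<noteq> 0" by (rule asy(1)) simp_all
    from eventually_compose_filterlim[OF this lim] show "\<forall>\<^sub>F w in at (z i). w \<in> X - Z" unfolding XZ by simp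
    have "((\<lambda>y. \<phi> (z i + y) + (2 * Re 1 * ln (norm y) + 2 * ln \<bar>ln (norm y)\<bar>)) \<longlongrightarrow> 0) (at 0)"
      unfolding \<phi> by (rule asy(2)) simp_all
    from filterlim_compose[OF this lim]
    show "((\<lambda>w. \<phi> w - (- 2 * ln (cmod (w - z i)) - 2 * ln \<bar>ln (cmod (w - z i))\<bar>)) \<longlongrightarrow> 0) (at (z i))"
      by (simp add: algebra_simps)
  qed
  have infinite_puncture:
    "\<forall>\<^sub>F w in at_infinity. w \<in> X - Z"
    "((\<lambda>w. \<phi> w - (- 2 * ln (cmod w) - 2 * ln (ln (cmod w)))) \<longlongrightarrow> 0) at_infinity"
  proof -
    obtain R \<rho> where R: "R holomorphic_on ball 0 \<rho>" "\<rho> > 0" "R 0 = 0"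
      and 1: "\<And>s. Re s < ln \<rho> \<Longrightarrow> 0 + exp ((- 1) * s) \<in> X"
      and 2: "\<And>s. Re s < ln \<rho> \<Longrightarrow> potential n z c (0 + exp ((- 1) * s)) * exp (2 * (- 1) * s) = 1 / 4 - R (exp s)"
      using potential_at_infinity[OF assms(4,8,9)] unfolding X_def by blast
    have lim: "filterlim inverse (at 0) (at_infinity :: complex filter)"
      by (simp add: filterlim_inverse_at_iff filterlim_ident)
    note asy = phi_asymptotics_at_puncture[OF disjI2[OF refl] R 1 2, of inverse]
    have "\<forall>\<^sub>F y in at 0. inverse y \<in> X \<and> hermitian_form (inverse y) \<noteq> 0" by (rule asy(1)) (simp_all add: exp_minus)
    from eventually_compose_filterlim[OF this lim] show "\<forall>\<^sub>F w in at_infinity. w \<in> X - Z" unfolding XZ by simp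
    have "((\<lambda>y. \<phi> (inverse y) + (2 * Re (- 1) * ln (norm y) + 2 * ln \<bar>ln (norm y)\<bar>)) \<longlongrightarrow> 0) (at 0)"
      unfolding \<phi> by (rule asy(2)) (simp_all add: exp_minus)
    from filterlim_compose[OF this lim]
    have l: "((\<lambda>w. \<phi> w + (- 2 * ln (norm (inverse w)) + 2 * ln \<bar>ln (norm (inverse w))\<bar>)) \<longlongrightarrow> 0) at_infinity"
      by simp
    have "\<forall>\<^sub>F w :: complex in at_infinity. 2 \<le> norm w" unfolding eventually_at_infinity by blast
    then have "\<forall>\<^sub>F w in at_infinity. \<phi> w + (- 2 * ln (norm (inverse w)) + 2 * ln \<bar>ln (norm (inverse w))\<bar>)
       = \<phi> w - (- 2 * ln (cmod w) - 2 * ln (ln (cmod w)))"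
    proof eventually_elim
      case (elim w)
      \<comment> \<open>Here ln |w| is positive, so the absolute value in the general formula
        becomes ln (ln |w|).\<close>
      then have w: "norm w > 1" by linarith
      then have "ln (norm w) > 0" by (rule ln_gt_zero)
      moreover have "ln (norm (inverse w)) = - ln (norm w)" using w by (simp add: norm_inverse ln_inverse)
      ultimately show ?case by simp
    qed
    with l show "((\<lambda>w. \<phi> w - (- 2 * ln (cmod w) - 2 * ln (ln (cmod w)))) \<longlongrightarrow> 0) at_infinity"
      by (rule Lim_transform_eventually)
  qed
  have "compact Z"
  proof -
    have "bounded Z"
    proof -
      obtain b where "\<And>w. b \<le> norm w \<Longrightarrow> w \<in> X - Z"
        using infinite_puncture(1) unfolding eventually_at_infinity by blast
      then have "\<not> b \<le> norm w" if "w \<in> Z" for w using that by blast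
      then have "norm w \<le> b" if "w \<in> Z" for w using that by force
      then show ?thesis unfolding bounded_iff by blast
    qed
    moreover have "closed Z"
    proof -
      have "\<forall>\<^sub>F x in nhds w. x \<in> - Z" if w: "w \<in> - Z" for w
      proof (cases "w \<in> X")
        case True
        have "open (X \<inter> hermitian_form -` (- {0}))"
          by (intro continuous_open_preimage continuous_on_hermitian_form open_X) auto
        moreover have "w \<in> X \<inter> hermitian_form -` (- {0})" using True w by (auto simp: Z)
        ultimately have "\<forall>\<^sub>F x in nhds w. x \<in> X \<inter> hermitian_form -` (- {0})" by (rule eventually_nhds_in_open)
        then show ?thesis by eventually_elim (simp add: Z)
      next
        \<comment> \<open>A puncture, near which the form has no zeros: \<open>Z\<close> is closed
          in the plane and not merely in \<open>X\<close>.\<close>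
        case False
        then obtain i where i: "i \<in> {1..n - 1}" "w = z i" unfolding X_def punctured_plane_def by blast
        have "\<forall>\<^sub>F x in at w. x \<in> - Z" unfolding i(2) using finite_puncture(1)[OF i(1)] by eventually_elim simp
        then show ?thesis using w unfolding eventually_at_filter by (auto elim: eventually_mono)
      qed
      then have "\<exists>T. open T \<and> w \<in> T \<and> T \<subseteq> - Z" if "w \<in> - Z" for w
        using that unfolding eventually_nhds by (metis subsetI)
      then have "open (- Z)" by (subst open_subopen) blast
      then show ?thesis by (simp add: closed_def)
    qed
    ultimately show ?thesis by (simp add: compact_eq_bounded_closed)
  qed
  then have "\<exists>\<C>. finite \<C> \<and> disjoint \<C> \<and> \<Union>\<C> = Z \<and> (\<forall>C\<in>\<C>. simple_closed_analytic_curve C)"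
  proof (rule compact_level_set_union_of_curves)
    fix w assume "w \<in> Z"
    then have "w \<in> X" by (simp add: Z)
    then show "\<exists>U f. open U \<and> w \<in> U \<and> f holomorphic_on U \<and> deriv f w \<noteq> 0 \<and>
       (\<forall>x\<in>U. (x \<in> Z \<longleftrightarrow> Im (f x) = 0) \<and> (x \<in> {x \<in> X. hermitian_form x > 0} \<longleftrightarrow> Im (f x) > 0))"
      unfolding Z by (rule real_locus_chart)
  qed
  then obtain \<C> where \<C>: "finite \<C>" "disjoint \<C>" "\<Union>\<C> = Z" "\<And>C. C \<in> \<C> \<Longrightarrow> simple_closed_analytic_curve C"
    by blast
  show ?thesis
  proof (intro exI[of _ \<C>] conjI ballI allI impI)
    show "finite \<C>" "disjoint \<C>" "\<Union>\<C> = Z" by (rule \<C>)+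
    show "simple_closed_analytic_curve C" if "C \<in> \<C>" for C using \<C>(4)[OF that] .
    show "C \<subseteq> X" if "C \<in> \<C>" for C using that \<C>(3) Z by blast
    show "\<exists>!r. phi_value \<eta> w r" if "w \<in> X - Z" for w
      unfolding \<eta> by (rule phi_eq(1)[OF wX[OF that]])
    show "(\<lambda>x. complex_of_real (\<phi> x)) differentiable (at w)" if "w \<in> X - Z" for w
      unfolding \<phi> by (rule liouville_equation_phi(1)[OF wX[OF that]])
    show "wirtinger_bar (\<lambda>x. complex_of_real (\<phi> x)) differentiable (at w)" if "w \<in> X - Z" for w
      unfolding \<phi> by (rule liouville_equation_phi(2)[OF wX[OF that]])
    show "wirtinger (wirtinger_bar (\<lambda>x. complex_of_real (\<phi> x))) w = 1 / 2 * complex_of_real (exp (\<phi> w))"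
      if "w \<in> X - Z" for w
      unfolding \<phi> by (rule liouville_equation_phi(3)[OF wX[OF that]])
    show "(\<lambda>w. \<phi> w - (- 2 * ln (cmod (w - z i)) - 2 * ln \<bar>ln (cmod (w - z i))\<bar>)) \<in> o[at (z i)](\<lambda>_. 1)"
      if "i \<in> {1..n - 1}" for i
      using finite_puncture(2)[OF that] by (intro smalloI_tendsto) simp_all
    show "(\<lambda>w. \<phi> w - (- 2 * ln (cmod w) - 2 * ln (ln (cmod w)))) \<in> o[at_infinity](\<lambda>_. 1)"
      using infinite_puncture(2) by (intro smalloI_tendsto) simp_all
    fix C S z0 v F
    assume C: "C \<in> \<C>" and S: "schwarz_function S C" and z0: "z0 \<in> C"
      and nt: "\<not> tangent_to v C z0" and F: "approaches_along F z0 v"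
    have "C \<subseteq> {x \<in> X. hermitian_form x = 0}" using C \<C>(3) Z by blast
    from phi_schwarz_asymptotics[OF \<C>(4)[OF C] this z0 S nt F]
    show "\<exists>E. E \<in> O[F](\<lambda>x. x - z0) \<and>
             (\<forall>\<^sub>F x in F. x \<in> X - Z \<and>
                complex_of_real (exp (\<phi> x)) =
                  - (4 * deriv S z0 / (cnj x - cnj z0 - deriv S z0 * (x - z0))\<^sup>2) * (1 + E x))"
      unfolding \<phi> XZ by (simp only: conj_assoc)
  qed
qed

end
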